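(* The problem $\max\{C_d(P) : P\in\mathcal{SP}(G)\}$, where the input $G$ is a weighted graph, is NP-hard.
   Context: A weighted graph $G=(V,E)$ is a possibly directed graph whose edges carry positive weights (encoded as rationals in binary); in a directed graph an undirected edge is understood as a pair of oppositely directed edges. $G$ is assumed connected if undirected and weakly connected if directed. A path is a finite sequence of distinct vertices in which consecutive vertices are adjacent (a single vertex is allowed); its length is the sum of the weights of its edges. $\mathcal{SP}(G)$ is the set of all shortest (minimum-length) paths between all pairs of nodes of $G$. The neighbourhood of a path $P$ is $\mathcal{N}(P)=\{v:(u,v)\in E,\ u\in P\}\setminus P$, and its path degree centrality is $C_d(P)=|\mathcal{N}(P)|$ (edge weights do not enter $C_d$). *)

theory Defs
  imports
    "HOL-Computational_Algebra.Polynomial"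
    "Graph_Theory.Digraph_Component"
    "Graph_Theory.Pair_Digraph"
    "Graph_Theory.Vertex_Walk"
begin

section \<open>Turing machines and NP-hardness\<close>

text \<open>
  Deterministic multi-tape Turing machines with two-way infinite tapes. States and tape symbols
  are initial segments of the natural numbers; symbol 0 is the blank, and the input alphabet
  consists of the symbols 1 and 2, which represent the bits 0 and 1.
  Values of the transition function outside the range checked by \<open>wf_tm\<close> are never used.
\<close>

datatype direction = Left | Stay | Right

record tm =
  tapes :: nat
  states :: nat
  symbols :: nat
  start :: nat
  accept :: nat
  reject :: nat
  delta :: "nat \<Rightarrow> nat list \<Rightarrow> nat \<times> (nat \<times> direction) list"

definition wf_tm :: "tm \<Rightarrow> bool" where
  "wf_tm M \<longleftrightarrow>
     2 \<le> tapes M \<and> 3 \<le> symbols M \<and>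
     start M < states M \<and> accept M < states M \<and> reject M < states M \<and> accept M \<noteq> reject M \<and>
     (\<forall>q < states M. \<forall>ss. length ss = tapes M \<and> (\<forall>s \<in> set ss. s < symbols M) \<longrightarrow>
        fst (delta M q ss) < states M \<and>
        length (snd (delta M q ss)) = tapes M \<and>
        (\<forall>a \<in> set (snd (delta M q ss)). fst a < symbols M))"

record config =
  state :: nat
  head_pos :: "nat \<Rightarrow> int"
  content :: "nat \<Rightarrow> int \<Rightarrow> nat"

definition halted :: "tm \<Rightarrow> config \<Rightarrow> bool" where
  "halted M c \<longleftrightarrow> state c = accept M \<or> state c = reject M"

fun offset :: "direction \<Rightarrow> int" where
  "offset Left = - 1"
| "offset Stay = 0"
| "offset Right = 1"

definition step :: "tm \<Rightarrow> config \<Rightarrow> config" where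
  "step M c =
     (if halted M c then c
      else let (q, acts) = delta M (state c) (map (\<lambda>i. content c i (head_pos c i)) [0..<tapes M])
           in \<lparr> state = q,
                head_pos = (\<lambda>i. if i < tapes M
                                then head_pos c i + offset (snd (acts ! i)) else head_pos c i),
                content = (\<lambda>i. if i < tapes M
                               then (content c i)(head_pos c i := fst (acts ! i))
                               else content c i) \<rparr>)"

definition tape_of :: "bool list \<Rightarrow> int \<Rightarrow> nat" where
  "tape_of x i = (if 0 \<le> i \<and> i < int (length x) then (if x ! nat i then 2 else 1) else 0)"

text \<open>The \<open>i\<close>-th input word is written on tape \<open>i\<close>; all other tapes are blank.\<close>

definition initial :: "tm \<Rightarrow> bool list list \<Rightarrow> config" where
  "initial M xs =
     \<lparr> state = start M,
       head_pos = (\<lambda>_. 0),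
       content = (\<lambda>i. if i < length xs then tape_of (xs ! i) else tape_of []) \<rparr>"

definition run :: "tm \<Rightarrow> bool list list \<Rightarrow> nat \<Rightarrow> config" where
  "run M xs t = (step M ^^ t) (initial M xs)"

definition accepts :: "tm \<Rightarrow> bool list list \<Rightarrow> bool" where
  "accepts M xs \<longleftrightarrow> (\<exists>t. state (run M xs t) = accept M)"

text \<open>The output of a halting computation is the word written on tape 1.\<close>

definition outputs :: "tm \<Rightarrow> bool list list \<Rightarrow> bool list \<Rightarrow> bool" where
  "outputs M xs y \<longleftrightarrow> (\<exists>t. halted M (run M xs t) \<and> content (run M xs t) 1 = tape_of y)"

definition poly_time_tm :: "nat \<Rightarrow> tm \<Rightarrow> bool" where
  "poly_time_tm r M \<longleftrightarrow>
     wf_tm M \<and>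
     (\<exists>p :: nat poly. \<forall>xs. length xs = r \<longrightarrow>
        halted M (run M xs (poly p (sum_list (map length xs)))))"

definition poly_time_computable :: "(bool list \<Rightarrow> bool list) \<Rightarrow> bool" where
  "poly_time_computable f \<longleftrightarrow> (\<exists>M. poly_time_tm 1 M \<and> (\<forall>x. outputs M [x] (f x)))"

definition NP :: "bool list set set" where
  "NP = {L. \<exists>M (p :: nat poly). poly_time_tm 2 M \<and>
           (\<forall>x. x \<in> L \<longleftrightarrow> (\<exists>c. length c \<le> poly p (length x) \<and> accepts M [x, c]))}"

definition poly_reducible :: "bool list set \<Rightarrow> bool list set \<Rightarrow> bool" where
  "poly_reducible L H \<longleftrightarrow> (\<exists>f. poly_time_computable f \<and> (\<forall>x. x \<in> L \<longleftrightarrow> f x \<in> H))"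

definition NP_hard :: "bool list set \<Rightarrow> bool" where
  "NP_hard H \<longleftrightarrow> (\<forall>L \<in> NP. poly_reducible L H)"

section \<open>Optimization problems\<close>

text \<open>
  Natural numbers are written in binary, least significant bit first. In a sequence of numbers
  each bit is preceded by the marker \<open>True\<close>, and each number is terminated by \<open>False\<close>.
\<close>

fun nat_bits :: "nat \<Rightarrow> bool list" where
  "nat_bits n = (if n = 0 then [] else odd n # nat_bits (n div 2))"

declare nat_bits.simps [simp del]

definition encode_nat :: "nat \<Rightarrow> bool list" where
  "encode_nat n = concat (map (\<lambda>b. [True, b]) (nat_bits n)) @ [False]"

definition encode_nats :: "nat list \<Rightarrow> bool list" where
  "encode_nats ns = concat (map encode_nat ns)"

text \<open>
  A maximization problem has a set \<open>I\<close> of instances, and asks for the maximum of \<open>val i s\<close> over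
  all feasible solutions \<open>s \<in> feas i\<close> of a given instance \<open>i\<close>. An instance is presented by any one
  of its codes. As usual, the complexity of the maximization problem is that of its threshold
  version: given \<open>i\<close> and \<open>k\<close>, decide whether the maximum is at least \<open>k\<close>.
\<close>

definition threshold_language ::
  "'i set \<Rightarrow> ('i \<Rightarrow> nat list set) \<Rightarrow> ('i \<Rightarrow> 's set) \<Rightarrow> ('i \<Rightarrow> 's \<Rightarrow> nat) \<Rightarrow> bool list set" where
  "threshold_language I codes feas val =
     {encode_nats (k # ns) | k ns i. i \<in> I \<and> ns \<in> codes i \<and> k \<le> Max (val i ` feas i)}"

definition NP_hard_max ::
  "'i set \<Rightarrow> ('i \<Rightarrow> nat list set) \<Rightarrow> ('i \<Rightarrow> 's set) \<Rightarrow> ('i \<Rightarrow> 's \<Rightarrow> nat) \<Rightarrow> bool" where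
  "NP_hard_max I codes feas val \<longleftrightarrow> NP_hard (threshold_language I codes feas val)"

section \<open>Weighted graphs, shortest paths and path degree centrality\<close>

text \<open>
  An undirected graph is the special case of a symmetric arc set with symmetric weights.
  For arbitrary digraphs, \<^const>\<open>connected\<close> is weak connectivity; it includes that the
  vertex set is nonempty.
\<close>

definition weighted_graph :: "'a pair_pre_digraph \<Rightarrow> ('a \<times> 'a \<Rightarrow> rat) \<Rightarrow> bool" where
  "weighted_graph G w \<longleftrightarrow>
     pair_digraph G \<and> connected (with_proj G) \<and> (\<forall>e \<in> parcs G. 0 < w e)"

definition path_length :: "('a \<times> 'a \<Rightarrow> rat) \<Rightarrow> 'a list \<Rightarrow> rat" where
  "path_length w P = sum_list (map w (vwalk_arcs P))"

definition shortest_paths :: "'a pair_pre_digraph \<Rightarrow> ('a \<times> 'a \<Rightarrow> rat) \<Rightarrow> 'a list set" where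
  "shortest_paths G w =
     {P. vpath P (with_proj G) \<and>
         (\<forall>Q. vpath Q (with_proj G) \<and> hd Q = hd P \<and> last Q = last P \<longrightarrow>
              path_length w P \<le> path_length w Q)}"

definition path_neighbourhood :: "'a pair_pre_digraph \<Rightarrow> 'a list \<Rightarrow> 'a set" where
  "path_neighbourhood G P = {v. \<exists>u \<in> set P. (u, v) \<in> parcs G} - set P"

definition path_degree :: "'a pair_pre_digraph \<Rightarrow> 'a list \<Rightarrow> nat" where
  "path_degree G P = card (path_neighbourhood G P)"

text \<open>
  As an input, a graph has the vertices \<open>0, \<dots>, n - 1\<close> and is given by \<open>n\<close> and a list of its arcs
  in any order, each with the numerator and the denominator of its (positive) weight.
\<close>

definition arc_code :: "(nat \<times> nat \<Rightarrow> rat) \<Rightarrow> nat \<times> nat \<Rightarrow> nat list" where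
  "arc_code w e =
     [fst e, snd e, nat (fst (quotient_of (w e))), nat (snd (quotient_of (w e)))]"

definition graph_codes :: "nat pair_pre_digraph \<Rightarrow> (nat \<times> nat \<Rightarrow> rat) \<Rightarrow> nat list set" where
  "graph_codes G w =
     {n # concat (map (arc_code w) as) | n as.
        pverts G = {0..<n} \<and> distinct as \<and> set as = parcs G}"

section \<open>Consistency of the definitions\<close>

lemma encode_nat_append_inj:
  assumes "encode_nat m @ xs = encode_nat n @ ys"
  shows "m = n \<and> xs = ys"
  using assms
proof (induction m arbitrary: n rule: less_induct)
  case (less m)
  have unfold0: "encode_nat 0 = [False]"
    by (simp add: encode_nat_def nat_bits.simps[of 0])
  have unfold: "encode_nat k = True # odd k # encode_nat (k div 2)" if "k \<noteq> 0" for k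
    using that by (simp add: encode_nat_def nat_bits.simps[of k])
  show ?case
  proof (cases "m = 0 \<or> n = 0")
    case True
    then show ?thesis
      using less.prems by (cases "m = 0"; cases "n = 0") (auto simp: unfold0 unfold)
  next
    case False
    then have "odd m = odd n" "encode_nat (m div 2) @ xs = encode_nat (n div 2) @ ys"
      using less.prems by (auto simp: unfold)
    moreover have "m div 2 < m"
      using False by simp
    ultimately have "m div 2 = n div 2" "xs = ys" "odd m = odd n"
      using less.IH by blast+
    then show ?thesis
      by (metis odd_two_times_div_two_succ even_two_times_div_two)
  qed
qed

lemma encode_nats_inj: "encode_nats ms = encode_nats ns \<Longrightarrow> ms = ns"
proof (induction ms arbitrary: ns)
  case Nil
  then show ?case
    by (cases ns) (auto simp: encode_nats_def encode_nat_def)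
next
  case (Cons m ms)
  then obtain n ns' where "ns = n # ns'"
    by (cases ns) (auto simp: encode_nats_def encode_nat_def)
  then show ?case
    using Cons encode_nat_append_inj[of m "encode_nats ms" n "encode_nats ns'"]
    by (auto simp: encode_nats_def)
qed

lemma arc_code_inj:
  assumes "arc_code w e = arc_code w' e'" "0 < w e" "0 < w' e'"
  shows "e = e' \<and> w e = w' e'"
proof -
  obtain a b a' b' where q: "quotient_of (w e) = (a, b)" "quotient_of (w' e') = (a', b')"
    by fastforce
  have pos: "b > 0" "b' > 0"
    using q quotient_of_denom_pos by blast+
  have wab: "w e = of_int a / of_int b" "w' e' = of_int a' / of_int b'"
    using q quotient_of_div by blast+
  have "a > 0" "a' > 0"
    using assms(2,3) pos wab by (auto simp: zero_less_divide_iff)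
  moreover have "e = e'" "nat a = nat a'" "nat b = nat b'"
    using assms(1) q by (auto simp: arc_code_def prod_eq_iff)
  ultimately show ?thesis
    using wab pos by (simp add: eq_nat_nat_iff)
qed

lemma concat_arc_code_inj:
  assumes "concat (map (arc_code w) as) = concat (map (arc_code w') bs)"
    and "\<forall>e \<in> set as. 0 < w e" "\<forall>e \<in> set bs. 0 < w' e"
  shows "as = bs \<and> (\<forall>e \<in> set as. w e = w' e)"
  using assms
proof (induction as arbitrary: bs)
  case Nil
  then show ?case
    by (cases bs) (auto simp: arc_code_def)
next
  case (Cons a as)
  obtain b bs' where bs: "bs = b # bs'"
    using Cons.prems(1) by (cases bs) (auto simp: arc_code_def)
  have "arc_code w a = arc_code w' b"
    "concat (map (arc_code w) as) = concat (map (arc_code w') bs')"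
    using Cons.prems(1) by (simp_all add: bs arc_code_def[of w a] arc_code_def[of w' b])
  then have "as = bs' \<and> (\<forall>e \<in> set as. w e = w' e)" 
    using Cons.IH[of bs'] Cons.prems(2,3) by (simp add: bs)
  moreover have "a = b \<and> w a = w' b"
    using \<open>arc_code w a = arc_code w' b\<close> Cons.prems(2,3) by (intro arc_code_inj) (auto simp: bs)
  ultimately show ?case
    by (auto simp: bs)
qed

lemma graph_codes_unique:
  assumes "weighted_graph G w" "weighted_graph G' w'"
    and "ns \<in> graph_codes G w" "ns \<in> graph_codes G' w'"
  shows "G = G' \<and> (\<forall>e \<in> parcs G. w e = w' e)"
proof -
  obtain n as where 1: "ns = n # concat (map (arc_code w) as)" "pverts G = {0..<n}"
    "set as = parcs G"
    using assms(3) by (auto simp: graph_codes_def)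
  obtain n' as' where 2: "ns = n' # concat (map (arc_code w') as')" "pverts G' = {0..<n'}"
    "set as' = parcs G'"
    using assms(4) by (auto simp: graph_codes_def)
  have "as = as' \<and> (\<forall>e \<in> set as. w e = w' e)"
    using assms(1,2) 1 2 by (intro concat_arc_code_inj) (auto simp: weighted_graph_def)
  moreover have "n = n'"
    using 1 2 by simp
  ultimately show ?thesis
    using 1 2 by (auto intro: pair_pre_digraph.equality)
qed

lemma
  assumes "weighted_graph G w"
  shows finite_shortest_paths: "finite (shortest_paths G w)"
    and shortest_paths_nonempty: "shortest_paths G w \<noteq> {}"
proof -
  have fin: "finite (pverts G)"
    using assms pair_fin_digraph.pair_finite_verts
    by (auto simp: weighted_graph_def pair_digraph_def)
  have "shortest_paths G w \<subseteq> {P. set P \<subseteq> pverts G \<and> distinct P}"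
    by (auto simp: shortest_paths_def vpath_def vwalk_def)
  moreover have "{P. set P \<subseteq> pverts G \<and> distinct P} \<subseteq>
      {P. set P \<subseteq> pverts G \<and> length P \<le> card (pverts G)}"
    using fin by (metis (no_types, lifting) Collect_mono card_mono distinct_card)
  ultimately show "finite (shortest_paths G w)"
    using finite_lists_length_le[OF fin] by (meson finite_subset)
  obtain v where v: "v \<in> pverts G"
    using assms by (auto simp: weighted_graph_def connected_def strongly_connected_def)
  have "Q = [v]" if "vpath Q (with_proj G)" "hd Q = v" "last Q = v" for Q
    using that by (cases Q) (auto split: if_splits)
  then have "[v] \<in> shortest_paths G w"
    using v by (auto simp: shortest_paths_def intro!: vpathI)
  then show "shortest_paths G w \<noteq> {}"
    by blast
qed

end

theory Submission
  imports Defs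
begin

text \<open>
  The proof reduces every language in NP directly to the path problem.

  The computation of a verifier is a grid of cells, one row per time step and one column per tape
  position, where each cell carries one of finitely many tiles. A tile records the state, the
  symbols that are read, the symbols of the column and on which side of the column each head is.
  Since the tiles broadcast the state and the symbols read along their row, whether the grid is a
  correct accepting computation depends only on conditions on single cells and on pairs of
  horizontally or vertically adjacent cells.

  Numbering the cells row by row, the graph has a layer of vertices for each cell, one vertex per
  tile, with all arcs from each layer to the next. All weights are 1, so a path through all layers
  is shortest, and it is just a choice of a tile for every cell. Each condition has many copies of
  a vertex, with arcs from exactly those tiles which, on their own, make the condition true. There
  are more copies than layer vertices, so the degree of a path reaches the number of all copies
  of conditions iff its tiles satisfy all conditions. A common sink makes the graph connected.

  The code of this graph is produced by nested loops over polynomially bounded ranges. Such loop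
  expressions are compiled to a register machine, and each instruction of this machine is
  one step of a Turing machine that keeps a register as the position of a head.
\<close>

section \<open>Register machine programs\<close>

text \<open>\<open>NP_hard\<close> quantifies over all of \<open>NP\<close>, so some Cook-Levin
  argument is the base of any reduction; carrying it out for paths directly saves the detour over
  satisfiability. What shapes the proof is that the path degree only expresses disjunctions of
  single choices: a copy is a neighbour iff some vertex of the path points to it. Hence a relation
  between two cells becomes one clause per pair of tiles, in which "not tile \<open>a\<close>" is
  spelled out as the disjunction of all other tiles. Checking pairs suffices because the state and
  the symbols read are part of every tile; only the side on which a moved head lies needs a further
  argument, \<open>flags_determined\<close>. Paths that do not cross all layers do no harm: a path
  meets each layer at most once, so it is a partial choice, and completing it arbitrarily keeps
  every condition that it already meets. Registers hold numbers in unary. This is affordable since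
  all numbers that occur are polynomial in the input length; only the output is in binary.\<close>

datatype com =
    Nop
  | Inc nat
  | Dec nat
  | Put bool
  | Fwd
  | Back
  | Get nat
  | Scan nat
  | Seq com com
  | Cond nat com com
  | Loop nat com

datatype action = ANop | AInc nat | ADec nat | APut bool | AFwd | ABack | AScan nat

text \<open>
  The memory consists of the registers, the position of the head on the input, and the output
  written so far. Control is a stack of commands that remain to be executed; the finitely many
  stacks that can arise from a program become the states of the Turing machine.
\<close>

type_synonym mem = "(nat \<Rightarrow> nat) \<times> int \<times> bool list"

text \<open>Control may depend only on which registers are zero and on the scanned symbol, for this
  is all that a Turing machine sees in one step. The test of a \<open>Loop\<close> also takes one
  unit from its counter (see \<open>next_action\<close>).\<close>

fun next_stack :: "com list \<Rightarrow> (nat \<Rightarrow> bool) \<Rightarrow> nat \<Rightarrow> com list" where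
  "next_stack [] nz \<sigma> = []"
| "next_stack (Seq a b # ks) nz \<sigma> = a # b # ks"
| "next_stack (Cond r a b # ks) nz \<sigma> = (if nz r then a # ks else b # ks)"
| "next_stack (Loop r c # ks) nz \<sigma> = (if nz r then c # Loop r c # ks else ks)"
| "next_stack (Scan r # ks) nz \<sigma> = (if \<sigma> \<noteq> 0 then Scan r # ks else ks)"
| "next_stack (c # ks) nz \<sigma> = ks"

fun next_action :: "com list \<Rightarrow> (nat \<Rightarrow> bool) \<Rightarrow> nat \<Rightarrow> action" where
  "next_action (Inc r # ks) nz \<sigma> = AInc r"
| "next_action (Dec r # ks) nz \<sigma> = (if nz r then ADec r else ANop)"
| "next_action (Put b # ks) nz \<sigma> = APut b"
| "next_action (Fwd # ks) nz \<sigma> = AFwd"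
| "next_action (Back # ks) nz \<sigma> = ABack"
| "next_action (Get r # ks) nz \<sigma> = (if \<sigma> = 2 then AInc r else ANop)"
| "next_action (Scan r # ks) nz \<sigma> = (if \<sigma> \<noteq> 0 then AScan r else ANop)"
| "next_action (Loop r c # ks) nz \<sigma> = (if nz r then ADec r else ANop)"
| "next_action ks nz \<sigma> = ANop"

fun perform :: "action \<Rightarrow> mem \<Rightarrow> mem" where
  "perform ANop (R, h, y) = (R, h, y)"
| "perform (AInc r) (R, h, y) = (R(r := Suc (R r)), h, y)"
| "perform (ADec r) (R, h, y) = (R(r := R r - 1), h, y)"
| "perform (APut b) (R, h, y) = (R, h, y @ [b])"
| "perform AFwd (R, h, y) = (R, h + 1, y)"
| "perform ABack (R, h, y) = (R, h - 1, y)"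
| "perform (AScan r) (R, h, y) = (R(r := Suc (R r)), h + 1, y)"

fun com_step :: "bool list \<Rightarrow> com list \<times> mem \<Rightarrow> com list \<times> mem" where
  "com_step x (ks, R, h, y) =
     (next_stack ks (\<lambda>r. R r \<noteq> 0) (tape_of x h),
      perform (next_action ks (\<lambda>r. R r \<noteq> 0) (tape_of x h)) (R, h, y))"

text \<open>The same \<open>k\<close> serves every continuation \<open>ks\<close>, which lets the
  runs of parts be composed inside a larger stack. \<open>K\<close> is only an upper bound, so costs
  need not be exact.\<close>

definition runs :: "bool list \<Rightarrow> com \<Rightarrow> mem \<Rightarrow> mem \<Rightarrow> nat \<Rightarrow> bool" where
  "runs x c s s' K \<longleftrightarrow> (\<exists>k \<le> K. \<forall>ks. (com_step x ^^ k) (c # ks, s) = (ks, s'))"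

lemma runs_mono: "runs x c s s' K \<Longrightarrow> K \<le> K' \<Longrightarrow> runs x c s s' K'"
  unfolding runs_def using order_trans by blast

lemma runs_step:
  assumes "\<And>ks. com_step x (c # ks, s) = (ks, s')"
  shows "runs x c s s' 1"
  unfolding runs_def using assms by (intro exI[of _ 1]) simp

lemma runs_Nop: "runs x Nop s s 1"
  by (rule runs_step, cases s) simp
lemma runs_Inc: "runs x (Inc r) (R, h, y) (R(r := Suc (R r)), h, y) 1"
  by (rule runs_step) simp
lemma runs_Dec: "runs x (Dec r) (R, h, y) (R(r := R r - 1), h, y) 1"
  by (rule runs_step) (auto simp: fun_eq_iff)
lemma runs_Put: "runs x (Put b) (R, h, y) (R, h, y @ [b]) 1"
  by (rule runs_step) simp
lemma runs_Fwd: "runs x Fwd (R, h, y) (R, h + 1, y) 1"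
  by (rule runs_step) simp
lemma runs_Back: "runs x Back (R, h, y) (R, h - 1, y) 1"
  by (rule runs_step) simp
lemma runs_Get:
  "runs x (Get r) (R, h, y) (if tape_of x h = 2 then R(r := Suc (R r)) else R, h, y) 1"
  by (rule runs_step) simp

lemma runs_trans:
  assumes step: "\<And>ks. com_step x (c # ks, s) = (c1 # c2 # ks, s0)"
    and "runs x c1 s0 s1 K1" "runs x c2 s1 s2 K2"
  shows "runs x c s s2 (Suc (K1 + K2))"
proof -
  obtain k1 k2 where k: "k1 \<le> K1" "k2 \<le> K2"
    "\<And>ks. (com_step x ^^ k1) (c1 # ks, s0) = (ks, s1)"
    "\<And>ks. (com_step x ^^ k2) (c2 # ks, s1) = (ks, s2)"
    using assms unfolding runs_def by blast
  have "(com_step x ^^ Suc (k1 + k2)) (c # ks, s) = (ks, s2)" for ks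
  proof -
    have "(com_step x ^^ Suc (k1 + k2)) (c # ks, s) = (com_step x ^^ (k2 + k1)) (c1 # c2 # ks, s0)"
      by (simp add: funpow_Suc_right step add.commute del: funpow.simps com_step.simps)
    then show ?thesis by (simp add: funpow_add k)
  qed
  then show ?thesis unfolding runs_def using k(1,2)
    by (intro exI[of _ "Suc (k1 + k2)"]) auto
qed

lemma runs_cont:
  assumes step: "\<And>ks. com_step x (c # ks, s) = (c1 # ks, s0)"
    and "runs x c1 s0 s1 K"
  shows "runs x c s s1 (Suc K)"
proof -
  obtain k where k: "k \<le> K" "\<And>ks. (com_step x ^^ k) (c1 # ks, s0) = (ks, s1)"
    using assms unfolding runs_def by blast
  have "(com_step x ^^ Suc k) (c # ks, s) = (ks, s1)" for ks
    by (simp add: funpow_Suc_right step k del: funpow.simps com_step.simps)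
  then show ?thesis unfolding runs_def using k(1) by (intro exI[of _ "Suc k"]) auto
qed

lemma runs_Seq:
  assumes "runs x a s s1 K1" "runs x b s1 s2 K2"
  shows "runs x (Seq a b) s s2 (Suc (K1 + K2))"
  by (rule runs_trans[OF _ assms], cases s) simp

lemma runs_Cond:
  assumes "R r \<noteq> 0 \<Longrightarrow> runs x a (R, h, y) s K" "R r = 0 \<Longrightarrow> runs x b (R, h, y) s K"
  shows "runs x (Cond r a b) (R, h, y) s (Suc K)"
proof (cases "R r = 0")
  case True
  show ?thesis by (rule runs_cont[OF _ assms(2)[OF True]]) (simp add: True)
next
  case False
  show ?thesis by (rule runs_cont[OF _ assms(1)[OF False]]) (simp add: False)
qed

lemma runs_Loop_0: "R r = 0 \<Longrightarrow> runs x (Loop r c) (R, h, y) (R, h, y) 1"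
  by (rule runs_step) simp

lemma runs_Loop_Suc:
  assumes "R r \<noteq> 0" "runs x c (R(r := R r - 1), h, y) s1 K1" "runs x (Loop r c) s1 s2 K2"
  shows "runs x (Loop r c) (R, h, y) s2 (Suc (K1 + K2))"
  by (rule runs_trans[OF _ assms(2,3)]) (simp add: assms(1))

text \<open>Invariant rule: index \<open>j\<close> counts finished rounds. The test has already
  taken one unit when the body starts, hence \<open>n - Suc j\<close> there. The induction is on the
  number of remaining rounds.\<close>

lemma runs_Loop:
  assumes "\<And>j. j < n \<Longrightarrow> runs x c ((S j)(r := n - Suc j), h j, y j) (S (Suc j), h (Suc j), y (Suc j)) (k j)"
    and "\<And>j. j \<le> n \<Longrightarrow> S j r = n - j"
  shows "runs x (Loop r c) (S 0, h 0, y 0) (S n, h n, y n) (Suc (\<Sum>j<n. Suc (k j)))"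
proof -
  have "runs x (Loop r c) (S (n - i), h (n - i), y (n - i)) (S n, h n, y n)
          (Suc (\<Sum>j\<in>{n-i..<n}. Suc (k j)))" if "i \<le> n" for i
    using that
  proof (induction i)
    case 0
    then show ?case using runs_Loop_0[of "S n" r] assms(2)[of n] by simp
  next
    case (Suc i)
    let ?j = "n - Suc i"
    have j: "?j < n" "Suc ?j = n - i" using Suc.prems by auto
    have "{?j..<n} = insert ?j {n-i..<n}" using j by auto
    then have sum: "(\<Sum>j\<in>{?j..<n}. Suc (k j)) = Suc (k ?j) + (\<Sum>j\<in>{n-i..<n}. Suc (k j))"
      using j by simp
    have S: "S ?j r = Suc i" using assms(2)[of ?j] Suc.prems by simp
    have "runs x (Loop r c) (S ?j, h ?j, y ?j) (S n, h n, y n)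
        (Suc (k ?j + Suc (\<Sum>j\<in>{n-i..<n}. Suc (k j))))"
    proof (rule runs_Loop_Suc)
      show "S ?j r \<noteq> 0" by (simp add: S)
      show "runs x c ((S ?j)(r := S ?j r - 1), h ?j, y ?j) (S (n - i), h (n - i), y (n - i)) (k ?j)"
        using assms(1)[OF j(1)] j(2) Suc.prems by (simp add: S)
      show "runs x (Loop r c) (S (n - i), h (n - i), y (n - i)) (S n, h n, y n)
              (Suc (\<Sum>j\<in>{n-i..<n}. Suc (k j)))"
        using Suc by simp
    qed
    then show ?case by (simp add: sum)
  qed
  from this[of n] show ?thesis by (simp add: lessThan_atLeast0)
qed

lemma runs_Scan_aux:
  assumes "i \<le> length x"
  shows "runs x (Scan r) (R(r := length x - i), int (length x - i), y)
           (R(r := length x), int (length x), y) (Suc i)"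
  using assms
proof (induction i)
  case 0
  show ?case by (rule runs_mono[OF runs_step]) (auto simp: tape_of_def)
next
  case (Suc i)
  show ?case
    by (rule runs_cont[OF _ Suc.IH]) (use Suc.prems in \<open>auto simp: tape_of_def Suc_diff_Suc\<close>)
qed

lemma runs_Scan:
  "R r = 0 \<Longrightarrow> runs x (Scan r) (R, 0, y) (R(r := length x), int (length x), y) (Suc (length x))"
  using runs_Scan_aux[of "length x" x r R y] by (simp add: fun_upd_idem)

section \<open>Compilation to Turing machines\<close>

text \<open>These are the stacks between the start of \<open>c\<close> on top of \<open>ks\<close>
  and the return to \<open>ks\<close>. A loop body gets its own loop as continuation, so iterating
  it creates no new stacks and the set is finite.\<close>

fun stacks :: "com \<Rightarrow> com list \<Rightarrow> com list set" where
  "stacks (Seq a b) ks = insert (Seq a b # ks) (stacks a (b # ks) \<union> stacks b ks)"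
| "stacks (Cond r a b) ks = insert (Cond r a b # ks) (stacks a ks \<union> stacks b ks)"
| "stacks (Loop r c) ks = insert (Loop r c # ks) (stacks c (Loop r c # ks))"
| "stacks c ks = {c # ks}"

lemma finite_stacks: "finite (stacks c ks)"
  by (induction c arbitrary: ks) auto

lemma start_in_stacks: "c # ks \<in> stacks c ks"
  by (cases c) auto

lemma next_stack_in_stacks:
  "ls \<in> stacks c ks \<Longrightarrow> next_stack ls nz \<sigma> \<in> insert ks (stacks c ks)"
proof (induction c arbitrary: ks ls)
  case (Seq a b)
  then show ?case using start_in_stacks[of a "b # ks"] start_in_stacks[of b ks] by fastforce
next
  case (Cond r a b)
  then show ?case
    using start_in_stacks[of a ks] start_in_stacks[of b ks] by (auto split: if_splits)
next
  case (Loop r c)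
  then show ?case using start_in_stacks[of c "Loop r c # ks"] by fastforce
qed auto

primrec registers :: "com \<Rightarrow> nat set" where
  "registers Nop = {}"
| "registers (Inc r) = {r}"
| "registers (Dec r) = {r}"
| "registers (Put b) = {}"
| "registers Fwd = {}"
| "registers Back = {}"
| "registers (Get r) = {r}"
| "registers (Scan r) = {r}"
| "registers (Seq a b) = registers a \<union> registers b"
| "registers (Cond r a b) = insert r (registers a \<union> registers b)"
| "registers (Loop r c) = insert r (registers c)"

lemma finite_registers: "finite (registers c)"
  by (induction c) auto

lemma registers_stacks:
  "ls \<in> stacks c ks \<Longrightarrow> registers c \<subseteq> A \<Longrightarrow> \<forall>d \<in> set ks. registers d \<subseteq> A \<Longrightarrow>
   \<forall>d \<in> set ls. registers d \<subseteq> A"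
proof (induction c arbitrary: ks ls)
  case (Seq a b)
  show ?case
  proof (cases "ls = Seq a b # ks")
    case False
    then show ?thesis
      using Seq.prems Seq.IH(1)[of ls "b # ks"] Seq.IH(2)[of ls ks] by auto
  qed (use Seq.prems in auto)
next
  case (Cond r a b)
  show ?case
  proof (cases "ls = Cond r a b # ks")
    case False
    then show ?thesis
      using Cond.prems Cond.IH(1)[of ls ks] Cond.IH(2)[of ls ks] by auto
  qed (use Cond.prems in auto)
next
  case (Loop r c)
  show ?case
  proof (cases "ls = Loop r c # ks")
    case False
    then show ?thesis
      using Loop.prems Loop.IH[of ls "Loop r c # ks"] by auto
  qed (use Loop.prems in auto)
qed auto

text \<open>
  Register \<open>r\<close> is the head position of tape \<open>r + 2\<close>, which is blank except for
  a marker at position 0 that makes the test for zero possible.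
\<close>

fun tape_action :: "action \<Rightarrow> nat \<Rightarrow> nat \<Rightarrow> nat \<times> direction" where
  "tape_action (AInc r) i s = (s, if i = r + 2 then Right else Stay)"
| "tape_action (ADec r) i s = (s, if i = r + 2 then Left else Stay)"
| "tape_action (APut b) i s = (if i = 1 then (if b then 2 else 1, Right) else (s, Stay))"
| "tape_action AFwd i s = (s, if i = 0 then Right else Stay)"
| "tape_action ABack i s = (s, if i = 0 then Left else Stay)"
| "tape_action (AScan r) i s = (s, if i = 0 \<or> i = r + 2 then Right else Stay)"
| "tape_action ANop i s = (s, Stay)"

locale compile =
  fixes P :: com and n :: nat and idx :: "com list \<Rightarrow> nat"
  assumes registers: "registers P \<subseteq> {..<n}"
    and idx: "bij_betw idx (insert [] (stacks P [])) {..<card (insert [] (stacks P []))}"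
begin

abbreviation "S \<equiv> insert [] (stacks P [])"

text \<open>Two states are added to those for stacks: the start state, whose only step writes the
  markers on the register tapes, and a rejecting state that is never entered. The empty stack is the
  accepting state, so halting means that the program is finished. Tape 0 is the input and tape 1 the
  output.\<close>

definition machine :: tm where
  "machine = \<lparr> tapes = n + 2, states = card S + 2, symbols = 3,
     start = Suc (card S), accept = idx [], reject = card S,
     delta = (\<lambda>q ss.
       if q = Suc (card S) then
         (idx [P], map (\<lambda>i. (if i < 2 then ss ! i else 1, Stay)) [0..<n + 2])
       else if q < card S then
         let ks = the_inv_into S idx q; nz = (\<lambda>r. ss ! (r + 2) \<noteq> 1); \<sigma> = ss ! 0 in
         (idx (next_stack ks nz \<sigma>),
          map (\<lambda>i. tape_action (next_action ks nz \<sigma>) i (ss ! i)) [0..<n + 2])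
       else (q, map (\<lambda>i. (ss ! i, Stay)) [0..<n + 2])) \<rparr>"

lemma idx_less: "ks \<in> S \<Longrightarrow> idx ks < card S"
  using idx by (auto simp: bij_betw_def)

lemma idx_inv: "ks \<in> S \<Longrightarrow> the_inv_into S idx (idx ks) = ks"
  using idx by (intro the_inv_into_f_f) (auto simp: bij_betw_def)

lemma inv_in: "q < card S \<Longrightarrow> the_inv_into S idx q \<in> S"
  using idx by (intro the_inv_into_into) (auto simp: bij_betw_def)

lemma next_in: "ks \<in> S \<Longrightarrow> next_stack ks nz \<sigma> \<in> S"
  using next_stack_in_stacks[of ks P "[]" nz \<sigma>] by auto

lemma wf_machine: "wf_tm machine"
proof -
  have P: "[P] \<in> S" "[] \<in> S" using start_in_stacks by auto
  have act: "fst (tape_action a i s) < 3" if "s < 3" for a i s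
    using that by (cases a) auto
  have "idx [] < card S" "idx [P] < card S"
    using idx_less P by auto
  moreover have "idx (next_stack (the_inv_into S idx q) nz \<sigma>) < card S" if "q < card S" for q nz \<sigma>
    using that by (intro idx_less next_in inv_in)
  ultimately show ?thesis
    unfolding wf_tm_def machine_def
    by (auto simp: Let_def less_Suc_eq act intro!: act)
qed

fun rep :: "bool list \<Rightarrow> com list \<times> mem \<Rightarrow> config \<Rightarrow> bool" where
  "rep x (ks, R, h, y) c \<longleftrightarrow>
     ks \<in> S \<and> state c = idx ks \<and>
     head_pos c 0 = h \<and> content c 0 = tape_of x \<and>
     head_pos c 1 = int (length y) \<and> content c 1 = tape_of y \<and>
     (\<forall>r<n. head_pos c (r + 2) = int (R r) \<and> content c (r + 2) = (\<lambda>_. 0)(0 := 1))"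

lemma tape_of_snoc: "tape_of (y @ [b]) = (tape_of y)(int (length y) := if b then 2 else 1)"
  by (auto simp: tape_of_def fun_eq_iff nth_append)

text \<open>The tapes show the zero test only for registers that the program mentions; this lemma
  makes agreement on those sufficient.\<close>

lemma next_cong:
  assumes "\<forall>d \<in> set ks. registers d \<subseteq> A" "\<And>r. r \<in> A \<Longrightarrow> nz r = nz' r"
  shows "next_stack ks nz \<sigma> = next_stack ks nz' \<sigma>" "next_action ks nz \<sigma> = next_action ks nz' \<sigma>"
proof -
  show "next_stack ks nz \<sigma> = next_stack ks nz' \<sigma>"
    using assms by (cases "(ks, nz, \<sigma>)" rule: next_stack.cases) auto
  show "next_action ks nz \<sigma> = next_action ks nz' \<sigma>"
    using assms by (cases "(ks, nz, \<sigma>)" rule: next_action.cases) auto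
qed

lemma rep_step:
  assumes rep: "rep x (ks, R, h, y) c" and "ks \<noteq> []"
  shows "rep x (com_step x (ks, R, h, y)) (step machine c)"
proof -
  let ?ss = "map (\<lambda>i. content c i (head_pos c i)) [0..<n + 2]"
  let ?nz = "\<lambda>r. ?ss ! (r + 2) \<noteq> 1" and ?nz' = "\<lambda>r. R r \<noteq> 0" and ?\<sigma> = "tape_of x h"
  have ks: "ks \<in> S" "state c = idx ks" and c0: "head_pos c 0 = h" "content c 0 = tape_of x"
    and c1: "head_pos c 1 = int (length y)" "content c 1 = tape_of y"
    and cr: "\<And>r. r < n \<Longrightarrow> head_pos c (r + 2) = int (R r)"
            "\<And>r. r < n \<Longrightarrow> content c (r + 2) = (\<lambda>_. 0)(0 := 1)"
    using rep by auto
  have regs: "\<forall>d \<in> set ks. registers d \<subseteq> {..<n}"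
    using registers_stacks[of ks P "[]"] ks registers by auto
  have \<sigma>: "?ss ! 0 = ?\<sigma>" using c0 by (simp add: nth_append upt_conv_Cons)
  have nz: "?nz r = ?nz' r" if "r \<in> {..<n}" for r
    using that cr[of r] by (simp del: upt_Suc)
  let ?a = "next_action ks ?nz' ?\<sigma>" and ?ks' = "next_stack ks ?nz' ?\<sigma>"
  have ne: "idx ks \<noteq> idx []"
    using idx ks(1) \<open>ks \<noteq> []\<close> by (auto simp: bij_betw_def inj_on_def)
  have lt: "idx ks < card S" using ks idx_less by blast
  have nh: "\<not> halted machine c"
    using ne lt ks by (simp add: halted_def machine_def)
  have delta: "delta machine (state c) ?ss =
      (idx ?ks', map (\<lambda>i. tape_action ?a i (?ss ! i)) [0..<n + 2])"
    using lt ks(2) next_cong[of ks "{..<n}" ?nz ?nz' ?\<sigma>, OF regs nz]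
    by (simp only: machine_def tm.simps Let_def idx_inv[OF ks(1)] \<sigma> if_True less_not_refl split: if_split) auto
  have tp: "tapes machine = n + 2" by (simp add: machine_def)
  define acts where "acts = map (\<lambda>i. tape_action ?a i (?ss ! i)) [0..<n + 2]"
  have acts: "acts ! i = tape_action ?a i (content c i (head_pos c i))" if "i < n + 2" for i
    using that by (simp add: acts_def del: upt_Suc)
  have step: "step machine c =
    \<lparr> state = idx ?ks',
      head_pos = (\<lambda>i. if i < n + 2 then head_pos c i + offset (snd (acts ! i)) else head_pos c i),
      content = (\<lambda>i. if i < n + 2 then (content c i)(head_pos c i := fst (acts ! i)) else content c i) \<rparr>"
    by (simp only: step_def nh if_False tp delta acts_def[symmetric] Let_def prod.case)
  have areg: "?a = AInc r \<or> ?a = ADec r \<or> ?a = AScan r \<Longrightarrow> r < n" for r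
    using regs by (cases "(ks, ?nz', ?\<sigma>)" rule: next_action.cases) (auto split: if_splits)
  \<comment> \<open>A decrement is issued only for a nonzero register, so the head never moves left
    of its marker and truncated subtraction agrees with the move.\<close>
  have dec: "?a = ADec r \<Longrightarrow> R r \<noteq> 0" for r
    by (cases "(ks, ?nz', ?\<sigma>)" rule: next_action.cases) (auto split: if_splits)
  have in': "?ks' \<in> S" by (rule next_in[OF ks(1)])
  show ?thesis
    unfolding step com_step.simps
    using in' acts c0 c1 cr areg dec
    by (cases ?a) (auto simp: tape_of_snoc)
qed

lemma rep_run:
  assumes "rep x (ks, m) c"
  shows "rep x ((com_step x ^^ k) (ks, m)) ((step machine ^^ k) c)"
proof (induction k)
  case 0
  then show ?case using assms by simp
next
  case (Suc k)
  obtain ks' R h y where s: "(com_step x ^^ k) (ks, m) = (ks', R, h, y)"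
    by (metis prod.collapse)
  show ?case
  proof (cases "ks' = []")
    case True
    have "halted machine ((step machine ^^ k) c)"
      using Suc s True by (simp add: halted_def machine_def)
    then have "(step machine ^^ Suc k) c = (step machine ^^ k) c"
      by (simp add: step_def)
    moreover have "(com_step x ^^ Suc k) (ks, m) = (com_step x ^^ k) (ks, m)"
      by (simp add: s True)
    ultimately show ?thesis using Suc by simp
  next
    case False
    then show ?thesis using Suc rep_step[of x ks' R h y] by (simp add: s del: com_step.simps)
  qed
qed

lemma rep_start: "rep x ([P], (\<lambda>_. 0), 0, []) (step machine (initial machine [x]))"
proof -
  have P: "[P] \<in> S" "[] \<in> S" using start_in_stacks by auto
  have "\<not> halted machine (initial machine [x])"
    using idx_less[OF P(2)] by (auto simp: halted_def machine_def initial_def)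
  then show ?thesis
    using P by (auto simp: step_def machine_def initial_def Let_def nth_append tape_of_def fun_eq_iff
      simp del: upt_Suc)
qed

end

lemma halted_run_mono:
  assumes "halted M (run M xs t)" "t \<le> t'"
  shows "run M xs t' = run M xs t"
  using assms(2)
proof (induction t' rule: dec_induct)
  case (step i)
  then show ?case using assms(1) by (simp add: run_def step_def)
qed simp

theorem poly_time_computable_runs:
  assumes "\<And>x. \<exists>m. runs x P ((\<lambda>_. 0), 0, []) (fst m, snd m, f x) (poly p (length x))"
  shows "poly_time_computable f"
proof -
  obtain n where n: "registers P \<subseteq> {..<n}"
    using finite_registers[of P] by (meson finite_nat_iff_bounded)
  have "finite (insert [] (stacks P []))" using finite_stacks by auto
  then obtain idx where idx: "bij_betw idx (insert [] (stacks P [])) {..<card (insert [] (stacks P []))}"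
    using ex_bij_betw_finite_nat by (metis lessThan_atLeast0)
  interpret compile P n idx by standard (fact n, fact idx)
  have main: "\<exists>t \<le> Suc (poly p (length x)). halted machine (run machine [x] t) \<and>
                content (run machine [x] t) 1 = tape_of (f x)" for x
  proof -
    obtain m k where k: "k \<le> poly p (length x)"
      "(com_step x ^^ k) ([P], (\<lambda>_. 0), 0, []) = ([], fst m, snd m, f x)"
      using assms[of x] unfolding runs_def by blast
    have "rep x ([], fst m, snd m, f x) ((step machine ^^ k) (step machine (initial machine [x])))"
      using rep_run[OF rep_start, of x k] k by simp
    then have "rep x ([], fst m, snd m, f x) (run machine [x] (Suc k))"
      by (simp add: run_def funpow_Suc_right del: funpow.simps)
    then show ?thesis using k(1)
      by (intro exI[of _ "Suc k"]) (auto simp: halted_def machine_def)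
  qed
  have "poly_time_tm 1 machine"
    unfolding poly_time_tm_def
  \<comment> \<open>The additional step is the one that writes the markers.\<close>
  proof (intro conjI wf_machine exI[of _ "p + 1"] allI impI)
    fix xs :: "bool list list" assume "length xs = 1"
    then obtain x where xs: "xs = [x]" by (cases xs) auto
    obtain t where t: "t \<le> Suc (poly p (length x))" "halted machine (run machine [x] t)"
      using main by blast
    then show "halted machine (run machine xs (poly (p + 1) (sum_list (map length xs))))"
      using halted_run_mono[OF t(2), of "Suc (poly p (length x))"] by (simp add: xs)
  qed
  moreover have "outputs machine [x] (f x)" for x
    using main unfolding outputs_def by blast
  ultimately show ?thesis unfolding poly_time_computable_def by blast
qed

section \<open>Loop expressions\<close>

datatype expr =
    Const nat
  | Var nat
  | Add expr expr
  | Mul expr expr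
  | Sub expr expr
  | Bit expr

primrec val :: "bool list \<Rightarrow> expr \<Rightarrow> (nat \<Rightarrow> nat) \<Rightarrow> nat" where
  "val x (Const k) R = k"
| "val x (Var i) R = R i"
| "val x (Add a b) R = val x a R + val x b R"
| "val x (Mul a b) R = val x a R * val x b R"
| "val x (Sub a b) R = val x a R - val x b R"
| "val x (Bit a) R = of_bool (val x a R < length x \<and> x ! val x a R)"

primrec vars :: "expr \<Rightarrow> nat set" where
  "vars (Const k) = {}"
| "vars (Var i) = {i}"
| "vars (Add a b) = vars a \<union> vars b"
| "vars (Mul a b) = vars a \<union> vars b"
| "vars (Sub a b) = vars a \<union> vars b"
| "vars (Bit a) = vars a"

text \<open>
  \<open>add_expr e r t\<close> adds the value of \<open>e\<close> to register \<open>r\<close>, where the registers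
  from \<open>t\<close> on are 0 before and after, and serve as scratch space.
\<close>

primrec add_expr :: "expr \<Rightarrow> nat \<Rightarrow> nat \<Rightarrow> com" where
  "add_expr (Const k) r t = ((Seq (Inc r)) ^^ k) Nop"
| "add_expr (Var i) r t = Seq (Loop i (Seq (Inc r) (Inc t))) (Loop t (Inc i))"
| "add_expr (Add a b) r t = Seq (add_expr a r t) (add_expr b r t)"
| "add_expr (Mul a b) r t = Seq (add_expr a t (Suc t)) (Loop t (add_expr b r (Suc t)))"
| "add_expr (Sub a b) r t =
     Seq (add_expr a t (Suc t)) (Seq (add_expr b (Suc t) (Suc (Suc t)))
       (Seq (Loop (Suc t) (Dec t)) (Loop t (Inc r))))"
| "add_expr (Bit a) r t =
     Seq (add_expr a t (Suc t)) (Seq (Loop t (Seq Fwd (Inc (Suc t))))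
       (Seq (Get r) (Loop (Suc t) Back)))"

primrec cost :: "bool list \<Rightarrow> expr \<Rightarrow> (nat \<Rightarrow> nat) \<Rightarrow> nat" where
  "cost x (Const k) R = 2 * k + 1"
| "cost x (Var i) R = 6 * R i + 3"
| "cost x (Add a b) R = Suc (cost x a R + cost x b R)"
| "cost x (Mul a b) R = cost x a R + val x a R * Suc (cost x b R) + 2"
| "cost x (Sub a b) R = cost x a R + cost x b R + 2 * val x a R + 2 * val x b R + 5"
| "cost x (Bit a) R = cost x a R + 6 * val x a R + 6"

lemma val_cong: "(\<And>i. i \<in> vars e \<Longrightarrow> R i = R' i) \<Longrightarrow> val x e R = val x e R'"
  by (induction e) auto

lemma cost_cong: "(\<And>i. i \<in> vars e \<Longrightarrow> R i = R' i) \<Longrightarrow> cost x e R = cost x e R'"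
proof (induction e)
  case (Mul a b)
  then show ?case using val_cong[of a R R' x] by simp
next
  case (Sub a b)
  then show ?case using val_cong[of a R R' x] val_cong[of b R R' x] by simp
next
  case (Bit a)
  then show ?case using val_cong[of a R R' x] by simp
qed auto

lemma runs_eq: "runs x c s s' K \<Longrightarrow> s' = s'' \<Longrightarrow> K \<le> K' \<Longrightarrow> runs x c s s'' K'"
  using runs_mono by blast

lemma runs_eq_start: "runs x c s s' K \<Longrightarrow> s0 = s \<Longrightarrow> runs x c s0 s' K"
  by simp

lemma runs_move:
  assumes "a \<noteq> r"
  shows "runs x (Loop a (Inc r)) (R, h, y) (R(a := 0, r := R r + R a), h, y) (2 * R a + 1)"
proof -
  have "runs x (Loop a (Inc r)) ((\<lambda>j. R(a := R a - j, r := R r + j)) 0, h, y)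
      ((\<lambda>j. R(a := R a - j, r := R r + j)) (R a), h, y) (Suc (\<Sum>j<R a. Suc 1))"
    by (rule runs_Loop[where h="\<lambda>_. h" and y="\<lambda>_. y"], rule runs_eq[OF runs_Inc])
      (use assms in \<open>auto simp: fun_eq_iff\<close>)
  moreover have "R(a := R a - 0, r := R r + 0) = R" by auto
  ultimately show ?thesis by (auto elim!: runs_eq)
qed

lemma runs_copy:
  assumes "i \<noteq> r" "i \<noteq> t" "r \<noteq> t" "R t = 0"
  shows "runs x (Loop i (Seq (Inc r) (Inc t))) (R, h, y)
           (R(i := 0, r := R r + R i, t := R i), h, y) (4 * R i + 1)"
proof -
  define S where "S j = R(i := R i - j, r := R r + j, t := j)" for j
  have "runs x (Loop i (Seq (Inc r) (Inc t))) (S 0, h, y) (S (R i), h, y)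
      (Suc (\<Sum>j<R i. Suc (Suc (1 + 1))))"
    by (rule runs_Loop[where h="\<lambda>_. h" and y="\<lambda>_. y"], rule runs_eq[OF runs_Seq[OF runs_Inc runs_Inc]])
      (use assms in \<open>auto simp: S_def fun_eq_iff\<close>)
  moreover have "S 0 = R" "S (R i) = R(i := 0, r := R r + R i, t := R i)"
    using assms by (auto simp: S_def fun_eq_iff)
  ultimately show ?thesis by (auto elim!: runs_eq)
qed

text \<open>Reading a variable empties its register into two others and refills it afterwards. The
  target \<open>r\<close> must not occur in \<open>e\<close>, since partial sums would be read back.
  The input head is at 0 between evaluations because \<open>Bit\<close> counts its way out and
  back.\<close>

lemma runs_add_expr:
  assumes "\<And>j. t \<le> j \<Longrightarrow> R j = 0" "r < t" "r \<notin> vars e" "vars e \<subseteq> {..<t}"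
  shows "runs x (add_expr e r t) (R, 0, y) (R(r := R r + val x e R), 0, y) (cost x e R)"
  using assms
proof (induction e arbitrary: r t R)
  case (Const k)
  have "runs x ((Seq (Inc r) ^^ k) Nop) (R, 0, y) (R(r := R r + k), 0, y) (2 * k + 1)" for R
  proof (induction k arbitrary: R)
    case 0
    then show ?case using runs_Nop[of x "(R, 0, y)"] by simp
  next
    case (Suc k)
    show ?case
      by (simp, rule runs_eq[OF runs_Seq[OF runs_Inc Suc.IH]]) (auto simp: fun_eq_iff)
  qed
  from this[of R] show ?case by (simp only: add_expr.simps val.simps cost.simps)
next
  case (Var i)
  then have "i \<noteq> r" "i \<noteq> t" "r \<noteq> t" "R t = 0" by auto
  then show ?case
    unfolding add_expr.simps val.simps cost.simps
    by (intro runs_eq[OF runs_Seq[OF runs_copy runs_move]]) (auto simp: fun_eq_iff)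
next
  case (Add a b)
  let ?R = "R(r := R r + val x a R)"
  have v: "val x b ?R = val x b R" "cost x b ?R = cost x b R"
    using Add.prems by (auto intro!: val_cong cost_cong)
  have a: "runs x (add_expr a r t) (R, 0, y) (?R, 0, y) (cost x a R)"
    by (rule Add.IH(1)) (use Add.prems in auto)
  have b: "runs x (add_expr b r t) (?R, 0, y) (?R(r := ?R r + val x b ?R), 0, y) (cost x b ?R)"
    by (rule Add.IH(2)) (use Add.prems in auto)
  show ?case unfolding add_expr.simps
    by (rule runs_eq[OF runs_Seq[OF a b]]) (auto simp: v)
next
  case (Mul a b)
  let ?n = "val x a R"
  define S where "S j = R(r := R r + j * val x b R, t := ?n - j)" for j
  have a: "runs x (add_expr a t (Suc t)) (R, 0, y) (S 0, 0, y) (cost x a R)"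
    by (rule runs_eq[OF Mul.IH(1)]) (use Mul.prems in \<open>auto simp: S_def fun_eq_iff\<close>)
  have b: "runs x (Loop t (add_expr b r (Suc t))) (S 0, 0, y) (S ?n, 0, y)
      (Suc (\<Sum>j<?n. Suc (cost x b R)))"
  proof (rule runs_Loop[where h="\<lambda>_. 0" and y="\<lambda>_. y"])
    fix j assume "j < ?n"
    let ?R = "(S j)(t := ?n - Suc j)"
    have v: "val x b ?R = val x b R" "cost x b ?R = cost x b R"
      using Mul.prems by (auto simp: S_def intro!: val_cong cost_cong)
    have "runs x (add_expr b r (Suc t)) (?R, 0, y) (?R(r := ?R r + val x b ?R), 0, y) (cost x b ?R)"
      by (rule Mul.IH(2)) (use Mul.prems in \<open>auto simp: S_def\<close>)
    then show "runs x (add_expr b r (Suc t)) (?R, 0, y) (S (Suc j), 0, y) (cost x b R)"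
      unfolding v by (rule runs_eq) (use Mul.prems in \<open>auto simp: S_def fun_eq_iff\<close>)
  qed (auto simp: S_def)
  show ?case unfolding add_expr.simps
    by (rule runs_eq[OF runs_Seq[OF a b]]) (use Mul.prems in \<open>auto simp: S_def fun_eq_iff\<close>)
next
  case (Sub a b)
  let ?n = "val x a R" and ?m = "val x b R"
  have a: "runs x (add_expr a t (Suc t)) (R, 0, y) (R(t := ?n), 0, y) (cost x a R)"
    by (rule runs_eq[OF Sub.IH(1)]) (use Sub.prems in \<open>auto simp: fun_eq_iff\<close>)
  have v: "val x b (R(t := ?n)) = ?m" "cost x b (R(t := ?n)) = cost x b R"
    using Sub.prems by (auto intro!: val_cong cost_cong)
  define S where "S j = R(t := ?n - j, Suc t := ?m - j)" for j
  have b: "runs x (add_expr b (Suc t) (Suc (Suc t))) (R(t := ?n), 0, y) (S 0, 0, y) (cost x b R)"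
  proof -
    let ?R = "R(t := ?n)"
    have "runs x (add_expr b (Suc t) (Suc (Suc t))) (?R, 0, y)
        (?R(Suc t := ?R (Suc t) + val x b ?R), 0, y) (cost x b ?R)"
      by (rule Sub.IH(2)) (use Sub.prems in auto)
    then show ?thesis
      unfolding v by (rule runs_eq) (use Sub.prems in \<open>auto simp: fun_eq_iff S_def\<close>)
  qed
  have c: "runs x (Loop (Suc t) (Dec t)) (S 0, 0, y) (S ?m, 0, y) (Suc (\<Sum>j<?m. Suc 1))"
    by (rule runs_Loop[where h="\<lambda>_. 0" and y="\<lambda>_. y"], rule runs_eq[OF runs_Dec])
      (auto simp: S_def fun_eq_iff)
  show ?case unfolding add_expr.simps
    by (rule runs_eq[OF runs_Seq[OF a runs_Seq[OF b runs_Seq[OF c runs_move]]]])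
      (use Sub.prems in \<open>auto simp: S_def fun_eq_iff\<close>)
next
  case (Bit a)
  let ?n = "val x a R"
  define S where "S j = R(t := ?n - j, Suc t := j)" for j
  have a: "runs x (add_expr a t (Suc t)) (R, 0, y) (S 0, int 0, y) (cost x a R)"
    by (rule runs_eq[OF Bit.IH]) (use Bit.prems in \<open>auto simp: fun_eq_iff S_def\<close>)
  have b: "runs x (Loop t (Seq Fwd (Inc (Suc t)))) (S 0, int 0, y) (S ?n, int ?n, y)
      (Suc (\<Sum>j<?n. Suc (Suc (1 + 1))))"
    by (rule runs_Loop[where h="\<lambda>j. int j" and y="\<lambda>_. y"],
        rule runs_eq[OF runs_Seq[OF runs_Fwd runs_Inc]])
      (auto simp: S_def fun_eq_iff)
  define T where "T j = R(r := R r + val x (Bit a) R, Suc t := ?n - j)" for j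
  have bit: "(tape_of x (int ?n) = 2) = (?n < length x \<and> x ! ?n)"
    by (auto simp: tape_of_def)
  have c: "runs x (Get r) (S ?n, int ?n, y) (T 0, int ?n - int 0, y) 1"
    by (rule runs_eq[OF runs_Get], use Bit.prems in \<open>simp only: bit\<close>)
      (use Bit.prems in \<open>auto simp: S_def T_def fun_eq_iff\<close>)
  have d: "runs x (Loop (Suc t) Back) (T 0, int ?n - int 0, y) (T ?n, int ?n - int ?n, y)
     (Suc (\<Sum>j<?n. Suc 1))"
    by (rule runs_Loop[where h="\<lambda>j. int ?n - int j" and y="\<lambda>_. y"], rule runs_eq[OF runs_Back])
      (use Bit.prems in \<open>auto simp: T_def fun_eq_iff\<close>)
  have "runs x (add_expr (Bit a) r t) (R, 0, y) (T ?n, int ?n - int ?n, y) (cost x (Bit a) R)"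
    unfolding add_expr.simps
    by (rule runs_eq[OF runs_Seq[OF a[simplified] runs_Seq[OF b[simplified] runs_Seq[OF c[simplified] d[simplified]]]]])
      auto
  moreover have "T ?n = R(r := R r + val x (Bit a) R)"
    using Bit.prems by (auto simp: T_def fun_eq_iff)
  ultimately show ?case by (simp only: diff_self)
qed


section \<open>Polynomial bounds for values and evaluation costs\<close>

lemma poly_nat_mono: "a \<le> b \<Longrightarrow> poly p a \<le> poly (p :: nat poly) b"
proof (induction p)
  case (pCons c p)
  then show ?case using mult_mono[of a b "poly p a" "poly p b"] by simp
qed simp

text \<open>A single \<open>b\<close> bounds the input length and all variables, so that nested
  loops can later be handled by composing polynomials.\<close>

lemma expr_bound:
  "\<exists>p :: nat poly. \<forall>(x :: bool list) (R :: nat \<Rightarrow> nat) b. length x \<le> b \<longrightarrow> (\<forall>i \<in> vars e. R i \<le> b) \<longrightarrow>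
     val x e R \<le> poly p b \<and> cost x e R \<le> poly p b"
proof (induction e)
  case (Const k)
  show ?case by (rule exI[of _ "[:2 * k + 1:]"]) auto
next
  case (Var i)
  show ?case by (rule exI[of _ "[:3, 6:]"]) (auto intro: order_trans)
next
  case (Add a b)
  then obtain p q :: "nat poly"
    where p: "\<And>(x :: bool list) (R :: nat \<Rightarrow> nat) n. length x \<le> n \<Longrightarrow> \<forall>i \<in> vars a. R i \<le> n \<Longrightarrow>
        val x a R \<le> poly p n \<and> cost x a R \<le> poly p n"
      and q: "\<And>(x :: bool list) (R :: nat \<Rightarrow> nat) n. length x \<le> n \<Longrightarrow> \<forall>i \<in> vars b. R i \<le> n \<Longrightarrow>
        val x b R \<le> poly q n \<and> cost x b R \<le> poly q n"
    by metis
  show ?case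
  proof (intro exI[of _ "p + q + 1"] allI impI)
    fix x :: "bool list" and R n assume "length x \<le> n" "\<forall>i \<in> vars (Add a b). R i \<le> n"
    then show "val x (Add a b) R \<le> poly (p + q + 1) n \<and> cost x (Add a b) R \<le> poly (p + q + 1) n"
      using p[of x n R] q[of x n R] by auto
  qed
next
  case (Mul a b)
  then obtain p q :: "nat poly"
    where p: "\<And>(x :: bool list) (R :: nat \<Rightarrow> nat) n. length x \<le> n \<Longrightarrow> \<forall>i \<in> vars a. R i \<le> n \<Longrightarrow>
        val x a R \<le> poly p n \<and> cost x a R \<le> poly p n"
      and q: "\<And>(x :: bool list) (R :: nat \<Rightarrow> nat) n. length x \<le> n \<Longrightarrow> \<forall>i \<in> vars b. R i \<le> n \<Longrightarrow>
        val x b R \<le> poly q n \<and> cost x b R \<le> poly q n"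
    by metis
  show ?case
  proof (intro exI[of _ "p + p * (q + 1) + 2"] allI impI)
    fix x :: "bool list" and R n assume "length x \<le> n" "\<forall>i \<in> vars (Mul a b). R i \<le> n"
    then have "val x a R \<le> poly p n" "cost x a R \<le> poly p n" "val x b R \<le> poly q n"
        "cost x b R \<le> poly q n"
      using p[of x n R] q[of x n R] by auto
    moreover from this have "val x a R * Suc (cost x b R) \<le> poly p n * (poly q n + 1)"
      "val x a R * val x b R \<le> poly p n * (poly q n + 1)"
      by (intro mult_mono; simp)+
    ultimately show "val x (Mul a b) R \<le> poly (p + p * (q + 1) + 2) n \<and>
        cost x (Mul a b) R \<le> poly (p + p * (q + 1) + 2) n"
      by (simp add: numeral_2_eq_2)
  qed
next
  case (Sub a b)
  then obtain p q :: "nat poly"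
    where p: "\<And>(x :: bool list) (R :: nat \<Rightarrow> nat) n. length x \<le> n \<Longrightarrow> \<forall>i \<in> vars a. R i \<le> n \<Longrightarrow>
        val x a R \<le> poly p n \<and> cost x a R \<le> poly p n"
      and q: "\<And>(x :: bool list) (R :: nat \<Rightarrow> nat) n. length x \<le> n \<Longrightarrow> \<forall>i \<in> vars b. R i \<le> n \<Longrightarrow>
        val x b R \<le> poly q n \<and> cost x b R \<le> poly q n"
    by metis
  show ?case
  proof (intro exI[of _ "smult 3 p + smult 3 q + [:5:]"] allI impI)
    fix x :: "bool list" and R n assume "length x \<le> n" "\<forall>i \<in> vars (Sub a b). R i \<le> n"
    then show "val x (Sub a b) R \<le> poly (smult 3 p + smult 3 q + [:5:]) n \<and>
        cost x (Sub a b) R \<le> poly (smult 3 p + smult 3 q + [:5:]) n"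
      using p[of x n R] q[of x n R] by auto
  qed
next
  case (Bit a)
  then obtain p :: "nat poly"
    where p: "\<And>(x :: bool list) (R :: nat \<Rightarrow> nat) n. length x \<le> n \<Longrightarrow> \<forall>i \<in> vars a. R i \<le> n \<Longrightarrow>
        val x a R \<le> poly p n \<and> cost x a R \<le> poly p n"
    by metis
  show ?case
  proof (intro exI[of _ "smult 7 p + [:6:]"] allI impI)
    fix x :: "bool list" and R n assume "length x \<le> n" "\<forall>i \<in> vars (Bit a). R i \<le> n"
    then show "val x (Bit a) R \<le> poly (smult 7 p + [:6:]) n \<and>
        cost x (Bit a) R \<le> poly (smult 7 p + [:6:]) n"
      using p[of x n R] by auto
  qed
qed

section \<open>Printing a unary register as a binary code\<close>

definition halve :: "nat \<Rightarrow> com" where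
  "halve t = Loop t (Cond t (Seq (Dec t) (Inc (Suc t))) (Inc (Suc (Suc t))))"

lemma runs_halve:
  "runs x (halve t) (R(t := v, Suc t := a, Suc (Suc t) := 0), h, y)
     (R(t := 0, Suc t := a + v div 2, Suc (Suc t) := v mod 2), h, y) (5 * v + 1)"
proof (induction v arbitrary: a rule: less_induct)
  case (less v)
  consider "v = 0" | "v = 1" | "v \<ge> 2" by linarith
  then show ?case
  proof cases
    case 1
    then show ?thesis unfolding halve_def by (auto intro: runs_eq[OF runs_Loop_0])
  next
    case 2
    show ?thesis unfolding halve_def
      by (rule runs_eq[OF runs_Loop_Suc[OF _ runs_Cond[OF _ runs_eq[OF runs_Inc refl order_refl]] runs_Loop_0]])
         (auto simp: 2 fun_eq_iff)
  next
    case 3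
    have rec: "runs x (halve t) (R(t := v - 2, Suc t := Suc a, Suc (Suc t) := 0), h, y)
       (R(t := 0, Suc t := a + v div 2, Suc (Suc t) := v mod 2), h, y) (5 * (v - 2) + 1)"
      using less.IH[of "v - 2" "Suc a"] 3 by (auto simp: le_div_geq le_mod_geq simp del: fun_upd_apply)
    have body: "runs x (Cond t (Seq (Dec t) (Inc (Suc t))) (Inc (Suc (Suc t))))
      (R(t := v - 1, Suc t := a, Suc (Suc t) := 0), h, y)
      (R(t := v - 2, Suc t := Suc a, Suc (Suc t) := 0), h, y) (Suc (Suc (1 + 1)))"
      by (rule runs_Cond, rule runs_eq[OF runs_Seq[OF runs_Dec runs_Inc]])
        (use 3 in \<open>auto simp: fun_eq_iff\<close>)
    show ?thesis unfolding halve_def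
      by (rule runs_eq[OF runs_Loop_Suc[OF _ runs_eq_start[OF body] rec[unfolded halve_def]]])
        (use 3 in \<open>auto simp: fun_eq_iff\<close>)
  qed
qed

text \<open>\<open>Loop t\<close> serves as a plain test for nonzero: \<open>Inc t\<close> undoes
  its decrement, and the quotient moved back into \<open>t\<close> is the next value to be
  tested.\<close>

definition print_reg :: "nat \<Rightarrow> com" where
  "print_reg t = Seq
     (Loop t (Seq (Put True) (Seq (Inc t) (Seq (halve t) (Seq
        (Cond (Suc (Suc t)) (Seq (Put True) (Dec (Suc (Suc t)))) (Put False))
        (Loop (Suc t) (Inc t)))))))
     (Put False)"

lemma encode_nat_0: "encode_nat 0 = [False]"
  by (simp add: encode_nat_def nat_bits.simps[of 0])

lemma encode_nat_pos: "k \<noteq> 0 \<Longrightarrow> encode_nat k = True # odd k # encode_nat (k div 2)"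
  by (simp add: encode_nat_def nat_bits.simps[of k])

text \<open>The counter is halved, not lowered by one, so \<open>runs_Loop\<close> does not fit;
  strong induction follows the recursion of \<open>encode_nat\<close>. The loop leaves out the final
  \<open>False\<close>, hence the word \<open>y'\<close>.\<close>

lemma runs_print_reg:
  assumes "R t = 0" "R (Suc t) = 0" "R (Suc (Suc t)) = 0"
  shows "runs x (print_reg t) (R(t := v), h, y) (R, h, y @ encode_nat v) ((v + 1) * (10 * v + 20))"
proof -
  let ?body = "Seq (Put True) (Seq (Inc t) (Seq (halve t) (Seq
        (Cond (Suc (Suc t)) (Seq (Put True) (Dec (Suc (Suc t)))) (Put False))
        (Loop (Suc t) (Inc t)))))"
  have "\<exists>y'. y @ encode_nat v = y' @ [False] \<and>
      runs x (Loop t ?body) (R(t := v), h, y) (R, h, y') (v * (10 * v + 20) + 1)" for y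
  proof (induction v arbitrary: y rule: less_induct)
    case (less v)
    show ?case
    proof (cases "v = 0")
      case True
      then show ?thesis
        by (auto intro!: exI[of _ y] runs_eq[OF runs_Loop_0] simp: encode_nat_0 assms fun_upd_idem)
    next
      case False
      let ?y = "y @ [True, odd v]"
      obtain y' where y': "?y @ encode_nat (v div 2) = y' @ [False]"
        "runs x (Loop t ?body) (R(t := v div 2), h, ?y) (R, h, y')
           (v div 2 * (10 * (v div 2) + 20) + 1)"
        using less.IH[of "v div 2" ?y] False by (auto simp del: fun_upd_apply)
      have put: "runs x (Put True) (R(t := v - 1), h, y) (R(t := v - 1), h, y @ [True]) 1"
        by (rule runs_Put)
      have inc: "runs x (Inc t) (R(t := v - 1), h, y @ [True])
          (R(t := v, Suc t := 0, Suc (Suc t) := 0), h, y @ [True]) 1"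
        by (rule runs_eq[OF runs_Inc]) (use False assms in \<open>auto simp: fun_eq_iff\<close>)
      have bit: "runs x (Cond (Suc (Suc t)) (Seq (Put True) (Dec (Suc (Suc t)))) (Put False))
         (R(t := 0, Suc t := 0 + v div 2, Suc (Suc t) := v mod 2), h, y @ [True])
         (R(t := 0, Suc t := v div 2, Suc (Suc t) := 0), h, ?y) 4"
      proof (rule runs_eq[OF runs_Cond[where K=3 and s="(R(t := 0, Suc t := v div 2, Suc (Suc t) := 0), h, ?y)"]], goal_cases)
        case 1
        then show ?case
          by (intro runs_eq[OF runs_Seq[OF runs_Put runs_Dec]]) (auto simp: fun_eq_iff odd_iff_mod_2_eq_one)
      next
        case 2
        then show ?case
          by (intro runs_eq[OF runs_Put]) (auto simp: fun_eq_iff even_iff_mod_2_eq_zero)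
      qed auto
      have mv: "runs x (Loop (Suc t) (Inc t)) (R(t := 0, Suc t := v div 2, Suc (Suc t) := 0), h, ?y)
         (R(t := v div 2), h, ?y) (2 * (v div 2) + 1)"
        by (rule runs_eq[OF runs_move]) (use assms in \<open>auto simp: fun_eq_iff\<close>)
      have body: "runs x ?body (R(t := v - 1), h, y) (R(t := v div 2), h, ?y)
         (6 * v + 14)"
        by (rule runs_eq[OF runs_Seq[OF put runs_Seq[OF inc runs_Seq[OF runs_halve runs_Seq[OF bit mv]]]]])
          auto
      have "runs x (Loop t ?body) (R(t := v), h, y) (R, h, y')
          (Suc (6 * v + 14 + (v div 2 * (10 * (v div 2) + 20) + 1)))"
        by (rule runs_Loop_Suc[OF _ runs_eq_start[OF body] y'(2)]) (use False in auto)
      \<comment> \<open>Since \<open>v div 2\<close> is at most \<open>v - 1\<close>, one share of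
        \<open>10 * v + 20\<close> is left over, and it pays for the current round.\<close>
      moreover have "v div 2 * (10 * (v div 2) + 20) \<le> (v - 1) * (10 * v + 20)"
        using False by (intro mult_mono) auto
      moreover have "(v - 1) * (10 * v + 20) + (10 * v + 20) = v * (10 * v + 20)"
        using False by (cases v) auto
      ultimately show ?thesis
        using y'(1) False
        by (intro exI[of _ y'] conjI) (auto simp: encode_nat_pos simp del: fun_upd_apply elim!: runs_eq)
    qed
  qed
  then obtain y' where y': "y @ encode_nat v = y' @ [False]"
    "runs x (Loop t ?body) (R(t := v), h, y) (R, h, y') (v * (10 * v + 20) + 1)"
    by blast
  show ?thesis unfolding print_reg_def
    by (rule runs_eq[OF runs_Seq[OF y'(2) runs_Put]]) (auto simp: y'(1))
qed

section \<open>Loop programs that print sequences of numbers\<close>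

datatype gen =
    Num expr
  | GNil
  | GSeq gen gen
  | For nat expr gen

primrec emit :: "bool list \<Rightarrow> gen \<Rightarrow> (nat \<Rightarrow> nat) \<Rightarrow> bool list" where
  "emit x (Num e) R = encode_nat (val x e R)"
| "emit x GNil R = []"
| "emit x (GSeq g h) R = emit x g R @ emit x h R"
| "emit x (For i e g) R = concat (map (\<lambda>j. emit x g (R(i := j))) [0..<val x e R])"

primrec binders :: "gen \<Rightarrow> nat set" where
  "binders (Num e) = {}"
| "binders GNil = {}"
| "binders (GSeq g h) = binders g \<union> binders h"
| "binders (For i e g) = insert i (binders g)"

primrec gen_vars :: "gen \<Rightarrow> nat set" where
  "gen_vars (Num e) = vars e"
| "gen_vars GNil = {}"
| "gen_vars (GSeq g h) = gen_vars g \<union> gen_vars h"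
| "gen_vars (For i e g) = insert i (vars e \<union> gen_vars g)"

text \<open>
  A loop counts in the register of its own variable and resets it to 0 at the end, hence
  nested loops must have different variables.
\<close>

primrec wf_gen :: "gen \<Rightarrow> bool" where
  "wf_gen (Num e) \<longleftrightarrow> True"
| "wf_gen GNil \<longleftrightarrow> True"
| "wf_gen (GSeq g h) \<longleftrightarrow> wf_gen g \<and> wf_gen h"
| "wf_gen (For i e g) \<longleftrightarrow> i \<notin> binders g \<and> wf_gen g"

primrec compile_gen :: "gen \<Rightarrow> nat \<Rightarrow> com" where
  "compile_gen (Num e) t = Seq (add_expr e t (Suc t)) (print_reg t)"
| "compile_gen GNil t = Nop"
| "compile_gen (GSeq g h) t = Seq (compile_gen g t) (compile_gen h t)"
| "compile_gen (For i e g) t =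
     Seq (add_expr e t (Suc t))
       (Seq (Loop t (Seq (compile_gen g (Suc t)) (Inc i))) (Loop i Nop))"

primrec gen_cost :: "bool list \<Rightarrow> gen \<Rightarrow> (nat \<Rightarrow> nat) \<Rightarrow> nat" where
  "gen_cost x (Num e) R = Suc (cost x e R + (val x e R + 1) * (10 * val x e R + 20))"
| "gen_cost x GNil R = 1"
| "gen_cost x (GSeq g h) R = Suc (gen_cost x g R + gen_cost x h R)"
| "gen_cost x (For i e g) R =
     cost x e R + (\<Sum>j<val x e R. gen_cost x g (R(i := j))) + 5 * val x e R + 4"

lemma binders_subset: "binders g \<subseteq> gen_vars g"
  by (induction g) auto

lemma emit_cong: "(\<And>i. i \<in> gen_vars g \<Longrightarrow> R i = R' i) \<Longrightarrow> emit x g R = emit x g R'"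
proof (induction g arbitrary: R R')
  case (Num e)
  then show ?case using val_cong[of e R R' x] by simp
next
  case (GSeq g h)
  then show ?case by (metis UnCI gen_vars.simps(3) emit.simps(3))
next
  case (For i e g)
  have "emit x g (R(i := j)) = emit x g (R'(i := j))" for j
    using For.prems by (intro For.IH) auto
  moreover have "val x e R = val x e R'" using For.prems by (intro val_cong) auto
  ultimately show ?case by simp
qed simp

lemma gen_cost_cong: "(\<And>i. i \<in> gen_vars g \<Longrightarrow> R i = R' i) \<Longrightarrow> gen_cost x g R = gen_cost x g R'"
proof (induction g arbitrary: R R')
  case (Num e)
  then show ?case using val_cong[of e R R' x] cost_cong[of e R R' x] by simp
next
  case (GSeq g h)
  then show ?case by (metis UnCI gen_vars.simps(3) gen_cost.simps(3))
next
  case (For i e g)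
  have "gen_cost x g (R(i := j)) = gen_cost x g (R'(i := j))" for j
    using For.prems by (intro For.IH) auto
  moreover have "val x e R = val x e R'" "cost x e R = cost x e R'"
    using For.prems by (auto intro!: val_cong cost_cong)
  ultimately show ?case by simp
qed simp

lemma runs_clear: "runs x (Loop i Nop) (R, h, y) (R(i := 0), h, y) (2 * R i + 1)"
proof -
  have "runs x (Loop i Nop) ((\<lambda>j. R(i := R i - j)) 0, h, y)
      ((\<lambda>j. R(i := R i - j)) (R i), h, y) (Suc (\<Sum>j<R i. Suc 1))"
    by (rule runs_Loop[where h="\<lambda>_. h" and y="\<lambda>_. y"], rule runs_eq[OF runs_Nop]) auto
  moreover have "R(i := R i - 0) = R" by auto
  ultimately show ?thesis by (auto elim!: runs_eq)
qed

lemma runs_compile_gen: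
  assumes "\<And>j. t \<le> j \<Longrightarrow> R j = 0" "gen_vars g \<subseteq> {..<t}" "wf_gen g" "\<And>i. i \<in> binders g \<Longrightarrow> R i = 0"
  shows "runs x (compile_gen g t) (R, 0, y) (R, 0, y @ emit x g R) (gen_cost x g R)"
  using assms
proof (induction g arbitrary: t R y)
  case (Num e)
  let ?v = "val x e R"
  have e: "runs x (add_expr e t (Suc t)) (R, 0, y) (R(t := ?v), 0, y) (cost x e R)"
    by (rule runs_eq[OF runs_add_expr]) (use Num.prems in \<open>auto simp: fun_eq_iff\<close>)
  have p: "runs x (print_reg t) (R(t := ?v), 0, y) (R, 0, y @ encode_nat ?v) ((?v + 1) * (10 * ?v + 20))"
    by (rule runs_print_reg) (use Num.prems in auto)
  show ?case unfolding compile_gen.simps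
    by (rule runs_eq[OF runs_Seq[OF e p]]) auto
next
  case GNil
  then show ?case using runs_Nop[of x "(R, 0, y)"] by simp
next
  case (GSeq g h)
  show ?case unfolding compile_gen.simps
    by (rule runs_eq[OF runs_Seq[OF GSeq.IH(1)[of t R] GSeq.IH(2)[of t R]]]) (use GSeq.prems in auto)
next
  case (For i e g)
  let ?n = "val x e R"
  define S where "S j = R(i := j, t := ?n - j)" for j
  define Y where "Y k = y @ concat (map (\<lambda>j. emit x g (R(i := j))) [0..<k])" for k
  have it: "i < t" "R i = 0" using For.prems by auto
  have e: "runs x (add_expr e t (Suc t)) (R, 0, y) (S 0, 0, Y 0) (cost x e R)"
    by (rule runs_eq[OF runs_add_expr]) (use For.prems it in \<open>auto simp: fun_eq_iff S_def Y_def\<close>)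
  have loop: "runs x (Loop t (Seq (compile_gen g (Suc t)) (Inc i))) (S 0, 0, Y 0) (S ?n, 0, Y ?n)
      (Suc (\<Sum>j<?n. Suc (Suc (gen_cost x g (R(i := j)) + 1))))"
  proof (rule runs_Loop[where h="\<lambda>_. 0"])
    fix j assume "j < ?n"
    let ?R = "(S j)(t := ?n - Suc j)"
    have cong: "emit x g ?R = emit x g (R(i := j))" "gen_cost x g ?R = gen_cost x g (R(i := j))"
      using For.prems by (auto simp: S_def intro!: emit_cong gen_cost_cong)
    have ineq: "gen_vars g \<subseteq> {..<Suc t}" "binders g \<subseteq> {..<t}"
      using For.prems binders_subset[of g] by auto
    have "runs x (compile_gen g (Suc t)) (?R, 0, Y j) (?R, 0, Y j @ emit x g ?R) (gen_cost x g ?R)"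
      by (rule For.IH) (use For.prems it ineq in \<open>auto simp: S_def\<close>)
    then have body: "runs x (compile_gen g (Suc t)) (?R, 0, Y j) (?R, 0, Y (Suc j)) (gen_cost x g (R(i := j)))"
      by (simp only: cong) (simp add: Y_def)
    show "runs x (Seq (compile_gen g (Suc t)) (Inc i)) (?R, 0, Y j) (S (Suc j), 0, Y (Suc j))
        (Suc (gen_cost x g (R(i := j)) + 1))"
      by (rule runs_eq[OF runs_Seq[OF body runs_Inc]]) (use it in \<open>auto simp: S_def fun_eq_iff\<close>)
  qed (use it in \<open>auto simp: S_def\<close>)
  have "S ?n i = ?n" using it by (simp add: S_def)
  then have cl: "runs x (Loop i Nop) (S ?n, 0, Y ?n) (R, 0, Y ?n) (2 * ?n + 1)"
    by (intro runs_eq[OF runs_clear]) (use For.prems it in \<open>auto simp: S_def fun_eq_iff\<close>)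
  show ?case unfolding compile_gen.simps
    by (rule runs_eq[OF runs_Seq[OF e runs_Seq[OF loop cl]]]) (auto simp: Y_def sum.distrib sum_Suc)
qed

lemma gen_bound:
  "\<exists>p :: nat poly. \<forall>(x :: bool list) (R :: nat \<Rightarrow> nat) b. length x \<le> b \<longrightarrow> (\<forall>i. R i \<le> b) \<longrightarrow>
     gen_cost x g R \<le> poly p b"
proof (induction g)
  case (Num e)
  obtain p :: "nat poly" where p: "\<And>(x :: bool list) (R :: nat \<Rightarrow> nat) b. length x \<le> b \<Longrightarrow> \<forall>i \<in> vars e. R i \<le> b \<Longrightarrow>
     val x e R \<le> poly p b \<and> cost x e R \<le> poly p b"
    using expr_bound[of e] by metis
  show ?case
  proof (intro exI[of _ "p + (p + 1) * (smult 10 p + [:20:]) + 1"] allI impI)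
    fix x :: "bool list" and R :: "nat \<Rightarrow> nat" and b assume "length x \<le> b" "\<forall>i. R i \<le> b"
    then have v: "val x e R \<le> poly p b" "cost x e R \<le> poly p b"
      using p[of x b R] by auto
    then have "(val x e R + 1) * (10 * val x e R + 20) \<le> (poly p b + 1) * (10 * poly p b + 20)"
      by (intro mult_mono) auto
    with v show "gen_cost x (Num e) R \<le> poly (p + (p + 1) * (smult 10 p + [:20:]) + 1) b"
      by simp
  qed
next
  case GNil
  show ?case by (rule exI[of _ 1]) simp
next
  case (GSeq g h)
  then obtain p q :: "nat poly"
    where p: "\<And>(x :: bool list) (R :: nat \<Rightarrow> nat) n. length x \<le> n \<Longrightarrow> \<forall>i. R i \<le> n \<Longrightarrow> gen_cost x g R \<le> poly p n"
      and q: "\<And>(x :: bool list) (R :: nat \<Rightarrow> nat) n. length x \<le> n \<Longrightarrow> \<forall>i. R i \<le> n \<Longrightarrow> gen_cost x h R \<le> poly q n"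
    by metis
  show ?case
  proof (intro exI[of _ "p + q + 1"] allI impI)
    fix x :: "bool list" and R :: "nat \<Rightarrow> nat" and b assume "length x \<le> b" "\<forall>i. R i \<le> b"
    then show "gen_cost x (GSeq g h) R \<le> poly (p + q + 1) b"
      using p[of x b R] q[of x b R] by simp
  qed
next
  case (For i e g)
  obtain p :: "nat poly" where p: "\<And>(x :: bool list) (R :: nat \<Rightarrow> nat) b. length x \<le> b \<Longrightarrow> \<forall>i \<in> vars e. R i \<le> b \<Longrightarrow>
     val x e R \<le> poly p b \<and> cost x e R \<le> poly p b"
    using expr_bound[of e] by metis
  obtain q :: "nat poly"
    where q: "\<And>(x :: bool list) (R :: nat \<Rightarrow> nat) n. length x \<le> n \<Longrightarrow> \<forall>i. R i \<le> n \<Longrightarrow> gen_cost x g R \<le> poly q n"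
    using For.IH by metis
  show ?case
  \<comment> \<open>Inside the loop the variable \<open>i\<close> is below \<open>poly p b\<close>,
    so the body is charged for the bound \<open>b + poly p b\<close>; this is the source of
    \<open>pcompose\<close>.\<close>
  proof (intro exI[of _ "p + p * pcompose q ([:0, 1:] + p) + smult 5 p + [:4:]"] allI impI)
    fix x :: "bool list" and R :: "nat \<Rightarrow> nat" and b assume b: "length x \<le> b" "\<forall>i. R i \<le> b"
    then have v: "val x e R \<le> poly p b" "cost x e R \<le> poly p b"
      using p[of x b R] by auto
    have "gen_cost x g (R(i := j)) \<le> poly q (b + poly p b)" if "j < val x e R" for j
    proof (rule q)
      show "\<forall>k. (R(i := j)) k \<le> b + poly p b"
        using b that v by (auto intro: trans_le_add1)
    qed (use b in auto)
    then have "(\<Sum>j<val x e R. gen_cost x g (R(i := j))) \<le> (\<Sum>j<val x e R. poly q (b + poly p b))"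
      by (intro sum_mono) auto
    also have "\<dots> \<le> poly p b * poly q (b + poly p b)"
      using v by simp
    finally show "gen_cost x (For i e g) R
        \<le> poly (p + p * pcompose q ([:0, 1:] + p) + smult 5 p + [:4:]) b"
      using v by (simp add: poly_pcompose)
  qed
qed

theorem poly_time_computable_emit:
  assumes "wf_gen g" "0 \<notin> binders g"
  shows "poly_time_computable (\<lambda>x. emit x g ((\<lambda>_. 0)(0 := length x)))"
proof -
  obtain t where t: "insert 0 (gen_vars g) \<subseteq> {..<t}"
  proof -
    have "finite (vars e)" for e by (induction e) auto
    then have "finite (gen_vars g)" by (induction g) auto
    then show ?thesis using that by (meson finite_insert finite_nat_iff_bounded)
  qed
  then have t0: "0 < t" by auto
  obtain p :: "nat poly"
    where p: "\<And>(x :: bool list) (R :: nat \<Rightarrow> nat) n. length x \<le> n \<Longrightarrow> \<forall>i. R i \<le> n \<Longrightarrow> gen_cost x g R \<le> poly p n"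
    using gen_bound by metis
  \<comment> \<open>\<open>Scan 0\<close> measures the input but leaves the head at its end. Walking
    back consumes register 0 as counter, so its value is saved in \<open>t\<close> and then
    restored.\<close>
  define P where "P = Seq (Scan 0) (Seq (Loop 0 (Seq Back (Inc t)))
    (Seq (Loop t (Inc 0)) (compile_gen g t)))"
  show ?thesis
  proof (rule poly_time_computable_runs[where P = P and p = "p + [:10, 10:]"])
    fix x :: "bool list"
    let ?n = "length x" and ?R = "(\<lambda>_ :: nat. 0)(0 := length x)"
    define S where "S j = (\<lambda>_. 0)(0 := ?n - j, t := j)" for j
    have a: "runs x (Scan 0) ((\<lambda>_. 0), 0, []) (S 0, int ?n - int 0, []) (Suc ?n)"
      by (rule runs_eq[OF runs_Scan]) (use t0 in \<open>auto simp: S_def fun_eq_iff\<close>)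
    have b: "runs x (Loop 0 (Seq Back (Inc t))) (S 0, int ?n - int 0, []) (S ?n, int ?n - int ?n, [])
      (Suc (\<Sum>j<?n. Suc (Suc (1 + 1))))"
      by (rule runs_Loop[where h="\<lambda>j. int ?n - int j" and y="\<lambda>_. []"],
          rule runs_eq[OF runs_Seq[OF runs_Back runs_Inc]])
        (use t0 in \<open>auto simp: S_def fun_eq_iff\<close>)
    have c: "runs x (Loop t (Inc 0)) (S ?n, int ?n - int ?n, []) (?R, 0, []) (2 * ?n + 1)"
      by (rule runs_eq[OF runs_move]) (use t0 in \<open>auto simp: S_def fun_eq_iff\<close>)
    have d: "runs x (compile_gen g t) (?R, 0, []) (?R, 0, [] @ emit x g ?R) (gen_cost x g ?R)"
      by (rule runs_compile_gen) (use t assms in \<open>auto intro: gr0I\<close>)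
    have "gen_cost x g ?R \<le> poly p ?n"
      by (rule p) auto
    then have "runs x P ((\<lambda>_. 0), 0, []) (?R, 0, emit x g ?R) (poly (p + [:10, 10:]) ?n)"
      unfolding P_def by (intro runs_eq[OF runs_Seq[OF a runs_Seq[OF b runs_Seq[OF c d]]]]) auto
    then show "\<exists>m. runs x P ((\<lambda>_. 0), 0, []) (fst m, snd m, emit x g ?R) (poly (p + [:10, 10:]) ?n)"
      by (intro exI[of _ "(?R, 0)"]) simp
  qed
qed

section \<open>A layered graph for choices subject to constraints\<close>

lemma vwalk_arcs_nth: "Suc k < length P \<Longrightarrow> (P ! k, P ! Suc k) \<in> set (vwalk_arcs P)"
proof (induction P arbitrary: k rule: vwalk_arcs.induct)
  case (3 x y xs)
  then show ?case by (cases k) auto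
qed auto

lemma vwalk_arcs_map_upt:
  "set (vwalk_arcs (map f [m..<n])) = (\<lambda>c. (f c, f (Suc c))) ` {c. m \<le> c \<and> Suc c < n}"
proof (induction "n - m" arbitrary: m)
  case 0
  then show ?case by auto
next
  case (Suc k)
  show ?case
  proof (cases "Suc m < n")
    case True
    then have "[m..<n] = m # Suc m # [Suc (Suc m)..<n]" by (simp add: upt_conv_Cons)
    moreover have "[Suc m..<n] = Suc m # [Suc (Suc m)..<n]" using True by (simp add: upt_conv_Cons)
    moreover have "{c. m \<le> c \<and> Suc c < n} = insert m {c. Suc m \<le> c \<and> Suc c < n}"
      using True by auto
    ultimately show ?thesis using Suc(1)[of "Suc m"] Suc(2) by simp
  next
    case False
    then have "[m..<n] = [m]" using Suc(2) by (simp add: upt_conv_Cons)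
    then show ?thesis using False by auto
  qed
qed

text \<open>\<open>cov z c a\<close> is to mean that option \<open>a\<close> in layer
  \<open>c\<close> fulfils constraint \<open>z\<close> on its own. Vertices are numbered layer by
  layer, then the copies, then the sink, so that every arc leads to a larger number.\<close>

locale choice_graph =
  fixes L d C :: nat and cov :: "nat \<Rightarrow> nat \<Rightarrow> nat \<Rightarrow> bool"
  assumes L_pos: "0 < L" and d_pos: "0 < d"
begin

text \<open>The neighbours that are not copies number at most \<open>L * d + 1\<close>: the layer
  vertices and the sink. One more makes the loss of all copies of one constraint
  irreparable.\<close>

definition copies :: nat where "copies = L * d + 2"
definition sink :: nat where "sink = L * d + copies * C"

definition layer_arcs :: "(nat \<times> nat) set" where
  "layer_arcs = {(c * d + a, Suc c * d + b) | c a b. Suc c < L \<and> a < d \<and> b < d}"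
definition cover_arcs :: "(nat \<times> nat) set" where
  "cover_arcs = {(c * d + a, L * d + (j * C + z)) | c a j z.
     c < L \<and> a < d \<and> j < copies \<and> z < C \<and> cov z c a}"
definition sink_arcs :: "(nat \<times> nat) set" where
  "sink_arcs = {(v, sink) | v. v < sink}"

definition graph :: "nat pair_pre_digraph" where
  "graph = \<lparr> pverts = {0..<Suc sink}, parcs = layer_arcs \<union> cover_arcs \<union> sink_arcs \<rparr>"

lemma choice_less: "c < n \<Longrightarrow> a < d \<Longrightarrow> c * d + a < n * d"
  using mult_le_mono1[of "Suc c" n d] by simp

lemma copy_less: "j < copies \<Longrightarrow> z < C \<Longrightarrow> j * C + z < copies * C"
  using mult_le_mono1[of "Suc j" copies C] by simp

lemma layer_arcs_iff:
  "(u, v) \<in> layer_arcs \<longleftrightarrow> u < L * d \<and> v < L * d \<and> v div d = Suc (u div d)"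
proof
  assume "(u, v) \<in> layer_arcs"
  then obtain c a b where cab: "u = c * d + a" "v = Suc c * d + b" "Suc c < L" "a < d" "b < d"
    unfolding layer_arcs_def by blast
  have "u < L * d" "v < L * d"
    unfolding cab by (intro choice_less; use cab in simp)+
  moreover have "v div d = Suc (u div d)"
    unfolding cab by (subst div_mult_self3 | use cab d_pos in simp)+
  ultimately show "u < L * d \<and> v < L * d \<and> v div d = Suc (u div d)" by blast
next
  assume uv: "u < L * d \<and> v < L * d \<and> v div d = Suc (u div d)"
  then have "v = Suc (u div d) * d + v mod d" "u = u div d * d + u mod d"
    by (metis div_mult_mod_eq)+
  moreover have "Suc (u div d) < L"
    using uv by (metis less_mult_imp_div_less)
  ultimately show "(u, v) \<in> layer_arcs"
    unfolding layer_arcs_def using d_pos mod_less_divisor by blast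
qed

lemma arc_less: "(u, v) \<in> parcs graph \<Longrightarrow> u < v"
proof -
  have "u < v" if "(u, v) \<in> layer_arcs"
    using that by (auto simp: layer_arcs_def)
  moreover have "u < v" if "(u, v) \<in> cover_arcs"
    using that choice_less by (fastforce simp: cover_arcs_def)
  moreover have "u < v" if "(u, v) \<in> sink_arcs"
    using that by (auto simp: sink_arcs_def)
  ultimately show "(u, v) \<in> parcs graph \<Longrightarrow> u < v" by (auto simp: graph_def)
qed

lemma arc_le_sink: "(u, v) \<in> parcs graph \<Longrightarrow> v \<le> sink"
  using copy_less
  by (fastforce simp: graph_def layer_arcs_iff cover_arcs_def sink_arcs_def sink_def)

lemma pair_digraph_graph: "pair_digraph graph"
proof
  show "fst e \<in> pverts graph" "snd e \<in> pverts graph" if "e \<in> parcs graph" for e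
    using that arc_less[of "fst e" "snd e"] arc_le_sink[of "fst e" "snd e"]
    by (auto simp: graph_def)
  show "fst e \<noteq> snd e" if "e \<in> parcs graph" for e
    using that arc_less[of "fst e" "snd e"] by auto
  show "finite (pverts graph)" by (simp add: graph_def)
  have "parcs graph \<subseteq> {0..sink} \<times> {0..sink}"
    using arc_less arc_le_sink by (fastforce dest: less_imp_le)
  then show "finite (parcs graph)"
    by (rule finite_subset) simp
qed

lemma connected_graph: "connected (with_proj graph)"
  unfolding connected_def
proof (rule strongly_connectedI)
  show "verts (with_proj (mk_symmetric (with_proj graph))) \<noteq> {}" by (simp add: graph_def)
  fix u v
  assume "u \<in> verts (with_proj (mk_symmetric (with_proj graph)))"
    "v \<in> verts (with_proj (mk_symmetric (with_proj graph)))"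
  then have uv: "u \<le> sink" "v \<le> sink" by (auto simp: graph_def)
  let ?E = "parcs (mk_symmetric (with_proj graph))"
  have E: "w \<noteq> sink \<Longrightarrow> (w, sink) \<in> ?E \<and> (sink, w) \<in> ?E" if "w \<le> sink" for w
    using that by (force simp: parcs_mk_symmetric graph_def sink_arcs_def)
  have "(u, sink) \<in> rtrancl_on {0..<Suc sink} ?E"
    using E[OF uv(1)] uv by (cases "u = sink")
      (auto intro: rtrancl_on_into_rtrancl_on[OF rtrancl_on_refl])
  then have "(u, v) \<in> rtrancl_on {0..<Suc sink} ?E"
    using E[OF uv(2)] uv by (cases "v = sink") (auto intro: rtrancl_on_into_rtrancl_on)
  then show "u \<rightarrow>\<^sup>*\<^bsub>with_proj (mk_symmetric (with_proj graph))\<^esub> v"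
    by (simp add: reachable_def graph_def)
qed

abbreviation weight :: "nat \<times> nat \<Rightarrow> rat" where "weight \<equiv> \<lambda>_. 1"

lemma weighted_graph: "weighted_graph graph weight"
  using pair_digraph_graph connected_graph by (simp add: weighted_graph_def)

text \<open>No arc enters the layers from outside, and arcs within them advance by one layer. So the
  induction goes backwards from \<open>j\<close>. This yields both that all walks between two layer
  vertices are equally long and that no layer is met twice.\<close>

lemma vwalk_layer:
  assumes "vwalk P (with_proj graph)" "i \<le> j" "j < length P" "P ! j < L * d"
  shows "P ! i < L * d \<and> P ! i div d + (j - i) = P ! j div d"
  using assms(2)
proof (induction i rule: inc_induct)
  case base
  then show ?case using assms by simp
next
  case (step i)
  have "(P ! i, P ! Suc i) \<in> parcs graph"
    using vwalk_arcs_nth[of i P] step assms(1,3) by (auto simp: vwalk_def)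
  then have "(P ! i, P ! Suc i) \<in> layer_arcs"
    using step by (auto simp: graph_def cover_arcs_def sink_arcs_def sink_def)
  then show ?case using step by (auto simp: layer_arcs_iff)
qed

lemma path_length_weight: "path_length weight P = of_nat (length P - 1)"
  using vwalk_length_simp[of P]
  by (simp add: path_length_def vwalk_length_def sum_list_triv del: vwalk_length_simp)

definition choice_path :: "(nat \<Rightarrow> nat) \<Rightarrow> nat list" where
  "choice_path X = map (\<lambda>c. c * d + X c) [0..<L]"

text \<open>By \<open>vwalk_layer\<close> every path from a vertex of the first layer to one of the
  last has exactly \<open>L\<close> vertices, so there is nothing shorter to compare with.\<close>

lemma choice_path_shortest:
  assumes X: "\<And>c. c < L \<Longrightarrow> X c < d"
  shows "choice_path X \<in> shortest_paths graph weight"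
proof -
  let ?P = "choice_path X"
  have ne: "?P \<noteq> []" using L_pos by (simp add: choice_path_def)
  have mem: "u < L * d" if "u \<in> set ?P" for u
    using that X choice_less by (auto simp: choice_path_def)
  have "L * d \<le> sink" by (simp add: sink_def)
  then have "set ?P \<subseteq> verts (with_proj graph)"
    using mem by (fastforce simp: graph_def)
  moreover have "set (vwalk_arcs ?P) \<subseteq> parcs graph"
  proof -
    have "(c * d + X c, Suc c * d + X (Suc c)) \<in> layer_arcs" if "Suc c < L" for c
      unfolding layer_arcs_def using that X[of c] X[of "Suc c"] by fastforce
    then show ?thesis
      unfolding choice_path_def vwalk_arcs_map_upt graph_def by auto
  qed
  moreover have "distinct ?P"
  proof -
    have "(c * d + X c) div d = c" if "c \<in> {0..<L}" for c
      using that X[of c] by simp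
    then have "inj_on (\<lambda>c. c * d + X c) {0..<L}"
      by (rule inj_on_inverseI)
    then show ?thesis by (simp add: choice_path_def distinct_map)
  qed
  ultimately have path: "vpath ?P (with_proj graph)"
    using ne by (auto simp: vpath_def vwalk_def)
  have "path_length weight ?P \<le> path_length weight Q"
    if Q: "vpath Q (with_proj graph)" "hd Q = hd ?P" "last Q = last ?P" for Q
  proof -
    have QN: "Q \<noteq> []" using Q by (auto simp: vpath_def vwalk_def)
    have "last ?P = (L - 1) * d + X (L - 1)"
      using L_pos by (simp add: choice_path_def last_map)
    then have l: "Q ! (length Q - 1) = (L - 1) * d + X (L - 1)"
      using Q QN by (simp add: last_conv_nth)
    have h: "Q ! 0 = X 0"
      using Q QN L_pos by (simp add: hd_conv_nth choice_path_def upt_conv_Cons)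
    have "Q ! 0 div d + (length Q - 1 - 0) = Q ! (length Q - 1) div d"
      using vwalk_layer[of Q 0 "length Q - 1"] Q QN choice_less[of "L - 1" L "X (L - 1)"] X[of "L - 1"] L_pos
      unfolding l by (auto simp: vpath_def)
    then have "length Q - 1 = L - 1"
      unfolding h l using X[of 0] X[of "L - 1"] L_pos by simp
    then show ?thesis by (simp add: path_length_weight choice_path_def)
  qed
  then show ?thesis using path by (simp add: shortest_paths_def)
qed

lemma choice_path_degree:
  assumes X: "\<And>c. c < L \<Longrightarrow> X c < d" and cov: "\<And>z. z < C \<Longrightarrow> \<exists>c<L. cov z c (X c)"
  shows "copies * C \<le> path_degree graph (choice_path X)"
proof -
  have "(\<lambda>i. L * d + i) ` {..<copies * C} \<subseteq> path_neighbourhood graph (choice_path X)"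
  proof (clarify)
    fix i assume i: "i < copies * C"
    then have C: "0 < C" by (auto intro: gr0I)
    \<comment> \<open>In the number \<open>i\<close> of a copy, the remainder modulo
      \<open>C\<close> is the constraint and the quotient is the number of the copy.\<close>
    then obtain c where c: "c < L" "cov (i mod C) c (X c)" using cov[of "i mod C"] by auto
    have "i div C < copies" using i by (simp add: less_mult_imp_div_less)
    then have "(c * d + X c, L * d + (i div C * C + i mod C)) \<in> cover_arcs"
      unfolding cover_arcs_def using c C X[of c]
      by (intro CollectI exI[of _ c] exI[of _ "X c"] exI[of _ "i div C"] exI[of _ "i mod C"]) auto
    then have "(c * d + X c, L * d + i) \<in> parcs graph" by (simp add: graph_def)
    moreover have "L * d + i \<notin> set (choice_path X)"
      using choice_less X by (fastforce simp: choice_path_def)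
    ultimately show "L * d + i \<in> path_neighbourhood graph (choice_path X)"
      using c by (auto simp: path_neighbourhood_def choice_path_def)
  qed
  moreover have "finite (path_neighbourhood graph (choice_path X))"
    by (rule finite_subset[of _ "{0..sink}"]) (auto simp: path_neighbourhood_def dest: arc_le_sink)
  ultimately have "card ((\<lambda>i. L * d + i) ` {..<copies * C}) \<le> path_degree graph (choice_path X)"
    unfolding path_degree_def by (intro card_mono)
  then show ?thesis by (simp add: card_image)
qed

text \<open>
  A constraint met by no vertex of the path costs all its copies, and these outnumber the
  neighbours that are not copies of constraints.
\<close>

lemma path_degree_cover:
  assumes "P \<in> shortest_paths graph weight" "copies * C \<le> path_degree graph P" "z < C"
  shows "\<exists>u \<in> set P. u < L * d \<and> cov z (u div d) (u mod d)"
proof (rule ccontr)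
  assume no: "\<not> ?thesis"
  let ?I = "(\<lambda>j. j * C + z) ` {..<copies}"
  have "path_neighbourhood graph P \<subseteq> insert sink {..<L * d} \<union> (\<lambda>i. L * d + i) ` ({..<copies * C} - ?I)"
  proof
    fix v assume "v \<in> path_neighbourhood graph P"
    then obtain u where u: "u \<in> set P" "(u, v) \<in> parcs graph"
      by (auto simp: path_neighbourhood_def)
    consider "(u, v) \<in> layer_arcs" | "(u, v) \<in> sink_arcs" | "(u, v) \<in> cover_arcs"
      using u by (auto simp: graph_def)
    then show "v \<in> insert sink {..<L * d} \<union> (\<lambda>i. L * d + i) ` ({..<copies * C} - ?I)"
    proof cases
      case 3
      then obtain c a j y where c: "u = c * d + a" "v = L * d + (j * C + y)"
        "c < L" "a < d" "j < copies" "y < C" "cov y c a"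
        unfolding cover_arcs_def by blast
      have "u < L * d" using choice_less c by simp
      moreover have "u div d = c" "u mod d = a" using c by auto
      ultimately have "y \<noteq> z" using no u c by auto
      \<comment> \<open>Copies of different constraints differ modulo \<open>C\<close>.\<close>
      have "j * C + y \<notin> ?I"
      proof
        assume "j * C + y \<in> ?I"
        then obtain j' where "j * C + y = j' * C + z" by auto
        then have "(j * C + y) mod C = (j' * C + z) mod C" by simp
        then show False using \<open>y \<noteq> z\<close> \<open>y < C\<close> \<open>z < C\<close> by simp
      qed
      then show ?thesis using c copy_less by auto
    qed (auto simp: layer_arcs_iff sink_arcs_def)
  qed
  then have "path_degree graph P
      \<le> card (insert sink {..<L * d} \<union> (\<lambda>i. L * d + i) ` ({..<copies * C} - ?I))"
    unfolding path_degree_def by (intro card_mono) auto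
  also have "\<dots> \<le> card (insert sink {..<L * d}) + card ((\<lambda>i. L * d + i) ` ({..<copies * C} - ?I))"
    by (rule card_Un_le)
  also have "card (insert sink {..<L * d}) \<le> Suc (L * d)"
    by (simp add: card_insert_if)
  also have "card ((\<lambda>i. L * d + i) ` ({..<copies * C} - ?I)) = copies * C - copies"
  proof -
    have "inj_on (\<lambda>j. j * C + z) {..<copies}"
      using \<open>z < C\<close> by (auto simp: inj_on_def)
    then have "card ?I = copies" by (simp add: card_image)
    moreover have "?I \<subseteq> {..<copies * C}" using copy_less \<open>z < C\<close> by auto
    ultimately show ?thesis by (simp add: card_image card_Diff_subset)
  qed
  finally have "path_degree graph P \<le> Suc (L * d) + (copies * C - copies)" by simp
  \<comment> \<open>This keeps the subtraction from being truncated, so the bound above equals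
    \<open>copies * C - 1\<close>, one below the assumed degree.\<close>
  moreover have "copies \<le> copies * C" using \<open>z < C\<close> by (cases C) auto
  ultimately show False using assms(2) by (simp add: copies_def)
qed

theorem max_degree_iff:
  "copies * C \<le> Max (path_degree graph ` shortest_paths graph weight) \<longleftrightarrow>
   (\<exists>X. (\<forall>c<L. X c < d) \<and> (\<forall>z<C. \<exists>c<L. cov z c (X c)))"
proof -
  have "copies * C \<le> Max (path_degree graph ` shortest_paths graph weight) \<longleftrightarrow>
    (\<exists>P \<in> shortest_paths graph weight. copies * C \<le> path_degree graph P)"
    using finite_shortest_paths[OF weighted_graph] shortest_paths_nonempty[OF weighted_graph]
    by (subst Max_ge_iff) auto
  also have "\<dots> \<longleftrightarrow> (\<exists>X. (\<forall>c<L. X c < d) \<and> (\<forall>z<C. \<exists>c<L. cov z c (X c)))"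
  proof
    assume "\<exists>P \<in> shortest_paths graph weight. copies * C \<le> path_degree graph P"
    then obtain P where P: "P \<in> shortest_paths graph weight" "copies * C \<le> path_degree graph P"
      by blast
    then have walk: "vwalk P (with_proj graph)" by (auto simp: shortest_paths_def vpath_def)
    have uniq: "u = v" if uv: "u \<in> set P" "v \<in> set P" "u < L * d" "v < L * d" "u div d = v div d" for u v
    proof -
      obtain i j where ij: "u = P ! i" "v = P ! j" "i < length P" "j < length P"
        using uv by (metis in_set_conv_nth)
      show ?thesis
        using vwalk_layer[OF walk, of i j] vwalk_layer[OF walk, of j i] ij uv
        by (cases i j rule: linorder_cases) auto
    qed
    \<comment> \<open>A layer missed by the path gets the default 0, which is below
      \<open>d\<close>. It cannot spoil anything, as each constraint is already met by a vertex of
      the path.\<close>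
    define X where "X c = (if \<exists>u \<in> set P. u < L * d \<and> u div d = c
      then (THE u. u \<in> set P \<and> u < L * d \<and> u div d = c) mod d else 0)" for c
    have X: "X (u div d) = u mod d" if "u \<in> set P" "u < L * d" for u
    proof -
      have "(THE v. v \<in> set P \<and> v < L * d \<and> v div d = u div d) = u"
        using that uniq by (intro the_equality) auto
      then show ?thesis using that by (auto simp: X_def)
    qed
    have "\<exists>c<L. cov z c (X c)" if "z < C" for z
    proof -
      obtain u where u: "u \<in> set P" "u < L * d" "cov z (u div d) (u mod d)"
        using path_degree_cover[OF P \<open>z < C\<close>] by blast
      then show ?thesis
        using X[OF u(1,2)] by (intro exI[of _ "u div d"]) (auto simp: less_mult_imp_div_less)
    qed
    moreover have "X c < d" for c using d_pos by (simp add: X_def)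
    ultimately show "\<exists>X. (\<forall>c<L. X c < d) \<and> (\<forall>z<C. \<exists>c<L. cov z c (X c))" by blast
  next
    assume "\<exists>X. (\<forall>c<L. X c < d) \<and> (\<forall>z<C. \<exists>c<L. cov z c (X c))"
    then show "\<exists>P \<in> shortest_paths graph weight. copies * C \<le> path_degree graph P"
      using choice_path_shortest choice_path_degree by blast
  qed
  finally show ?thesis .
qed

end

section \<open>Constraint tables\<close>

abbreviation degree_language :: "bool list set" where
  "degree_language \<equiv> threshold_language {(G, w). weighted_graph G w}
     (\<lambda>(G, w). graph_codes G w) (\<lambda>(G, w). shortest_paths G w) (\<lambda>(G, w). path_degree G)"

text \<open>Needed because a code determines the weights on the arcs only.\<close>

lemma shortest_paths_cong:
  assumes "\<And>e. e \<in> parcs G \<Longrightarrow> w e = w' e"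
  shows "shortest_paths G w = shortest_paths G w'"
proof -
  have "path_length w P = path_length w' P" if "vpath P (with_proj G)" for P
  proof -
    have "set (vwalk_arcs P) \<subseteq> parcs G" using that by (auto simp: vpath_def vwalk_def)
    then have "map w (vwalk_arcs P) = map w' (vwalk_arcs P)"
      using assms by (intro map_cong) blast+
    then show ?thesis by (metis path_length_def)
  qed
  then show ?thesis by (auto simp: shortest_paths_def)
qed

text \<open>The language allows any graph that has the given code; unique decoding leaves only this
  one, up to weights off the arcs.\<close>

lemma degree_language_iff:
  assumes "weighted_graph G w" "ns \<in> graph_codes G w"
  shows "encode_nats (k # ns) \<in> degree_language \<longleftrightarrow> k \<le> Max (path_degree G ` shortest_paths G w)"
proof
  assume "encode_nats (k # ns) \<in> degree_language"
  then obtain k' ns' G' w' where eq: "encode_nats (k # ns) = encode_nats (k' # ns')"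
    and G': "weighted_graph G' w'" "ns' \<in> graph_codes G' w'"
      "k' \<le> Max (path_degree G' ` shortest_paths G' w')"
    unfolding threshold_language_def by auto
  have k: "k' = k" "ns' = ns" using encode_nats_inj[OF eq] by auto
  then have "G' = G \<and> (\<forall>e \<in> parcs G'. w' e = w e)"
    using graph_codes_unique[OF G'(1) assms(1)] G'(2) assms(2) by blast
  then show "k \<le> Max (path_degree G ` shortest_paths G w)"
    using G'(3) k shortest_paths_cong[of G w' w] by auto
next
  assume "k \<le> Max (path_degree G ` shortest_paths G w)"
  then show "encode_nats (k # ns) \<in> degree_language"
    unfolding threshold_language_def using assms
    by (intro CollectI exI[of _ k] exI[of _ ns] exI[of _ "(G, w)"]) auto
qed

lemma div_mod_add:
  "(a :: nat) < k \<Longrightarrow> (c * k + a) div k = c" "a < k \<Longrightarrow> (c * k + a) mod k = a"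
  by simp_all

lemma mult_add_inj: "(a :: nat) < k \<Longrightarrow> b < k \<Longrightarrow> c * k + a = c' * k + b \<Longrightarrow> c = c' \<and> a = b"
  by (metis div_mod_add)

lemma distinct_concat_map:
  assumes "distinct xs" "\<And>x. x \<in> set xs \<Longrightarrow> distinct (f x)"
    and "\<And>x y v. x \<in> set xs \<Longrightarrow> y \<in> set xs \<Longrightarrow> v \<in> set (f x) \<Longrightarrow> v \<in> set (f y) \<Longrightarrow> x = y"
  shows "distinct (concat (map f xs))"
  using assms
proof (induction xs)
  case (Cons a xs)
  have "distinct (concat (map f xs))"
    using Cons.prems by (intro Cons.IH) auto
  moreover have "set (f a) \<inter> set (f x) = {}" if "x \<in> set xs" for x
    using Cons.prems(1) Cons.prems(3)[of a x] that by auto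
  ultimately show ?case using Cons.prems(2) by auto
qed simp

lemma encode_nats_append: "encode_nats (xs @ ys) = encode_nats xs @ encode_nats ys"
  by (simp add: encode_nats_def)

definition code :: "(nat \<times> nat) list \<Rightarrow> bool list" where
  "code as = encode_nats (concat (map (arc_code (\<lambda>_. 1)) as))"

lemma code_append: "code (as @ bs) = code as @ code bs"
  by (simp add: code_def encode_nats_append)

lemma code_concat: "code (concat ass) = concat (map code ass)"
  by (induction ass) (simp_all add: code_append, simp add: code_def encode_nats_def)

lemma code_map: "code (map f xs) = concat (map (\<lambda>x. code [f x]) xs)"
  by (induction xs) (simp_all add: code_def encode_nats_append, simp add: encode_nats_def)

lemma code_replicate: "code (replicate k e) = concat (map (\<lambda>_. code [e]) [0..<k])"
  using code_map[of "\<lambda>_. e" "[0..<k]"] by (simp add: map_replicate_const)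

definition gseq :: "gen list \<Rightarrow> gen" where
  "gseq gs = foldr GSeq gs GNil"

lemma gseq_simps:
  "emit x (gseq gs) R = concat (map (\<lambda>g. emit x g R) gs)"
  "binders (gseq gs) = (\<Union>g \<in> set gs. binders g)"
  "wf_gen (gseq gs) \<longleftrightarrow> (\<forall>g \<in> set gs. wf_gen g)"
  by (induction gs) (auto simp: gseq_def)

text \<open>The two constants are the numerator and the denominator of the weight 1, as in
  \<open>arc_code\<close>.\<close>

definition arc :: "expr \<Rightarrow> expr \<Rightarrow> gen" where
  "arc u v = gseq [Num u, Num v, Num (Const 1), Num (Const 1)]"

lemma arc_simps:
  "binders (arc u v) = {}" "wf_gen (arc u v)"
  "emit x (arc u v) R = code [(val x u R, val x v R)]"
  by (auto simp: arc_def gseq_simps arc_code_def encode_nats_def code_def)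

text \<open>Register 0 holds the input length and register 1 the current cell. The generators below
  also use register 2 for the copy and register 3 for the guard.\<close>

definition env :: "bool list \<Rightarrow> nat \<Rightarrow> nat \<Rightarrow> nat" where
  "env x c = (\<lambda>_. 0)(0 := length x, 1 := c)"

lemma val_env:
  assumes "vars e \<subseteq> {0, 1}" "R 0 = length x" "R 1 = c"
  shows "val x e R = val x e (env x c)"
  using assms by (intro val_cong) (auto simp: env_def)

text \<open>
  Every cell \<open>c\<close> below the value of \<open>rows\<close> has one constraint for each member of the table;
  an entry \<open>(off, a, g)\<close> of it is a disjunct which states that cell \<open>c + off\<close> has tile \<open>a\<close>,
  present only if \<open>g\<close> is nonzero.
\<close>

locale constraint_table =
  fixes cells rows :: expr and d :: nat and tab :: "(expr \<times> nat \<times> expr) list list"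
  assumes vars_cells: "vars cells \<subseteq> {0}" and vars_rows: "vars rows \<subseteq> {0}"
    and vars_tab: "\<And>es off a g. es \<in> set tab \<Longrightarrow> (off, a, g) \<in> set es \<Longrightarrow> vars off \<subseteq> {0, 1} \<and> vars g \<subseteq> {0, 1}"
    and d_pos: "0 < d" and cells_pos: "\<And>x. 0 < val x cells (env x 0)"
    and tab_less: "\<And>es off a g. es \<in> set tab \<Longrightarrow> (off, a, g) \<in> set es \<Longrightarrow> a < d"
    and off_less: "\<And>x c es off a g. c < val x rows (env x 0) \<Longrightarrow> es \<in> set tab \<Longrightarrow> (off, a, g) \<in> set es \<Longrightarrow>
        c + val x off (env x c) < val x cells (env x 0)"
    and guard_le: "\<And>x c es off a g. c < val x rows (env x 0) \<Longrightarrow> es \<in> set tab \<Longrightarrow> (off, a, g) \<in> set es \<Longrightarrow>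
        val x g (env x c) \<le> 1"
    and tab_distinct: "\<And>x c es. c < val x rows (env x 0) \<Longrightarrow> es \<in> set tab \<Longrightarrow>
        distinct (map (\<lambda>(off, a, g). (val x off (env x c), a)) es)"
begin

definition satisfies :: "bool list \<Rightarrow> (nat \<Rightarrow> nat) \<Rightarrow> nat \<Rightarrow> nat \<Rightarrow> bool" where
  "satisfies x X c \<tau> \<longleftrightarrow> (\<exists>(off, a, g) \<in> set (tab ! \<tau>).
     X (c + val x off (env x c)) = a \<and> val x g (env x c) \<noteq> 0)"

abbreviation "n_tab \<equiv> length tab"
abbreviation "n_cells x \<equiv> val x cells (env x 0)"
abbreviation "n_rows x \<equiv> val x rows (env x 0)"

text \<open>Constraint \<open>z\<close> is member \<open>z mod n_tab\<close> of the table, placed at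
  cell \<open>z div n_tab\<close>.\<close>

definition cov :: "bool list \<Rightarrow> nat \<Rightarrow> nat \<Rightarrow> nat \<Rightarrow> bool" where
  "cov x z c' a' \<longleftrightarrow> (\<exists>(off, a, g) \<in> set (tab ! (z mod n_tab)).
     c' = z div n_tab + val x off (env x (z div n_tab)) \<and> a' = a \<and> val x g (env x (z div n_tab)) \<noteq> 0)"

sublocale choice_graph "n_cells x" d "n_rows x * n_tab" "cov x" for x
  using cells_pos d_pos by unfold_locales auto

definition tiles_expr :: expr where "tiles_expr = Mul cells (Const d)"
definition copies_expr :: expr where "copies_expr = Add tiles_expr (Const 2)"
definition constraints_expr :: expr where "constraints_expr = Mul rows (Const n_tab)"
definition sink_expr :: expr where "sink_expr = Add tiles_expr (Mul copies_expr constraints_expr)"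

definition layer_gen :: gen where
  "layer_gen = For 1 (Sub cells (Const 1)) (gseq (map (\<lambda>a. gseq (map (\<lambda>b.
     arc (Add (Mul (Var 1) (Const d)) (Const a)) (Add (Mul (Add (Var 1) (Const 1)) (Const d)) (Const b)))
     [0..<d])) [0..<d]))"

text \<open>Loops over copies and cells depend on the input and stay loops, while the fixed table is
  unrolled. As guards are at most 1, \<open>For 3 g\<close> acts as a conditional.\<close>

definition cover_gen :: gen where
  "cover_gen = For 2 copies_expr (For 1 rows (gseq (map (\<lambda>\<tau>. gseq (map (\<lambda>(off, a, g).
     For 3 g (arc (Add (Mul (Add (Var 1) off) (Const d)) (Const a))
       (Add tiles_expr (Add (Mul (Var 2) constraints_expr)
         (Add (Mul (Var 1) (Const n_tab)) (Const \<tau>)))))) (tab ! \<tau>))) [0..<n_tab])))"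

definition sink_gen :: gen where
  "sink_gen = For 1 sink_expr (arc (Var 1) sink_expr)"

text \<open>The order is that of the threshold language: the threshold, the number of vertices, the
  arcs. The threshold is the number of all copies of constraints.\<close>

definition the_gen :: gen where
  "the_gen = gseq [Num (Mul copies_expr constraints_expr), Num (Add sink_expr (Const 1)),
     layer_gen, cover_gen, sink_gen]"

definition layer_list :: "bool list \<Rightarrow> (nat \<times> nat) list" where
  "layer_list x = concat (map (\<lambda>c. concat (map (\<lambda>a. map (\<lambda>b. (c * d + a, Suc c * d + b))
     [0..<d]) [0..<d])) [0..<n_cells x - 1])"

definition cover_entry :: "bool list \<Rightarrow> nat \<Rightarrow> nat \<Rightarrow> nat \<Rightarrow> expr \<times> nat \<times> expr \<Rightarrow> (nat \<times> nat) list" where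
  "cover_entry x j c \<tau> = (\<lambda>(off, a, g). replicate (val x g (env x c))
     ((c + val x off (env x c)) * d + a,
      n_cells x * d + (j * (n_rows x * n_tab) + (c * n_tab + \<tau>))))"

definition cover_entries :: "bool list \<Rightarrow> nat \<Rightarrow> nat \<Rightarrow> nat \<Rightarrow> (nat \<times> nat) list" where
  "cover_entries x j c \<tau> = concat (map (cover_entry x j c \<tau>) (tab ! \<tau>))"

definition cover_list :: "bool list \<Rightarrow> (nat \<times> nat) list" where
  "cover_list x = concat (map (\<lambda>j. concat (map (\<lambda>c. concat (map (cover_entries x j c)
     [0..<n_tab])) [0..<n_rows x])) [0..<copies x])"

definition sink_list :: "bool list \<Rightarrow> (nat \<times> nat) list" where
  "sink_list x = map (\<lambda>v. (v, sink x)) [0..<sink x]"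

lemma val_sizes:
  assumes "R 0 = length x"
  shows "val x cells R = n_cells x" "val x rows R = n_rows x" "val x tiles_expr R = n_cells x * d"
    "val x copies_expr R = copies x" "val x constraints_expr R = n_rows x * n_tab"
    "val x sink_expr R = sink x"
proof -
  show c: "val x cells R = n_cells x" "val x rows R = n_rows x"
    using assms vars_cells vars_rows by (auto intro!: val_cong simp: env_def)
  show "val x tiles_expr R = n_cells x * d" "val x copies_expr R = copies x"
    "val x constraints_expr R = n_rows x * n_tab" "val x sink_expr R = sink x"
    by (simp_all add: tiles_expr_def copies_expr_def constraints_expr_def sink_expr_def c
        copies_def sink_def)
qed

lemma emit_layer: "R 0 = length x \<Longrightarrow> emit x layer_gen R = code (layer_list x)"
  by (simp add: layer_gen_def layer_list_def val_sizes gseq_simps arc_simps code_concat code_map comp_def)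

lemma emit_cover: "R 0 = length x \<Longrightarrow> emit x cover_gen R = code (cover_list x)"
proof -
  assume R: "R 0 = length x"
  have *: "emit x (case e of (off, a, g) \<Rightarrow>
     For 3 g (arc (Add (Mul (Add (Var 1) off) (Const d)) (Const a))
       (Add tiles_expr (Add (Mul (Var 2) constraints_expr)
         (Add (Mul (Var 1) (Const n_tab)) (Const \<tau>)))))) (R(2 := j, 1 := c)) =
     code (cover_entry x j c \<tau> e)"
    if "e \<in> set (tab ! \<tau>)" "\<tau> < n_tab" for e \<tau> j c
  proof -
    obtain off a g where e: "e = (off, a, g)" by (cases e)
    have v: "vars off \<subseteq> {0, 1}" "vars g \<subseteq> {0, 1}"
      using vars_tab[of "tab ! \<tau>" off a g] that e by auto
    have g: "val x g (R(2 := j, 1 := c)) = val x g (env x c)"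
      using v R by (intro val_env) auto
    have off: "val x off (R(2 := j, 1 := c, 3 := i)) = val x off (env x c)" for i
      using v R by (intro val_env) auto
    have sizes: "val x tiles_expr (R(2 := j, 1 := c, 3 := i)) = n_cells x * d"
       "val x constraints_expr (R(2 := j, 1 := c, 3 := i)) = n_rows x * n_tab" for i
      using R by (simp_all add: val_sizes)
    show ?thesis
      unfolding e cover_entry_def prod.case code_replicate emit.simps g arc_simps val.simps off sizes by simp
  qed
  show ?thesis
    unfolding cover_gen_def cover_list_def cover_entries_def code_concat
    by (simp add: gseq_simps val_sizes R comp_def code_concat,
      intro arg_cong[where f = concat] map_cong refl, rule *[unfolded One_nat_def]) auto
qed

lemma emit_sink: "R 0 = length x \<Longrightarrow> emit x sink_gen R = code (sink_list x)"
  by (simp add: sink_gen_def sink_list_def val_sizes arc_simps comp_def code_map)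

lemma emit_the_gen:
  assumes "R 0 = length x"
  shows "emit x the_gen R = encode_nats (copies x * (n_rows x * n_tab) # Suc (sink x) #
     concat (map (arc_code (\<lambda>_. 1)) (layer_list x @ cover_list x @ sink_list x)))"
proof -
  have "encode_nats (a # b # concat (map (arc_code (\<lambda>_. 1)) as)) = encode_nat a @ encode_nat b @ code as" for a b as
    by (simp add: encode_nats_def code_def)
  then show ?thesis
    using assms by (simp add: the_gen_def gseq_simps val_sizes emit_layer emit_cover emit_sink
      code_append del: map_append concat_append)
qed

lemma set_layer_list: "set (layer_list x) = layer_arcs x"
proof -
  have 1: "(\<exists>c a b. e = (c * d + a, Suc c * d + b) \<and> Suc c < n_cells x \<and> a < d \<and> b < d) \<longleftrightarrow>
      (\<exists>c \<in> {0..<n_cells x - 1}. \<exists>a \<in> {0..<d}. \<exists>b \<in> {0..<d}. e = (c * d + a, Suc c * d + b))"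
    for e
    unfolding Bex_def atLeastLessThan_iff less_diff_conv by (metis Suc_eq_plus1 zero_le)
  have 2: "e \<in> set (layer_list x) \<longleftrightarrow>
      (\<exists>c \<in> {0..<n_cells x - 1}. \<exists>a \<in> {0..<d}. \<exists>b \<in> {0..<d}. e = (c * d + a, Suc c * d + b))"
    for e
    unfolding layer_list_def by (simp add: image_iff del: mult_Suc)
  show ?thesis
    unfolding layer_arcs_def by (rule set_eqI) (simp only: mem_Collect_eq 1 2)
qed

lemma set_cover_list: "set (cover_list x) = cover_arcs x"
proof (intro set_eqI iffI)
  fix uv assume "uv \<in> set (cover_list x)"
  then obtain j c \<tau> off a g where h: "j < copies x" "c < n_rows x" "\<tau> < n_tab"
    "(off, a, g) \<in> set (tab ! \<tau>)" "val x g (env x c) \<noteq> 0"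
    "uv = ((c + val x off (env x c)) * d + a,
        n_cells x * d + (j * (n_rows x * n_tab) + (c * n_tab + \<tau>)))"
    by (auto simp: cover_list_def cover_entries_def cover_entry_def)
  have mem: "tab ! \<tau> \<in> set tab" using h by auto
  have less: "c + val x off (env x c) < n_cells x" "a < d"
    using off_less[OF h(2) mem h(4)] tab_less[OF mem h(4)] by auto
  have z: "(c * n_tab + \<tau>) div n_tab = c" "(c * n_tab + \<tau>) mod n_tab = \<tau>"
    by (rule div_mod_add[OF h(3)])+
  have "c * n_tab + \<tau> < n_rows x * n_tab"
    using h(2,3) mult_le_mono1[of "Suc c" "n_rows x" n_tab] by simp
  moreover have "cov x (c * n_tab + \<tau>) (c + val x off (env x c)) a"
    unfolding cov_def z using h by force
  ultimately show "uv \<in> cover_arcs x"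
    unfolding cover_arcs_def h(6) using h(1) less by blast
next
  fix uv assume "uv \<in> cover_arcs x"
  then obtain c' a' j z where h: "uv = (c' * d + a', n_cells x * d + (j * (n_rows x * n_tab) + z))"
    "j < copies x" "z < n_rows x * n_tab" "cov x z c' a'"
    unfolding cover_arcs_def by blast
  define c \<tau> where "c = z div n_tab" "\<tau> = z mod n_tab"
  have n: "0 < n_tab" using h(3) by (auto intro: gr0I)
  have z: "z = c * n_tab + \<tau>" and c: "c < n_rows x" and t: "\<tau> < n_tab"
    using h(3) n by (auto simp: c_\<tau>_def less_mult_imp_div_less)
  obtain off g where e: "(off, a', g) \<in> set (tab ! \<tau>)" "c' = c + val x off (env x c)"
     "val x g (env x c) \<noteq> 0"
    using h(4) unfolding cov_def c_\<tau>_def by auto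
  have "uv \<in> set (cover_entry x j c \<tau> (off, a', g))"
    using e h z by (simp add: cover_entry_def)
  then have "uv \<in> set (cover_entries x j c \<tau>)"
    using e(1) by (auto simp: cover_entries_def)
  then show "uv \<in> set (cover_list x)"
    using h(2) c t unfolding cover_list_def set_concat set_map set_upt image_image
    by (intro UN_I[of j] UN_I[of c] UN_I[of \<tau>]) auto
qed

lemma set_sink_list: "set (sink_list x) = sink_arcs x"
  by (auto simp: sink_list_def sink_arcs_def)

lemma cover_entriesD:
  "v \<in> set (cover_entries x j c \<tau>) \<Longrightarrow>
   snd v = n_cells x * d + (j * (n_rows x * n_tab) + (c * n_tab + \<tau>))"
  by (auto simp: cover_entries_def cover_entry_def)

text \<open>Arcs of one constraint copy share their target, so their sources must differ. A source
  \<open>c' * d + a\<close> determines offset and tile since \<open>a < d\<close>, and a guard of at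
  most 1 excludes repetition of a single entry.\<close>

lemma distinct_cover_entries:
  assumes c: "c < n_rows x" and \<tau>: "\<tau> < n_tab"
  shows "distinct (cover_entries x j c \<tau>)"
  unfolding cover_entries_def
proof (rule distinct_concat_map)
  have mem: "tab ! \<tau> \<in> set tab" using \<tau> by auto
  let ?f = "\<lambda>(off, a, g :: expr). (val x off (env x c), a)"
  have dm: "distinct (map ?f (tab ! \<tau>))" by (rule tab_distinct[OF c mem])
  then show "distinct (tab ! \<tau>)" by (simp add: distinct_map)
  show "distinct (cover_entry x j c \<tau> e)" if "e \<in> set (tab ! \<tau>)" for e
  proof -
    obtain off a g where e: "e = (off, a, g)" by (cases e)
    have "val x g (env x c) \<le> 1" using guard_le[OF c mem] that e by auto
    then show ?thesis by (auto simp: e cover_entry_def le_Suc_eq)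
  qed
  fix e e' v assume e: "e \<in> set (tab ! \<tau>)" "e' \<in> set (tab ! \<tau>)"
    and v: "v \<in> set (cover_entry x j c \<tau> e)" "v \<in> set (cover_entry x j c \<tau> e')"
  obtain off a g where e1: "e = (off, a, g)" by (cases e)
  obtain off' a' g' where e2: "e' = (off', a', g')" by (cases e')
  have "a < d" "a' < d" using e tab_less[OF mem] e1 e2 by auto
  moreover have "(c + val x off (env x c)) * d + a = (c + val x off' (env x c)) * d + a'"
    using v by (simp add: e1 e2 cover_entry_def)
  ultimately have "c + val x off (env x c) = c + val x off' (env x c) \<and> a = a'"
    by (rule mult_add_inj)
  then have "?f e = ?f e'" by (simp add: e1 e2)
  then show "e = e'" using dm e by (auto simp: distinct_map inj_on_def)
qed

text \<open>The target of an arc determines copy, cell and table member, as digits of a mixed-radix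
  number.\<close>

lemma distinct_cover_list: "distinct (cover_list x)"
  unfolding cover_list_def
proof (rule distinct_concat_map, simp, rule distinct_concat_map, simp, rule distinct_concat_map, simp)
  fix j c \<tau> assume "c \<in> set [0..<n_rows x]" "\<tau> \<in> set [0..<n_tab]"
  then show "distinct (cover_entries x j c \<tau>)" by (simp add: distinct_cover_entries)
next
  fix j c \<tau> \<tau>' v
  assume "v \<in> set (cover_entries x j c \<tau>)" "v \<in> set (cover_entries x j c \<tau>')"
  then show "\<tau> = \<tau>'"
    using cover_entriesD[of v x j c \<tau>] cover_entriesD[of v x j c \<tau>'] by simp
next
  fix j c c' v
  assume "v \<in> set (concat (map (cover_entries x j c) [0..<n_tab]))"
    "v \<in> set (concat (map (cover_entries x j c') [0..<n_tab]))"
  then obtain \<tau> \<tau>' where t: "\<tau> < n_tab" "\<tau>' < n_tab"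
    "v \<in> set (cover_entries x j c \<tau>)" "v \<in> set (cover_entries x j c' \<tau>')" by auto
  then have "c * n_tab + \<tau> = c' * n_tab + \<tau>'"
    using cover_entriesD[OF t(3)] cover_entriesD[OF t(4)] by simp
  then show "c = c'" using mult_add_inj t by blast
next
  fix j j' v
  assume "v \<in> set (concat (map (\<lambda>c. concat (map (cover_entries x j c) [0..<n_tab])) [0..<n_rows x]))"
    "v \<in> set (concat (map (\<lambda>c. concat (map (cover_entries x j' c) [0..<n_tab])) [0..<n_rows x]))"
  then obtain c c' \<tau> \<tau>' where h: "c < n_rows x" "c' < n_rows x" "\<tau> < n_tab" "\<tau>' < n_tab"
    and v: "v \<in> set (cover_entries x j c \<tau>)" "v \<in> set (cover_entries x j' c' \<tau>')" by auto
  have eq: "j * (n_rows x * n_tab) + (c * n_tab + \<tau>) = j' * (n_rows x * n_tab) + (c' * n_tab + \<tau>')"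
    using cover_entriesD[OF v(1)] cover_entriesD[OF v(2)] by simp
  have "c * n_tab + \<tau> < n_rows x * n_tab" "c' * n_tab + \<tau>' < n_rows x * n_tab"
    using h mult_le_mono1[of "Suc c" "n_rows x" n_tab] mult_le_mono1[of "Suc c'" "n_rows x" n_tab]
    by auto
  then show "j = j'" using mult_add_inj[OF _ _ eq] by blast
qed

lemma distinct_layer_list: "distinct (layer_list x)"
  unfolding layer_list_def
proof (rule distinct_concat_map, simp, rule distinct_concat_map, simp)
  show "distinct (map (\<lambda>b. (c * d + a, Suc c * d + b)) [0..<d])" for c a
    by (auto simp: distinct_map inj_on_def)
next
  fix c a a' v
  assume "v \<in> set (map (\<lambda>b. (c * d + a, Suc c * d + b)) [0..<d])"
    "v \<in> set (map (\<lambda>b. (c * d + a', Suc c * d + b)) [0..<d])"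
  then show "a = a'" by auto
next
  fix c c' v
  assume "v \<in> set (concat (map (\<lambda>a. map (\<lambda>b. (c * d + a, Suc c * d + b)) [0..<d]) [0..<d]))"
    "v \<in> set (concat (map (\<lambda>a. map (\<lambda>b. (c' * d + a, Suc c' * d + b)) [0..<d]) [0..<d]))"
  then obtain a a' where "a < d" "a' < d" "c * d + a = c' * d + a'" by auto
  then show "c = c'" using mult_add_inj by blast
qed

text \<open>The three kinds of arcs have disjoint ranges of targets: layers, copies, sink.\<close>

lemma distinct_arcs: "distinct (layer_list x @ cover_list x @ sink_list x)"
proof -
  have "snd e < n_cells x * d" if "e \<in> layer_arcs x" for e
    using that by (cases e) (simp add: layer_arcs_iff)
  moreover have "n_cells x * d \<le> snd e \<and> snd e < sink x" if "e \<in> cover_arcs x" for e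
    using that copy_less unfolding cover_arcs_def sink_def by auto
  moreover have "snd e = sink x" if "e \<in> sink_arcs x" for e
    using that by (auto simp: sink_arcs_def)
  moreover have "n_cells x * d \<le> sink x" by (simp add: sink_def)
  ultimately have "layer_arcs x \<inter> cover_arcs x = {}" "layer_arcs x \<inter> sink_arcs x = {}"
    "cover_arcs x \<inter> sink_arcs x = {}"
    by (simp_all only: disjoint_iff) (metis not_le less_irrefl order_less_le_trans)+
  moreover have "distinct (sink_list x)" by (simp add: sink_list_def distinct_map inj_on_def)
  ultimately show ?thesis
    using distinct_layer_list distinct_cover_list
    by (auto simp: set_layer_list set_cover_list set_sink_list)
qed

theorem poly_reducible_table:
  assumes "\<And>x. x \<in> A \<longleftrightarrow>
    (\<exists>X. (\<forall>c < n_cells x. X c < d) \<and> (\<forall>c < n_rows x. \<forall>\<tau> < n_tab. satisfies x X c \<tau>))"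
  shows "poly_reducible A degree_language"
proof -
  have "wf_gen the_gen" "0 \<notin> binders the_gen"
    by (auto simp: the_gen_def gseq_simps layer_gen_def cover_gen_def sink_gen_def arc_simps split: prod.splits)
  then have "poly_time_computable (\<lambda>x. emit x the_gen ((\<lambda>_. 0)(0 := length x)))"
    by (rule poly_time_computable_emit)
  moreover have "x \<in> A \<longleftrightarrow> emit x the_gen ((\<lambda>_. 0)(0 := length x)) \<in> degree_language" for x
  proof -
    let ?as = "layer_list x @ cover_list x @ sink_list x"
    have "Suc (sink x) # concat (map (arc_code (\<lambda>_. 1)) ?as) \<in> graph_codes (graph x) (\<lambda>_. 1)"
      unfolding graph_codes_def using distinct_arcs[of x]
      by (intro CollectI exI[of _ "Suc (sink x)"] exI[of _ ?as])
        (auto simp: graph_def set_layer_list set_cover_list set_sink_list)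
    note lang = degree_language_iff[OF weighted_graph this]
    have sat: "(\<exists>X. (\<forall>c<n_cells x. X c < d) \<and>
        (\<forall>z<n_rows x * n_tab. \<exists>c<n_cells x. cov x z c (X c))) \<longleftrightarrow> x \<in> A"
    proof -
      have "(\<forall>z<n_rows x * n_tab. \<exists>c<n_cells x. cov x z c (X c)) \<longleftrightarrow>
        (\<forall>c < n_rows x. \<forall>\<tau> < n_tab. satisfies x X c \<tau>)" for X
      proof (intro iffI allI impI)
        fix c \<tau> assume c: "c < n_rows x" "\<tau> < n_tab"
          and h: "\<forall>z<n_rows x * n_tab. \<exists>c<n_cells x. cov x z c (X c)"
        have "c * n_tab + \<tau> < n_rows x * n_tab"
          using c mult_le_mono1[of "Suc c" "n_rows x" n_tab] by simp
        then obtain c' where "cov x (c * n_tab + \<tau>) c' (X c')" using h by blast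
        moreover have "(c * n_tab + \<tau>) div n_tab = c" "(c * n_tab + \<tau>) mod n_tab = \<tau>"
          by (rule div_mod_add[OF c(2)])+
        ultimately show "satisfies x X c \<tau>" by (force simp: cov_def satisfies_def)
      next
        fix z assume h: "\<forall>c < n_rows x. \<forall>\<tau> < n_tab. satisfies x X c \<tau>" and z: "z < n_rows x * n_tab"
        then have n: "0 < n_tab" by (auto intro: gr0I)
        define c \<tau> where "c = z div n_tab" "\<tau> = z mod n_tab"
        have c: "c < n_rows x" and t: "\<tau> < n_tab"
          using z n by (auto simp: c_\<tau>_def less_mult_imp_div_less)
        then obtain off a g where e: "(off, a, g) \<in> set (tab ! \<tau>)"
          "X (c + val x off (env x c)) = a" "val x g (env x c) \<noteq> 0"
          using h unfolding satisfies_def by blast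
        then have "cov x z (c + val x off (env x c)) (X (c + val x off (env x c)))"
          unfolding cov_def c_\<tau>_def by auto
        moreover have "c + val x off (env x c) < n_cells x"
          using off_less[OF c _ e(1)] t by simp
        ultimately show "\<exists>c<n_cells x. cov x z c (X c)" by blast
      qed
      then show ?thesis using assms[of x] by simp
    qed
    have "((\<lambda>_. 0)(0 := length x)) 0 = length x" by simp
    from emit_the_gen[of "(\<lambda>_. 0)(0 := length x)" x, OF this] show ?thesis
      by (simp only: lang max_degree_iff sat)
  qed
  ultimately show ?thesis unfolding poly_reducible_def by blast
qed

end

section \<open>Computations as tilings\<close>

primrec poly_of_list_expr :: "nat list \<Rightarrow> expr \<Rightarrow> expr" where
  "poly_of_list_expr [] e = Const 0"
| "poly_of_list_expr (a # as) e = Add (Const a) (Mul e (poly_of_list_expr as e))"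

definition poly_expr :: "nat poly \<Rightarrow> expr \<Rightarrow> expr" where
  "poly_expr p e = poly_of_list_expr (coeffs p) e"

lemma val_poly_expr: "val x (poly_expr p e) R = poly p (val x e R)"
proof -
  have "val x (poly_of_list_expr as e) R = poly (Poly as) (val x e R)" for as
    by (induction as) auto
  then show ?thesis by (simp add: poly_expr_def)
qed

lemma vars_poly_expr: "vars (poly_expr p e) \<subseteq> vars e"
proof -
  have "vars (poly_of_list_expr as e) \<subseteq> vars e" for as
    by (induction as) auto
  then show ?thesis by (simp add: poly_expr_def)
qed

text \<open>With truncated subtraction, \<open>1 - (1 - m)\<close> is the indicator of
  \<open>m\<close> being nonzero, and \<open>b - a\<close> is nonzero iff
  \<open>a < b\<close>.\<close>

definition lt_expr :: "expr \<Rightarrow> expr \<Rightarrow> expr" where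
  "lt_expr a b = Sub (Const 1) (Sub (Const 1) (Sub b a))"

definition not_expr :: "expr \<Rightarrow> expr" where
  "not_expr a = Sub (Const 1) a"

definition and_expr :: "expr \<Rightarrow> expr \<Rightarrow> expr" where
  "and_expr a b = Sub (Const 1) (Sub (Const 1) (Mul a b))"

lemma val_and_expr: "val x (and_expr a b) R = of_bool (val x a R \<noteq> 0 \<and> val x b R \<noteq> 0)"
  by (auto simp: and_expr_def)

lemma val_lt_expr: "val x (lt_expr a b) R = of_bool (val x a R < val x b R)"
  by (auto simp: lt_expr_def)

lemma val_not_expr: "val x (not_expr a) R = of_bool (val x a R = 0)"
  by (auto simp: not_expr_def)

lemma vars_bool_expr: "vars (lt_expr a b) = vars a \<union> vars b" "vars (not_expr a) = vars a"
  "vars (and_expr a b) = vars a \<union> vars b"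
  by (auto simp: lt_expr_def not_expr_def and_expr_def)

section \<open>Local views of configurations\<close>

type_synonym view = "nat \<times> nat list \<times> nat list \<times> int list"
type_synonym tile = "view \<times> bool \<times> bool"

fun view_state :: "view \<Rightarrow> nat" where "view_state (q, rs, cs, fs) = q"
fun view_reads :: "view \<Rightarrow> nat list" where "view_reads (q, rs, cs, fs) = rs"
fun view_contents :: "view \<Rightarrow> nat list" where "view_contents (q, rs, cs, fs) = cs"
fun view_dirs :: "view \<Rightarrow> int list" where "view_dirs (q, rs, cs, fs) = fs"

lemma view_eqI:
  "view_state v = view_state w \<Longrightarrow> view_reads v = view_reads w \<Longrightarrow>
   view_contents v = view_contents w \<Longrightarrow> view_dirs v = view_dirs w \<Longrightarrow> v = w"
  by (cases v; cases w) auto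

definition reads :: "tm \<Rightarrow> config \<Rightarrow> nat list" where
  "reads M C = map (\<lambda>i. content C i (head_pos C i)) [0..<tapes M]"

text \<open>The sign is 1 if the head is to the right of the column. Sign 0 marks the column of the
  head, the one place where the symbols read can be compared with the contents.\<close>

definition view :: "tm \<Rightarrow> config \<Rightarrow> int \<Rightarrow> view" where
  "view M C z = (state C, reads M C, map (\<lambda>i. content C i z) [0..<tapes M],
     map (\<lambda>i. sgn (head_pos C i - z)) [0..<tapes M])"

lemma view_sels [simp]:
  "view_state (view M C z) = state C"
  "view_reads (view M C z) = reads M C"
  "view_contents (view M C z) = map (\<lambda>i. content C i z) [0..<tapes M]"
  "view_dirs (view M C z) = map (\<lambda>i. sgn (head_pos C i - z)) [0..<tapes M]"
  by (simp_all add: view_def)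

abbreviation last_col :: "tile \<Rightarrow> bool" where "last_col a \<equiv> fst (snd a)"
abbreviation ended :: "tile \<Rightarrow> bool" where "ended a \<equiv> snd (snd a)"

text \<open>
  In a tile, the first flag marks the last column, where the cell with the next number starts a new
  row, and the second flag marks, in the first row, the columns after the end of the certificate.
\<close>

definition horizontal :: "tm \<Rightarrow> tile \<Rightarrow> tile \<Rightarrow> bool" where
  "horizontal M a b \<longleftrightarrow> last_col a \<or>
     (\<exists>C z. fst a = view M C z \<and> fst b = view M C (z + 1)) \<and> (ended a \<longrightarrow> ended b)"

text \<open>The witness \<open>C\<close> may be any configuration and may change from pair to pair;
  that all witnesses fit one run is proved later. No procedure for deciding the relation is
  required: for fixed \<open>M\<close> it is a finite relation on tiles, built into the reduction as
  a constant.\<close>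

definition vertical :: "tm \<Rightarrow> tile \<Rightarrow> tile \<Rightarrow> bool" where
  "vertical M a b \<longleftrightarrow>
     (\<exists>C z. fst a = view M C z \<and> fst b = view M (step M C) z) \<and> last_col a = last_col b"

text \<open>The transition function, made to agree with \<^const>\<open>step\<close> in the halting states.\<close>

definition effect :: "tm \<Rightarrow> nat \<Rightarrow> nat list \<Rightarrow> nat \<times> (nat \<times> direction) list" where
  "effect M q rs = (if q = accept M \<or> q = reject M then (q, map (\<lambda>s. (s, Stay)) rs) else delta M q rs)"

lemma step_effect:
  assumes "effect M (state C) (reads M C) = (q, acts)" "i < tapes M"
  shows "state (step M C) = q"
    "head_pos (step M C) i = head_pos C i + offset (snd (acts ! i))"
    "content (step M C) i = (content C i)(head_pos C i := fst (acts ! i))"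
proof -
  have "state (step M C) = q \<and> head_pos (step M C) i = head_pos C i + offset (snd (acts ! i)) \<and>
    content (step M C) i = (content C i)(head_pos C i := fst (acts ! i))"
  proof (cases "halted M C")
    case True
    then have "step M C = C" "q = state C" "acts = map (\<lambda>s. (s, Stay)) (reads M C)"
      using assms(1) by (auto simp: step_def effect_def halted_def)
    then show ?thesis using assms(2) by (simp add: reads_def)
  next
    case False
    then have "delta M (state C) (reads M C) = (q, acts)"
      using assms(1) by (auto simp: effect_def halted_def)
    then show ?thesis using False assms(2) by (simp add: step_def reads_def)
  qed
  then show "state (step M C) = q"
    "head_pos (step M C) i = head_pos C i + offset (snd (acts ! i))"
    "content (step M C) i = (content C i)(head_pos C i := fst (acts ! i))"
    by blast+
qed

lemma offset_cases: "offset d = -1 \<or> offset d = 0 \<or> offset d = 1"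
  by (cases d) auto

text \<open>This bound is what confines the heads to a window of polynomial width.\<close>

lemma head_pos_run_bound: "i < tapes M \<Longrightarrow> \<bar>head_pos (run M xs t) i\<bar> \<le> int t"
proof (induction t)
  case 0
  then show ?case by (simp add: run_def initial_def)
next
  case (Suc t)
  obtain q acts where e: "effect M (state (run M xs t)) (reads M (run M xs t)) = (q, acts)"
    by (cases "effect M (state (run M xs t)) (reads M (run M xs t))")
  have "run M xs (Suc t) = step M (run M xs t)" by (simp add: run_def)
  then show ?case
    using Suc step_effect(2)[OF e] offset_cases[of "snd (acts ! i)"] by auto
qed

definition valid :: "tm \<Rightarrow> config \<Rightarrow> bool" where
  "valid M C \<longleftrightarrow> state C < states M \<and> (\<forall>i < tapes M. \<forall>z. content C i z < symbols M)"

lemma valid_step: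
  assumes "wf_tm M" "valid M C"
  shows "valid M (step M C)"
proof (cases "halted M C")
  case True
  then show ?thesis using assms by (simp add: step_def)
next
  case False
  obtain q acts where d: "delta M (state C) (reads M C) = (q, acts)"
    by (cases "delta M (state C) (reads M C)")
  have "length (reads M C) = tapes M \<and> (\<forall>s \<in> set (reads M C). s < symbols M)"
    using assms(2) by (auto simp: reads_def valid_def)
  moreover have "state C < states M" using assms(2) by (simp add: valid_def)
  ultimately have "fst (delta M (state C) (reads M C)) < states M \<and>
      length (snd (delta M (state C) (reads M C))) = tapes M \<and>
      (\<forall>a \<in> set (snd (delta M (state C) (reads M C))). fst a < symbols M)"
    using assms(1) unfolding wf_tm_def by blast
  then have q: "q < states M" "length acts = tapes M" "\<forall>a \<in> set acts. fst a < symbols M"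
    by (simp_all add: d)
  then have "fst (acts ! i) < symbols M" if "i < tapes M" for i
    using that by (metis nth_mem)
  moreover have "step M C =
     \<lparr> state = q,
       head_pos = (\<lambda>i. if i < tapes M then head_pos C i + offset (snd (acts ! i)) else head_pos C i),
       content = (\<lambda>i. if i < tapes M then (content C i)(head_pos C i := fst (acts ! i))
         else content C i) \<rparr>"
    using False d by (simp add: step_def reads_def)
  ultimately show ?thesis
    using assms(2) q(1) by (simp add: valid_def)
qed

lemma valid_run: "wf_tm M \<Longrightarrow> valid M (run M xs t)"
proof (induction t)
  case 0
  then show ?case by (auto simp: run_def initial_def valid_def wf_tm_def tape_of_def)
next
  case (Suc t)
  then show ?case using valid_step[of M "run M xs t"] by (simp add: run_def)
qed

definition tiles :: "tm \<Rightarrow> tile set" where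
  "tiles M = ({..<states M} \<times> {rs. set rs \<subseteq> {..<symbols M} \<and> length rs = tapes M} \<times>
     {cs. set cs \<subseteq> {..<symbols M} \<and> length cs = tapes M} \<times>
     {fs. set fs \<subseteq> {-1, 0, 1} \<and> length fs = tapes M}) \<times> UNIV \<times> UNIV"

lemma finite_tiles: "finite (tiles M)"
  unfolding tiles_def by (intro finite_cartesian_product finite_lists_length_eq) auto

lemma view_tiles: "valid M C \<Longrightarrow> (view M C z, l, e) \<in> tiles M"
  by (auto simp: tiles_def view_def valid_def reads_def sgn_if)

text \<open>The pair \<open>h'\<close>, \<open>z'\<close> is a foreign witness with the same sign as
  the true \<open>h\<close>, \<open>z\<close>. The new sign then agrees as well, unless the head
  moves towards the column: the sign does not tell whether it arrives.\<close>

lemma sgn_int_step: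
  fixes h :: int
  assumes "sgn (h' - z') = sgn (h - z)" "k = -1 \<or> k = 0 \<or> k = 1"
  shows "h = z \<Longrightarrow> sgn (h' + k - z') = sgn k"
    and "z < h \<Longrightarrow> k \<noteq> -1 \<Longrightarrow> sgn (h' + k - z') = 1"
    and "z < h \<Longrightarrow> k = -1 \<Longrightarrow> sgn (h' + k - z') \<in> {0, 1}"
    and "h < z \<Longrightarrow> k \<noteq> 1 \<Longrightarrow> sgn (h' + k - z') = -1"
    and "h < z \<Longrightarrow> k = 1 \<Longrightarrow> sgn (h' + k - z') \<in> {0, -1}"
  using assms by (auto simp: sgn_if split: if_splits)

text \<open>
  The pairwise constraints determine the direction flags of the next row: a flag is fixed by the
  old one except between the old cell of the head and the side it moves to, where it is settled by
  the horizontal neighbour on the side of the old cell.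
\<close>

lemma flags_determined:
  fixes f :: "int \<Rightarrow> int"
  assumes k: "k = -1 \<or> k = 0 \<or> k = 1" and h: "lo \<le> h" "h < hi"
    and vert: "\<And>z. lo \<le> z \<Longrightarrow> z < hi \<Longrightarrow> \<exists>h' z'. sgn (h' - z') = sgn (h - z) \<and> f z = sgn (h' + k - z')"
    and hor: "\<And>z. lo \<le> z \<Longrightarrow> z + 1 < hi \<Longrightarrow> \<exists>h'. f z = sgn h' \<and> f (z + 1) = sgn (h' - 1)"
    and z: "lo \<le> z" "z < hi"
  shows "f z = sgn (h + k - z)"
proof -
  have fh: "f h = sgn k"
    using vert[OF h] sgn_int_step(1)[OF _ k] by metis
  \<comment> \<open>Read from left to right, the signs can only be a run of 1, then one 0, then a
    run of -1; in particular 1 is never followed by -1.\<close>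
  have hor': "f z = 1 \<and> f (z + 1) \<in> {0, 1} \<or> f z = 0 \<and> f (z + 1) = -1 \<or> f z = -1 \<and> f (z + 1) = -1"
    if zb: "lo \<le> z" "z + 1 < hi" for z
  proof -
    obtain h' where h': "f z = sgn h'" "f (z + 1) = sgn (h' - 1)" using hor[OF zb] by blast
    consider "h' > 0" | "h' = 0" | "h' < 0" by linarith
    then show ?thesis by cases (auto simp: h' sgn_if)
  qed
  obtain h' z' where w: "sgn (h' - z') = sgn (h - z)" "f z = sgn (h' + k - z')" using vert[OF z] by blast
  consider "z = h" | "z < h" | "h < z" by linarith
  then show ?thesis
  proof cases
    case 1
    then show ?thesis using fh by simp
  next
    case 2
    show ?thesis
    proof (cases "k = -1")
      case True
      \<comment> \<open>The right neighbour settles which it is. If it is the old cell of the head,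
        its sign is -1, which forces 0 here; otherwise its sign is 0 or 1, which forces 1
        here.\<close>
      have fz: "f z \<in> {0, 1}" using sgn_int_step(3)[OF w(1) k 2 True] w(2) by simp
      show ?thesis
      proof (cases "z + 1 = h")
        case True
        then have "f (z + 1) = -1" using fh \<open>k = -1\<close> by simp
        then show ?thesis using hor'[of z] fz z h True \<open>k = -1\<close> by auto
      next
        case False
        then have z1: "z + 1 < h" using 2 by simp
        obtain h1 z1' where w1: "sgn (h1 - z1') = sgn (h - (z + 1))" "f (z + 1) = sgn (h1 + k - z1')"
          using vert[of "z + 1"] z h z1 by auto
        have "f (z + 1) \<in> {0, 1}" using sgn_int_step(3)[OF w1(1) k z1 True] w1(2) by simp
        then have "f z = 1" using hor'[of z] z h z1 by auto
        then show ?thesis using z1 True by simp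
      qed
    next
      case False
      then show ?thesis using sgn_int_step(2)[OF w(1) k 2 False] w(2) k 2 by auto
    qed
  next
    case 3
    \<comment> \<open>Mirror image: the left neighbour decides.\<close>
    show ?thesis
    proof (cases "k = 1")
      case True
      have fz: "f z \<in> {0, -1}" using sgn_int_step(5)[OF w(1) k 3 True] w(2) by simp
      show ?thesis
      proof (cases "z - 1 = h")
        case True
        then have "f (z - 1) = 1" using fh \<open>k = 1\<close> by simp
        then show ?thesis using hor'[of "z - 1"] fz z h True \<open>k = 1\<close> by auto
      next
        case False
        then have z1: "h < z - 1" using 3 by simp
        obtain h1 z1' where w1: "sgn (h1 - z1') = sgn (h - (z - 1))" "f (z - 1) = sgn (h1 + k - z1')"
          using vert[of "z - 1"] z h z1 by auto
        have "f (z - 1) \<in> {0, -1}" using sgn_int_step(5)[OF w1(1) k z1 True] w1(2) by simp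
        then have "f z = -1" using hor'[of "z - 1"] z h z1 by auto
        then show ?thesis using z1 True by simp
      qed
    next
      case False
      then show ?thesis using sgn_int_step(4)[OF w(1) k 3 False] w(2) k 3 by auto
    qed
  qed
qed

section \<open>The grid of a verifier\<close>

locale verifier =
  fixes M :: tm and p q :: "nat poly"
  assumes wf: "wf_tm M"
    and halts: "\<And>xs. length xs = 2 \<Longrightarrow> halted M (run M xs (poly q (sum_list (map length xs))))"
begin

definition cert_expr :: expr where "cert_expr = poly_expr p (Var 0)"
definition time_expr :: expr where "time_expr = poly_expr q (Add (Var 0) cert_expr)"
definition origin_expr :: expr where "origin_expr = Add time_expr (Const 2)"
definition width_expr :: expr where "width_expr = Add (Add origin_expr origin_expr) cert_expr"

definition cert_len :: "bool list \<Rightarrow> nat" where "cert_len x = poly p (length x)"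
text \<open>This is the time bound for a certificate of full length; by monotonicity it covers all
  shorter ones.\<close>

definition time :: "bool list \<Rightarrow> nat" where "time x = poly q (length x + cert_len x)"
text \<open>The column of tape position 0. Within \<open>time x\<close> steps no head leaves the
  grid, with two columns to spare on the left. Input symbols beyond the window are cut off, which is
  harmless as no head gets there; the certificate is to fit in, whence \<open>cert_len x\<close> in
  the width.\<close>

definition origin :: "bool list \<Rightarrow> nat" where "origin x = time x + 2"
definition width :: "bool list \<Rightarrow> nat" where "width x = origin x + origin x + cert_len x"

lemma val_exprs:
  "val x cert_expr (env x c) = cert_len x"
  "val x time_expr (env x c) = time x"
  "val x origin_expr (env x c) = origin x"
  "val x width_expr (env x c) = width x"
  by (simp_all add: cert_expr_def time_expr_def origin_expr_def width_expr_def val_poly_expr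
      cert_len_def time_def origin_def width_def env_def)

lemma vars_exprs:
  "vars cert_expr \<subseteq> {0}" "vars time_expr \<subseteq> {0}" "vars origin_expr \<subseteq> {0}" "vars width_expr \<subseteq> {0}"
  using vars_poly_expr[of p "Var 0"] vars_poly_expr[of q "Add (Var 0) cert_expr"]
  by (auto simp: cert_expr_def time_expr_def origin_expr_def width_expr_def)

text \<open>Guarded conditions on the tile of the cell whose number is the value of variable 1.\<close>

definition unary :: "(expr \<times> (tile \<Rightarrow> bool)) list" where
  "unary =
    (let c = Var 1; row0 = lt_expr c width_expr; after = not_expr (lt_expr c origin_expr);
         bit = and_expr after (Bit (Sub c origin_expr));
         inp = and_expr after (lt_expr c (Add origin_expr (Var 0)));
         cert = and_expr after (lt_expr c (Add origin_expr cert_expr));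
         lst = not_expr (lt_expr (Add c (Const 1)) width_expr)
     in [(row0, \<lambda>a. view_state (fst a) = start M),
         (lt_expr c origin_expr, \<lambda>a. \<forall>i < tapes M. view_dirs (fst a) ! i = 1),
         (and_expr after (not_expr (lt_expr origin_expr c)), \<lambda>a. \<forall>i < tapes M. view_dirs (fst a) ! i = 0),
         (and_expr row0 (lt_expr origin_expr c), \<lambda>a. \<forall>i < tapes M. view_dirs (fst a) ! i = - 1),
         (row0, \<lambda>a. \<forall>i. 2 \<le> i \<and> i < tapes M \<longrightarrow> view_contents (fst a) ! i = 0),
         (and_expr row0 bit, \<lambda>a. view_contents (fst a) ! 0 = 2),
         (and_expr row0 (and_expr inp (not_expr bit)), \<lambda>a. view_contents (fst a) ! 0 = 1),
         (and_expr row0 (not_expr inp), \<lambda>a. view_contents (fst a) ! 0 = 0),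
         (cert, \<lambda>a. view_contents (fst a) ! 1 < 3 \<and> (view_contents (fst a) ! 1 = 0 \<longleftrightarrow> ended a)),
         (and_expr row0 (not_expr cert), \<lambda>a. view_contents (fst a) ! 1 = 0),
         (and_expr row0 lst, \<lambda>a. last_col a),
         (not_expr lst, \<lambda>a. \<not> last_col a),
         (and_expr (not_expr (lt_expr c (Mul width_expr time_expr)))
              (not_expr (lt_expr (Mul width_expr time_expr) c)), \<lambda>a. view_state (fst a) = accept M)])"

definition unary_ok :: "bool list \<Rightarrow> nat \<Rightarrow> tile \<Rightarrow> bool" where
  "unary_ok x c a \<longleftrightarrow> (\<forall>(g, P) \<in> set unary. val x g (env x c) \<noteq> 0 \<longrightarrow> P a)"

lemmas val_guard = val_lt_expr val_not_expr val_and_expr val.simps of_bool_eq_0_iff not_not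

lemma unary_guard:
  assumes "(g, P) \<in> set unary"
  shows "val x g (env x c) \<le> 1" "vars g \<subseteq> {0, 1}"
proof -
  have "\<forall>(g, P) \<in> set unary. val x g (env x c) \<le> 1"
    unfolding unary_def Let_def list.set
    by (simp only: ball_simps prod.case val_guard of_bool_less_eq_one simp_thms)
  then show "val x g (env x c) \<le> 1" using assms by blast
  have v: "vars cert_expr \<subseteq> {0, 1}" "vars time_expr \<subseteq> {0, 1}" "vars origin_expr \<subseteq> {0, 1}"
    "vars width_expr \<subseteq> {0, 1}"
    using vars_exprs by blast+
  have "\<forall>(g, P) \<in> set unary. vars g \<subseteq> {0, 1}"
    unfolding unary_def Let_def by (simp add: vars_bool_expr v[unfolded One_nat_def])
  then show "vars g \<subseteq> {0, 1}" using assms by blast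
qed

lemma unary_ok_unfold:
  "unary_ok x c a \<longleftrightarrow>
    (c < width x \<longrightarrow> view_state (fst a) = start M) \<and>
    (c < origin x \<longrightarrow> (\<forall>i < tapes M. view_dirs (fst a) ! i = 1)) \<and>
    (\<not> c < origin x \<and> \<not> origin x < c \<longrightarrow> (\<forall>i < tapes M. view_dirs (fst a) ! i = 0)) \<and>
    (c < width x \<and> origin x < c \<longrightarrow> (\<forall>i < tapes M. view_dirs (fst a) ! i = - 1)) \<and>
    (c < width x \<longrightarrow> (\<forall>i. 2 \<le> i \<and> i < tapes M \<longrightarrow> view_contents (fst a) ! i = 0)) \<and>
    (c < width x \<and> \<not> c < origin x \<and> (c - origin x < length x \<and> x ! (c - origin x)) \<longrightarrow>
       view_contents (fst a) ! 0 = 2) \<and>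
    (c < width x \<and> (\<not> c < origin x \<and> c < origin x + length x) \<and>
       \<not> (\<not> c < origin x \<and> (c - origin x < length x \<and> x ! (c - origin x))) \<longrightarrow>
       view_contents (fst a) ! 0 = 1) \<and>
    (c < width x \<and> \<not> (\<not> c < origin x \<and> c < origin x + length x) \<longrightarrow>
       view_contents (fst a) ! 0 = 0) \<and>
    (\<not> c < origin x \<and> c < origin x + cert_len x \<longrightarrow>
       view_contents (fst a) ! 1 < 3 \<and> (view_contents (fst a) ! 1 = 0 \<longleftrightarrow> ended a)) \<and>
    (c < width x \<and> \<not> (\<not> c < origin x \<and> c < origin x + cert_len x) \<longrightarrow>
       view_contents (fst a) ! 1 = 0) \<and>
    (c < width x \<and> \<not> c + 1 < width x \<longrightarrow> last_col a) \<and>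
    (c + 1 < width x \<longrightarrow> \<not> last_col a) \<and>
    (\<not> c < width x * time x \<and> \<not> width x * time x < c \<longrightarrow> view_state (fst a) = accept M)"
proof -
  have env: "env x c 0 = length x" "env x c 1 = c" by (simp_all add: env_def)
  show ?thesis
    unfolding unary_ok_def unary_def Let_def list.set
    by (simp only: ball_simps prod.case val_guard val_exprs env simp_thms)
qed

text \<open>The three guarded conditions on tape 0, for a set bit, a clear bit and the outside of
  the input, combine into one equation with \<open>tape_of x\<close>.\<close>

lemma unary_ok_iff:
  "unary_ok x c a \<longleftrightarrow>
    (c < width x \<longrightarrow> view_state (fst a) = start M) \<and>
    (c < origin x \<longrightarrow> (\<forall>i < tapes M. view_dirs (fst a) ! i = 1)) \<and>
    (c = origin x \<longrightarrow> (\<forall>i < tapes M. view_dirs (fst a) ! i = 0)) \<and>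
    (c < width x \<and> origin x < c \<longrightarrow> (\<forall>i < tapes M. view_dirs (fst a) ! i = - 1)) \<and>
    (c < width x \<longrightarrow> (\<forall>i. 2 \<le> i \<and> i < tapes M \<longrightarrow> view_contents (fst a) ! i = 0)) \<and>
    (c < width x \<longrightarrow> view_contents (fst a) ! 0 = tape_of x (int c - int (origin x))) \<and>
    (origin x \<le> c \<and> c < origin x + cert_len x \<longrightarrow>
       view_contents (fst a) ! 1 < 3 \<and> (view_contents (fst a) ! 1 = 0 \<longleftrightarrow> ended a)) \<and>
    (c < width x \<and> \<not> (origin x \<le> c \<and> c < origin x + cert_len x) \<longrightarrow>
       view_contents (fst a) ! 1 = 0) \<and>
    (Suc c = width x \<longrightarrow> last_col a) \<and>
    (Suc c < width x \<longrightarrow> \<not> last_col a) \<and>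
    (c = width x * time x \<longrightarrow> view_state (fst a) = accept M)"
proof -
  let ?v = "view_contents (fst a) ! 0" and ?O = "origin x"
  have "(c < width x \<and> \<not> c < ?O \<and> (c - ?O < length x \<and> x ! (c - ?O)) \<longrightarrow> ?v = 2) \<and>
    (c < width x \<and> (\<not> c < ?O \<and> c < ?O + length x) \<and>
       \<not> (\<not> c < ?O \<and> (c - ?O < length x \<and> x ! (c - ?O))) \<longrightarrow> ?v = 1) \<and>
    (c < width x \<and> \<not> (\<not> c < ?O \<and> c < ?O + length x) \<longrightarrow> ?v = 0) \<longleftrightarrow>
    (c < width x \<longrightarrow> ?v = tape_of x (int c - int ?O))"
  proof (cases "?O \<le> c")
    case True
    then obtain i where "c = ?O + i" using le_Suc_ex by blast
    then show ?thesis by (auto simp: tape_of_def)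
  next
    case False
    then show ?thesis by (auto simp: tape_of_def)
  qed
  moreover have "\<not> c < ?O \<and> \<not> ?O < c \<longleftrightarrow> c = ?O" by auto
  moreover have "\<not> c < width x * time x \<and> \<not> width x * time x < c \<longleftrightarrow> c = width x * time x" by auto
  moreover have "c < width x \<and> \<not> c + 1 < width x \<longleftrightarrow> Suc c = width x" by auto
  ultimately show ?thesis unfolding unary_ok_unfold not_less Suc_eq_plus1[symmetric] by satx
qed

text \<open>There is one row more than there are constrained ones, so that the cell below a
  constrained cell always exists. Row \<open>time x\<close>, where acceptance is checked, is itself
  constrained.\<close>

definition tiling :: "bool list \<Rightarrow> (nat \<Rightarrow> tile) \<Rightarrow> bool" where
  "tiling x X \<longleftrightarrow> (\<forall>c < width x * (time x + 2). X c \<in> tiles M) \<and>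
     (\<forall>c < width x * (time x + 1). horizontal M (X c) (X (c + 1)) \<and>
        vertical M (X c) (X (c + width x)) \<and> unary_ok x c (X c))"

text \<open>By \<open>time x\<close> the run has halted, and a halted configuration no longer
  changes.\<close>

lemma accepts_iff:
  assumes "length y \<le> cert_len x"
  shows "accepts M [x, y] \<longleftrightarrow> state (run M [x, y] (time x)) = accept M"
proof
  assume "accepts M [x, y]"
  then obtain t where t: "state (run M [x, y] t) = accept M" by (auto simp: accepts_def)
  have h: "halted M (run M [x, y] (poly q (length x + length y)))"
    using halts[of "[x, y]"] by simp
  have "poly q (length x + length y) \<le> time x"
    unfolding time_def using assms by (intro poly_nat_mono) simp
  then have h': "halted M (run M [x, y] (time x))" using h halted_run_mono[OF h] by metis
  have ht: "halted M (run M [x, y] t)" using t by (simp add: halted_def)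
  have "run M [x, y] t = run M [x, y] (time x)"
  proof (cases "t \<le> time x")
    case True
    show ?thesis by (rule halted_run_mono[OF ht True, symmetric])
  next
    case False
    then show ?thesis by (intro halted_run_mono[OF h']) simp
  qed
  then show "state (run M [x, y] (time x)) = accept M" using t by simp
qed (auto simp: accepts_def)

lemma initial_sels:
  "state (run M [x, y] 0) = start M"
  "head_pos (run M [x, y] 0) i = 0"
  "content (run M [x, y] 0) i = (if i = 0 then tape_of x else if i = 1 then tape_of y else (\<lambda>_. 0))"
  by (auto simp: run_def initial_def tape_of_def less_Suc_eq)

lemma tapes_ge_2: "2 \<le> tapes M"
  using wf by (simp add: wf_tm_def)

lemma tiling_of_accepting:
  assumes y: "length y \<le> cert_len x" "accepts M [x, y]"
  shows "\<exists>X. tiling x X"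
proof -
  let ?N = "width x" and ?O = "origin x"
  define C where "C t = run M [x, y] t" for t
  \<comment> \<open>The end flag is given by the same formula in all rows, which makes it monotone
    along each row as \<open>horizontal\<close> demands.\<close>
  define X where "X c = (view M (C (c div ?N)) (int (c mod ?N) - int ?O),
     Suc (c mod ?N) = ?N, ?O + length y \<le> c mod ?N)" for c
  have N: "0 < ?N" by (simp add: width_def origin_def)
  have CSuc: "C (Suc t) = step M (C t)" for t by (simp add: C_def run_def)
  have "tiling x X"
    unfolding tiling_def
  proof (intro conjI allI impI)
    fix c
    show "X c \<in> tiles M"
      unfolding X_def C_def by (intro view_tiles valid_run wf)
    show "horizontal M (X c) (X (c + 1))"
    proof (cases "Suc (c mod ?N) = ?N")
      case False
      then have "Suc c mod ?N = Suc (c mod ?N)" "Suc c div ?N = c div ?N"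
        by (auto simp: mod_Suc div_Suc)
      then show ?thesis
        by (auto simp: horizontal_def X_def algebra_simps intro!: exI[of _ "C (c div ?N)"]
            exI[of _ "int (c mod ?N) - int ?O"])
    qed (simp add: horizontal_def X_def)
    show "vertical M (X c) (X (c + ?N))"
      using N by (auto simp: vertical_def X_def CSuc)
    show "unary_ok x c (X c)"
    proof -
      have row0: "c div ?N = 0" "c mod ?N = c" if "c < ?N" using that by auto
      have acc: "state (C (time x)) = accept M" using accepts_iff[OF y(1)] y(2) by (simp add: C_def)
      have O: "?O < ?N" "?O + cert_len x < ?N" by (auto simp: width_def origin_def)
      have t1: "tape_of y z = 0 \<longleftrightarrow> z < 0 \<or> int (length y) \<le> z" "tape_of y z < 3" for z
        by (auto simp: tape_of_def)
      show ?thesis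
      proof (cases "c < ?N")
        case True
        \<comment> \<open>The cell where acceptance is checked lies in the first row only if
          \<open>time x = 0\<close>.\<close>
        have "?N \<le> ?N * time x \<or> time x = 0" by auto
        then have "c = ?N * time x \<Longrightarrow> time x = 0" using True by auto
        then show ?thesis
          unfolding unary_ok_iff X_def using True row0[OF True] tapes_ge_2 y(1) acc O
          by (auto simp: C_def initial_sels t1)
      next
        case False
        then show ?thesis
          unfolding unary_ok_iff X_def using O acc N by auto
      qed
    qed
  qed
  then show ?thesis by blast
qed

text \<open>A certificate is read off the first row. Induction on rows then shows that each tile is
  a view of the actual run on it, although a priori it is only a view of some configuration.\<close>

lemma accepting_of_tiling:
  assumes X: "tiling x X"
  shows "\<exists>y. length y \<le> cert_len x \<and> accepts M [x, y]"
proof -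
  let ?N = "width x" and ?O = "origin x" and ?T = "time x" and ?K = "tapes M"
  define cell where "cell t j = X (t * ?N + j)" for t j
  define core where "core t j = fst (cell t j)" for t j
  have sizes: "?O = ?T + 2" "?N = ?O + ?O + cert_len x" by (simp_all add: origin_def width_def)
  have in_range: "t * ?N + j < ?N * (?T + 1)" if "t \<le> ?T" "j < ?N" for t j
  proof -
    have "t * ?N \<le> ?T * ?N" using that(1) by (rule mult_le_mono1)
    moreover have "?N * (?T + 1) = ?T * ?N + ?N" by simp
    ultimately show ?thesis using that(2) by linarith
  qed
  have unary: "unary_ok x j (cell 0 j)" if "j < ?N" for j
    using X in_range[of 0 j] that by (simp add: tiling_def cell_def)
  have vert: "vertical M (cell t j) (cell (Suc t) j)" if "t \<le> ?T" "j < ?N" for t j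
  proof -
    have "vertical M (X (t * ?N + j)) (X (t * ?N + j + ?N))"
      using X in_range[OF that] unfolding tiling_def by blast
    moreover have "t * ?N + j + ?N = Suc t * ?N + j" by simp
    ultimately show ?thesis unfolding cell_def by metis
  qed
  \<comment> \<open>The flag is fixed in the first row and passed down by \<open>vertical\<close>.
    Otherwise a tile could call itself last and thereby escape the horizontal condition.\<close>
  have lastc: "last_col (cell t j) \<longleftrightarrow> Suc j = ?N" if "t \<le> Suc ?T" "j < ?N" for t j
    using that(1)
  proof (induction t)
    case 0
    then show ?case using unary[OF that(2)] that(2) unfolding unary_ok_iff by (metis Suc_lessI)
  next
    case (Suc t)
    then show ?case using vert[of t j] that(2) by (simp add: vertical_def)
  qed
  have hor: "\<exists>C z. core t j = view M C z \<and> core t (Suc j) = view M C (z + 1)"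
    "ended (cell t j) \<Longrightarrow> ended (cell t (Suc j))"
    if "t \<le> ?T" "Suc j < ?N" for t j
  proof -
    have "horizontal M (cell t j) (cell t (Suc j))"
      using X in_range[of t j] that unfolding tiling_def cell_def by simp
    moreover have "\<not> last_col (cell t j)" using lastc[of t j] that by simp
    ultimately show "\<exists>C z. core t j = view M C z \<and> core t (Suc j) = view M C (z + 1)"
      "ended (cell t j) \<Longrightarrow> ended (cell t (Suc j))"
      by (auto simp: horizontal_def core_def)
  qed
  have vert': "\<exists>C z. core t j = view M C z \<and> core (Suc t) j = view M (step M C) z"
    if "t \<le> ?T" "j < ?N" for t j
    using vert[OF that] by (auto simp: vertical_def core_def)
  have same_reads: "view_reads (core t j) = view_reads (core t 0)" if tb: "t \<le> ?T" "j < ?N" for t j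
    using tb(2)
  proof (induction j)
    case (Suc j)
    obtain C z where "core t j = view M C z" "core t (Suc j) = view M C (z + 1)"
      using hor(1)[OF tb(1) Suc.prems] by blast
    then show ?case using Suc by simp
  qed simp
  \<comment> \<open>Only the symbols read are not fixed column by column. By \<open>bound\<close>
    the head of tape \<open>i\<close> is in the grid; the tile there has sign 0 and so reads its own
    content, and \<open>same_reads\<close> carries this along the row.\<close>
  have row: "core t j = view M C (int j - int ?O)"
    if t: "t \<le> ?T" and j: "j < ?N" and bound: "\<And>i. i < ?K \<Longrightarrow> \<bar>head_pos C i\<bar> \<le> int ?T"
      and st: "\<And>j. j < ?N \<Longrightarrow> view_state (core t j) = state C"
      and ct: "\<And>j i. j < ?N \<Longrightarrow> i < ?K \<Longrightarrow> view_contents (core t j) ! i = content C i (int j - int ?O)"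
      and fl: "\<And>j i. j < ?N \<Longrightarrow> i < ?K \<Longrightarrow> view_dirs (core t j) ! i = sgn (head_pos C i - (int j - int ?O))"
    for t j C
  proof (rule view_eqI)
    obtain D z where D: "core t j = view M D z" using vert'[OF t j] by blast
    show "view_state (core t j) = view_state (view M C (int j - int ?O))" using st[OF j] by simp
    show "view_contents (core t j) = view_contents (view M C (int j - int ?O))"
      using ct[OF j] by (intro nth_equalityI) (auto simp: D)
    show "view_dirs (core t j) = view_dirs (view M C (int j - int ?O))"
      using fl[OF j] by (intro nth_equalityI) (auto simp: D)
    show "view_reads (core t j) = view_reads (view M C (int j - int ?O))"
    proof (intro nth_equalityI)
      fix i assume "i < length (view_reads (core t j))"
      then have i: "i < ?K" by (simp add: D reads_def)
      define j' where "j' = nat (int ?O + head_pos C i)"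
      have "int j' = int ?O + head_pos C i" using bound[OF i] sizes by (simp add: j'_def)
      then have j': "j' < ?N" "int j' - int ?O = head_pos C i" using bound[OF i] sizes by auto
      obtain E z' where E: "core t j' = view M E z'" using vert'[OF t j'(1)] by blast
      have "sgn (head_pos E i - z') = 0" using fl[OF j'(1) i] i j'(2) by (simp add: E)
      then have "head_pos E i = z'" by (simp add: sgn_0_0)
      then have "view_reads (core t j') ! i = content C i (head_pos C i)"
        using ct[OF j'(1) i] i j'(2) by (simp add: E reads_def)
      then show "view_reads (core t j) ! i = view_reads (view M C (int j - int ?O)) ! i"
        using same_reads[OF t j] same_reads[OF t j'(1)] i by (simp add: reads_def)
    qed (simp add: D reads_def)
  qed
  \<comment> \<open>The certificate stops at the first column flagged as ended, at the latest after
    \<open>cert_len x\<close> symbols.\<close>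
  define k where "k = (LEAST i. i = cert_len x \<or> ended (cell 0 (?O + i)))"
  have k: "k = cert_len x \<or> ended (cell 0 (?O + k))" "k \<le> cert_len x"
    unfolding k_def by (rule LeastI[of _ "cert_len x"], simp) (rule Least_le, simp)
  have not_ended: "\<not> ended (cell 0 (?O + i))" if "i < k" for i
    using not_less_Least[of i] that unfolding k_def by blast
  \<comment> \<open>Monotonicity of the flag excludes a blank between two bits, so the nonblank part
    of tape 1 is a word.\<close>
  have all_ended: "ended (cell 0 (?O + i))" if "k \<le> i" "i < cert_len x" for i
    using that
  proof (induction i rule: dec_induct)
    case base
    then show ?case using k by auto
  next
    case (step i)
    then show ?case using hor(2)[of 0 "?O + i"] sizes by simp
  qed
  define y where "y = map (\<lambda>i. view_contents (core 0 (?O + i)) ! 1 = 2) [0..<k]"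
  define C where "C t = run M [x, y] t" for t
  have content1: "view_contents (core 0 j) ! 1 = tape_of y (int j - int ?O)" if j: "j < ?N" for j
  proof (cases "?O \<le> j \<and> j < ?O + cert_len x")
    case False
    then have "view_contents (core 0 j) ! 1 = 0"
      using unary[OF j] j unfolding unary_ok_iff core_def by blast
    then show ?thesis using False k(2) by (auto simp: tape_of_def y_def)
  next
    case True
    then obtain i where i: "j = ?O + i" "i < cert_len x" using le_Suc_ex by fastforce
    have c: "view_contents (core 0 j) ! 1 < 3" "view_contents (core 0 j) ! 1 = 0 \<longleftrightarrow> ended (cell 0 j)"
      using unary[OF j] True unfolding unary_ok_iff core_def by blast+
    show ?thesis
    proof (cases "i < k")
      case True
      then have "view_contents (core 0 j) ! 1 \<noteq> 0" using c(2) not_ended i by auto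
      then have "view_contents (core 0 j) ! 1 = 1 \<or> view_contents (core 0 j) ! 1 = 2" using c(1) by linarith
      then show ?thesis using True i by (auto simp: tape_of_def y_def)
    next
      case False
      then have "view_contents (core 0 j) ! 1 = 0" using c(2) all_ended i by auto
      then show ?thesis using False i by (auto simp: tape_of_def y_def)
    qed
  qed
  have bound: "\<bar>head_pos (C t) i\<bar> \<le> int ?T" if "i < ?K" "t \<le> ?T" for i t
    using head_pos_run_bound[OF that(1), of "[x, y]" t] that(2) by (simp add: C_def)
  have main: "\<forall>j < ?N. core t j = view M (C t) (int j - int ?O)" if "t \<le> ?T" for t
    using that
  proof (induction t)
    case 0
    show ?case
    proof (intro allI impI row)
      fix j assume j: "j < ?N"
      show "view_state (core 0 j) = state (C 0)"
        using unary[OF j] j unfolding unary_ok_iff core_def by (simp add: C_def initial_sels)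
      show "view_contents (core 0 j) ! i = content (C 0) i (int j - int ?O)" if "i < ?K" for i
      proof -
        have "view_contents (core 0 j) ! 0 = tape_of x (int j - int ?O)"
          "2 \<le> i \<Longrightarrow> view_contents (core 0 j) ! i = 0"
          using unary[OF j] j that unfolding unary_ok_iff core_def by blast+
        moreover have "i = 0 \<or> i = 1 \<or> 2 \<le> i" by linarith
        ultimately show ?thesis using content1[OF j] by (auto simp: C_def initial_sels)
      qed
      show "view_dirs (core 0 j) ! i = sgn (head_pos (C 0) i - (int j - int ?O))" if "i < ?K" for i
      proof -
        consider "j < ?O" | "j = ?O" | "?O < j" by linarith
        then show ?thesis
        proof cases
          case 1
          then have "view_dirs (core 0 j) ! i = 1"
            using unary[OF j] that unfolding unary_ok_iff core_def by blast
          then show ?thesis using 1 by (simp add: C_def initial_sels)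
        next
          case 2
          then have "view_dirs (core 0 j) ! i = 0"
            using unary[OF j] that unfolding unary_ok_iff core_def by blast
          then show ?thesis using 2 by (simp add: C_def initial_sels)
        next
          case 3
          then have "view_dirs (core 0 j) ! i = - 1"
            using unary[OF j] that j unfolding unary_ok_iff core_def by blast
          then show ?thesis using 3 by (simp add: C_def initial_sels)
        qed
      qed
    qed (use bound in auto)
  next
    case (Suc t)
    have t: "t \<le> ?T" using Suc.prems by simp
    have IH: "core t j = view M (C t) (int j - int ?O)" if "j < ?N" for j
      using Suc.IH[OF t] that by blast
    obtain q' acts where eff: "effect M (state (C t)) (reads M (C t)) = (q', acts)"
      by (cases "effect M (state (C t)) (reads M (C t))")
    have CSuc: "C (Suc t) = step M (C t)" by (simp add: C_def run_def)
    \<comment> \<open>\<open>effect\<close> depends only on the state and the symbols read, which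
      all tiles of row \<open>t\<close> share with \<open>C t\<close>. So the witnesses, though
      different in each column, make the same transition.\<close>
    have wit: "\<exists>D z. core (Suc t) j = view M (step M D) z \<and> effect M (state D) (reads M D) = (q', acts) \<and>
        (\<forall>i < ?K. content D i z = content (C t) i (int j - int ?O) \<and>
          sgn (head_pos D i - z) = sgn (head_pos (C t) i - (int j - int ?O)))"
      if j: "j < ?N" for j
    proof -
      obtain D z where D: "core t j = view M D z" "core (Suc t) j = view M (step M D) z"
        using vert'[OF t j] by blast
      have eq: "view M D z = view M (C t) (int j - int ?O)" using IH[OF j] D(1) by simp
      have "state D = state (C t)" "reads M D = reads M (C t)"
        using arg_cong[OF eq, of view_state] arg_cong[OF eq, of view_reads] by simp_all
      moreover have "content D i z = content (C t) i (int j - int ?O)" if "i < ?K" for i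
        using arg_cong[OF eq, of "\<lambda>v. view_contents v ! i"] that by simp
      moreover have "sgn (head_pos D i - z) = sgn (head_pos (C t) i - (int j - int ?O))" if "i < ?K" for i
        using arg_cong[OF eq, of "\<lambda>v. view_dirs v ! i"] that by simp
      ultimately show ?thesis using D(2) eff by metis
    qed
    show ?case
    proof (intro allI impI row)
      fix j assume j: "j < ?N"
      obtain D z where D: "core (Suc t) j = view M (step M D) z"
        "effect M (state D) (reads M D) = (q', acts)"
        "\<And>i. i < ?K \<Longrightarrow> content D i z = content (C t) i (int j - int ?O)"
        "\<And>i. i < ?K \<Longrightarrow> sgn (head_pos D i - z) = sgn (head_pos (C t) i - (int j - int ?O))"
        using wit[OF j] by blast
      have K: "0 < ?K" using tapes_ge_2 by simp
      show "view_state (core (Suc t) j) = state (C (Suc t))"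
        using step_effect(1)[OF D(2) K] step_effect(1)[OF eff K] by (simp add: D(1) CSuc)
      show "view_contents (core (Suc t) j) ! i = content (C (Suc t)) i (int j - int ?O)" if i: "i < ?K" for i
      proof -
        \<comment> \<open>Equal signs mean that the witness writes in this column iff the run
          does.\<close>
        have "z = head_pos D i \<longleftrightarrow> int j - int ?O = head_pos (C t) i"
          using D(4)[OF i] by (auto simp: sgn_if split: if_splits)
        then show ?thesis
          using step_effect(3)[OF D(2) i] step_effect(3)[OF eff i] D(3)[OF i] i by (simp add: D(1) CSuc)
      qed
      show "view_dirs (core (Suc t) j) ! i = sgn (head_pos (C (Suc t)) i - (int j - int ?O))"
        if i: "i < ?K" for i
      proof -
        define f where "f z = view_dirs (core (Suc t) (nat (z + int ?O))) ! i" for z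
        let ?k = "offset (snd (acts ! i))"
        have "f (int j - int ?O) = sgn (head_pos (C t) i + ?k - (int j - int ?O))"
        proof (rule flags_determined[OF offset_cases, where lo = "- int ?O" and hi = "int ?N - int ?O"])
          show "- int ?O \<le> head_pos (C t) i" "head_pos (C t) i < int ?N - int ?O"
            using bound[OF i t] sizes by auto
          fix u assume u: "- int ?O \<le> u"
          show "\<exists>h' z'. sgn (h' - z') = sgn (head_pos (C t) i - u) \<and> f u = sgn (h' + ?k - z')"
            if "u < int ?N - int ?O"
          proof -
            have j': "nat (u + int ?O) < ?N" "int (nat (u + int ?O)) - int ?O = u" using u that by auto
            obtain E z' where E: "core (Suc t) (nat (u + int ?O)) = view M (step M E) z'"
              "effect M (state E) (reads M E) = (q', acts)"
              "\<And>i. i < ?K \<Longrightarrow> sgn (head_pos E i - z') = sgn (head_pos (C t) i - u)"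
              using wit[OF j'(1)] unfolding j'(2) by blast
            have "f u = sgn (head_pos E i + ?k - z')"
              using step_effect(2)[OF E(2) i] i by (simp add: f_def E(1))
            then show ?thesis using E(3)[OF i] by blast
          qed
          show "\<exists>h'. f u = sgn h' \<and> f (u + 1) = sgn (h' - 1)" if "u + 1 < int ?N - int ?O"
          proof -
            have "Suc (nat (u + int ?O)) < ?N" "nat (u + 1 + int ?O) = Suc (nat (u + int ?O))"
              using u that by auto
            then obtain E z' where "core (Suc t) (nat (u + int ?O)) = view M E z'"
              "core (Suc t) (nat (u + 1 + int ?O)) = view M E (z' + 1)"
              using hor(1)[OF Suc.prems] by metis
            then show ?thesis using i
              by (intro exI[of _ "head_pos E i - z'"]) (simp add: f_def algebra_simps)
          qed
        qed (use j in auto)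
        then show ?thesis using step_effect(2)[OF eff i] by (simp add: f_def CSuc)
      qed
    qed (use bound Suc.prems in auto)
  qed
  have "0 < ?N" using sizes by simp
  \<comment> \<open>This is column 0 of row \<open>?T\<close>; it speaks for the whole row, as every
    tile carries the state.\<close>
  have "unary_ok x (?T * ?N) (cell ?T 0)"
    using X in_range[of ?T 0] \<open>0 < ?N\<close> by (simp add: tiling_def cell_def)
  then have "view_state (core ?T 0) = accept M"
    unfolding unary_ok_iff core_def by (simp add: mult.commute)
  then have "state (C ?T) = accept M" using main[of ?T] \<open>0 < ?N\<close> by simp
  moreover have "length y \<le> cert_len x" using k(2) by (simp add: y_def)
  ultimately show ?thesis using accepts_iff[of y x] by (auto simp: C_def)
qed

theorem tiling_iff: "(\<exists>X. tiling x X) \<longleftrightarrow> (\<exists>y. length y \<le> cert_len x \<and> accepts M [x, y])"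
  using tiling_of_accepting accepting_of_tiling by blast

end

section \<open>Tilings as solutions of a constraint table\<close>

context verifier
begin

definition tile_list :: "tile list" where
  "tile_list = (SOME ts. set ts = tiles M \<and> distinct ts)"

lemma tile_list: "set tile_list = tiles M" "distinct tile_list"
proof -
  have "\<exists>ts. set ts = tiles M \<and> distinct ts"
    by (rule finite_distinct_list[OF finite_tiles])
  then have "set tile_list = tiles M \<and> distinct tile_list"
    unfolding tile_list_def by (rule someI_ex)
  then show "set tile_list = tiles M" "distinct tile_list" by auto
qed

abbreviation "n_tiles \<equiv> length tile_list"

text \<open>The implication from \<open>g\<close> to \<open>P\<close> as a disjunction over tiles: a
  tile with \<open>P\<close> always helps, any other only when the guard \<open>g\<close> is
  0.\<close>

definition unary_entries :: "expr \<times> (tile \<Rightarrow> bool) \<Rightarrow> (expr \<times> nat \<times> expr) list" where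
  "unary_entries = (\<lambda>(g, P). map (\<lambda>a. (Const 0, a, if P (tile_list ! a) then Const 1 else not_expr g))
     [0..<n_tiles])"

text \<open>The clause "not \<open>a\<close> here, or not \<open>b\<close> at \<open>off\<close>"
  written with positive choices. If the pair is allowed, \<open>a\<close> is listed too and the
  clause always holds.\<close>

definition pair_entries ::
  "expr \<Rightarrow> (tile \<Rightarrow> tile \<Rightarrow> bool) \<Rightarrow> nat \<Rightarrow> nat \<Rightarrow> (expr \<times> nat \<times> expr) list" where
  "pair_entries off rel a b =
     map (\<lambda>c. (Const 0, c, Const 1))
       (filter (\<lambda>c. c \<noteq> a \<or> rel (tile_list ! a) (tile_list ! b)) [0..<n_tiles]) @
     map (\<lambda>c. (off, c, Const 1)) (filter (\<lambda>c. c \<noteq> b) [0..<n_tiles])"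

definition pair_table :: "expr \<Rightarrow> (tile \<Rightarrow> tile \<Rightarrow> bool) \<Rightarrow> (expr \<times> nat \<times> expr) list list" where
  "pair_table off rel = concat (map (\<lambda>a. map (pair_entries off rel a) [0..<n_tiles]) [0..<n_tiles])"

definition table :: "(expr \<times> nat \<times> expr) list list" where
  "table = map unary_entries unary @ pair_table (Const 1) (horizontal M) @
     pair_table width_expr (vertical M)"

definition entries_sat :: "bool list \<Rightarrow> (nat \<Rightarrow> nat) \<Rightarrow> nat \<Rightarrow> (expr \<times> nat \<times> expr) list \<Rightarrow> bool" where
  "entries_sat x X c es \<longleftrightarrow> (\<exists>(off, a, g) \<in> set es.
     X (c + val x off (env x c)) = a \<and> val x g (env x c) \<noteq> 0)"

lemma set_table:
  "set table = unary_entries ` set unary \<union>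
    {pair_entries (Const 1) (horizontal M) a b | a b. a < n_tiles \<and> b < n_tiles} \<union>
    {pair_entries width_expr (vertical M) a b | a b. a < n_tiles \<and> b < n_tiles}"
  by (auto simp: table_def pair_table_def)

lemma entries_sat_unary:
  assumes "X c < n_tiles"
  shows "entries_sat x X c (unary_entries (g, P)) \<longleftrightarrow>
    (val x g (env x c) \<noteq> 0 \<longrightarrow> P (tile_list ! X c))"
  using assms by (auto simp: entries_sat_def unary_entries_def val_not_expr)

lemma entries_sat_pair:
  assumes "X c < n_tiles" "X (c + val x off (env x c)) < n_tiles"
  shows "entries_sat x X c (pair_entries off rel a b) \<longleftrightarrow>
    (X c = a \<longrightarrow> X (c + val x off (env x c)) = b \<longrightarrow> rel (tile_list ! a) (tile_list ! b))"
  using assms by (auto simp: entries_sat_def pair_entries_def bex_Un)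

definition cells_expr :: expr where "cells_expr = Mul width_expr (Add time_expr (Const 2))"
definition rows_expr :: expr where "rows_expr = Mul width_expr (Add time_expr (Const 1))"

lemma val_cells_rows:
  "val x cells_expr (env x c) = width x * (time x + 2)"
  "val x rows_expr (env x c) = width x * (time x + 1)"
  by (simp_all only: cells_expr_def rows_expr_def val.simps val_exprs)

lemma width_gt_1: "1 < width x"
  by (simp add: width_def origin_def)

lemma table_entry:
  assumes "es \<in> set table" "(off, a, g) \<in> set es"
  shows "off \<in> {Const 0, Const 1, width_expr}" "a < n_tiles"
    "vars g \<subseteq> {0, 1}" "val x g (env x c) \<le> 1"
proof -
  have *: "off \<in> {Const 0, Const 1, width_expr} \<and> a < n_tiles \<and>
      (g = Const 1 \<or> (\<exists>g' P. (g', P) \<in> set unary \<and> g = not_expr g'))"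
    using assms by (fastforce simp: set_table unary_entries_def pair_entries_def split: if_splits)
  then show "off \<in> {Const 0, Const 1, width_expr}" "a < n_tiles" by blast+
  from * consider "g = Const 1" | g' P where "(g', P) \<in> set unary" "g = not_expr g'" by blast
  then have "vars g \<subseteq> {0, 1} \<and> val x g (env x c) \<le> 1"
  proof cases
    case 2
    then show ?thesis using unary_guard(2)[OF 2(1)] by (simp add: vars_bool_expr val_not_expr)
  qed simp
  then show "vars g \<subseteq> {0, 1}" "val x g (env x c) \<le> 1" by blast+
qed

lemma constraint_table: "constraint_table cells_expr rows_expr n_tiles table"
proof
  show "vars cells_expr \<subseteq> {0}" "vars rows_expr \<subseteq> {0}"
    using vars_exprs by (auto simp: cells_expr_def rows_expr_def)
  show "vars off \<subseteq> {0, 1} \<and> vars g \<subseteq> {0, 1}" if "es \<in> set table" "(off, a, g) \<in> set es" for es off a g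
    using table_entry(1,3)[OF that] vars_exprs(4) by auto
  show "0 < n_tiles"
    using tile_list(1) view_tiles[OF valid_run[OF wf], of "[]" 0 0 True True] by (metis length_pos_if_in_set)
  show "0 < val x cells_expr (env x 0)" for x
    using width_gt_1[of x] by (simp add: val_cells_rows)
  show "a < n_tiles" if "es \<in> set table" "(off, a, g) \<in> set es" for es off a g
    by (rule table_entry(2)[OF that])
  show "c + val x off (env x c) < val x cells_expr (env x 0)"
    if "c < val x rows_expr (env x 0)" "es \<in> set table" "(off, a, g) \<in> set es" for x c es off a g
  proof -
    have "val x off (env x c) \<le> width x"
      using table_entry(1)[OF that(2,3)] width_gt_1[of x] by (auto simp: val_exprs)
    then show ?thesis using that(1) by (simp add: val_cells_rows)
  qed
  show "val x g (env x c) \<le> 1" if "es \<in> set table" "(off, a, g) \<in> set es" for x c es off a g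
    by (rule table_entry(4)[OF that])
  \<comment> \<open>The two halves of a pair clause may list the same tiles; they stay apart because
    one offset is 0 and the other is 1 or the positive width.\<close>
  show "distinct (map (\<lambda>(off, a, g). (val x off (env x c), a)) es)" if "es \<in> set table" for x c es
  proof -
    have "Const 0 \<noteq> width_expr" by (simp add: width_expr_def)
    then show ?thesis
      using that width_gt_1[of x] unfolding set_table
      by (auto simp: unary_entries_def pair_entries_def distinct_map inj_on_def val_exprs)
  qed
qed

sublocale tab: constraint_table cells_expr rows_expr n_tiles table
  by (rule constraint_table)

lemma table_solvable_iff:
  "(\<exists>X. (\<forall>c < width x * (time x + 2). X c < n_tiles) \<and>
     (\<forall>c < width x * (time x + 1). \<forall>\<tau> < length table. tab.satisfies x X c \<tau>)) \<longleftrightarrow>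
   (\<exists>X. tiling x X)"
proof -
  let ?m = "width x * (time x + 1)" and ?L = "width x * (time x + 2)"
  have next_cell: "c + 1 < ?L" "c + width x < ?L" "c < ?L" if "c < ?m" for c
    using that width_gt_1[of x] by auto
  have sat: "(\<forall>\<tau> < length table. tab.satisfies x X c \<tau>) \<longleftrightarrow>
     horizontal M (tile_list ! X c) (tile_list ! X (c + 1)) \<and>
     vertical M (tile_list ! X c) (tile_list ! X (c + width x)) \<and> unary_ok x c (tile_list ! X c)"
    if X: "\<forall>c < ?L. X c < n_tiles" and c: "c < ?m" for X c
  proof -
    have lt: "X c < n_tiles" "X (c + 1) < n_tiles" "X (c + width x) < n_tiles"
      using X next_cell[OF c] by auto
    have "(\<forall>\<tau> < length table. tab.satisfies x X c \<tau>) \<longleftrightarrow> (\<forall>es \<in> set table. entries_sat x X c es)"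
      by (auto simp: tab.satisfies_def entries_sat_def all_set_conv_all_nth)
    also have "\<dots> \<longleftrightarrow> (\<forall>(g, P) \<in> set unary. entries_sat x X c (unary_entries (g, P))) \<and>
      (\<forall>a < n_tiles. \<forall>b < n_tiles. entries_sat x X c (pair_entries (Const 1) (horizontal M) a b)) \<and>
      (\<forall>a < n_tiles. \<forall>b < n_tiles. entries_sat x X c (pair_entries width_expr (vertical M) a b))"
      unfolding set_table ball_Un conj_assoc by (intro arg_cong2[where f = conj]) (auto simp: split_beta)
    also have "\<dots> \<longleftrightarrow> unary_ok x c (tile_list ! X c) \<and>
      horizontal M (tile_list ! X c) (tile_list ! X (c + 1)) \<and>
      vertical M (tile_list ! X c) (tile_list ! X (c + width x))"
      using lt by (auto simp: unary_ok_def entries_sat_unary entries_sat_pair val_exprs)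
    finally show ?thesis by blast
  qed
  show ?thesis
  proof
    assume "\<exists>X. (\<forall>c < ?L. X c < n_tiles) \<and> (\<forall>c < ?m. \<forall>\<tau> < length table. tab.satisfies x X c \<tau>)"
    then obtain X where X: "\<forall>c < ?L. X c < n_tiles"
      "\<forall>c < ?m. \<forall>\<tau> < length table. tab.satisfies x X c \<tau>" by blast
    have "tile_list ! X c \<in> tiles M" if "c < ?L" for c
      using X(1) that tile_list(1) nth_mem by blast
    then have "tiling x (\<lambda>c. tile_list ! X c)"
      unfolding tiling_def using X(2) sat[OF X(1)] by blast
    then show "\<exists>X. tiling x X" by blast
  next
    assume "\<exists>X. tiling x X"
    then obtain Y where Y: "tiling x Y" by blast
    have "\<exists>a < n_tiles. tile_list ! a = Y c" if "c < ?L" for c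
      using Y that tile_list(1) unfolding tiling_def by (metis in_set_conv_nth)
    then obtain X where X: "\<And>c. c < ?L \<Longrightarrow> X c < n_tiles \<and> tile_list ! X c = Y c" by metis
    have "\<forall>\<tau> < length table. tab.satisfies x X c \<tau>" if c: "c < ?m" for c
      using sat[of X c] X Y c next_cell[OF c] unfolding tiling_def by simp
    then show "\<exists>X. (\<forall>c < ?L. X c < n_tiles) \<and> (\<forall>c < ?m. \<forall>\<tau> < length table. tab.satisfies x X c \<tau>)"
      using X by blast
  qed
qed

lemma poly_reducible_verifier:
  assumes "\<And>x. x \<in> A \<longleftrightarrow> (\<exists>y. length y \<le> poly p (length x) \<and> accepts M [x, y])"
  shows "poly_reducible A degree_language"
proof (rule tab.poly_reducible_table)
  show "x \<in> A \<longleftrightarrow> (\<exists>X. (\<forall>c < val x cells_expr (env x 0). X c < n_tiles) \<and>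
      (\<forall>c < val x rows_expr (env x 0). \<forall>\<tau> < length table. tab.satisfies x X c \<tau>))" for x
    unfolding val_cells_rows table_solvable_iff tiling_iff using assms[of x] by (simp add: cert_len_def)
qed

end

theorem corollary1:
  shows "NP_hard_max
           {(G, w). weighted_graph G w}
           (\<lambda>(G, w). graph_codes G w)
           (\<lambda>(G, w). shortest_paths G w)
           (\<lambda>(G, w). path_degree G)"
  unfolding NP_hard_max_def NP_hard_def
proof
  fix A assume "A \<in> NP"
  then obtain M and p :: "nat poly" where M: "poly_time_tm 2 M"
    and A: "\<And>x. x \<in> A \<longleftrightarrow> (\<exists>c. length c \<le> poly p (length x) \<and> accepts M [x, c])"
    unfolding NP_def by blast
  obtain q :: "nat poly" where "wf_tm M"
    "\<And>xs. length xs = 2 \<Longrightarrow> halted M (run M xs (poly q (sum_list (map length xs))))"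
    using M unfolding poly_time_tm_def by blast
  then interpret verifier M p q by unfold_locales
  show "poly_reducible A degree_language" by (rule poly_reducible_verifier[OF A])
qed

end
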